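(* Let $N\ge1$, $0<b<2$, $\frac{2-b}{N}<\sigma<\frac{2-b}{N-2}$ ($\frac{2-b}{N}<\sigma<\infty$ if $N=1,2$) and $\sigma_c=\frac{2N\sigma}{2-b}$. Then the embedding $$\dot H^1(\mathbb{R}^N)\cap L^{\sigma_c}(\mathbb{R}^N)\subset L^{2\sigma+2}_b(\mathbb{R}^N)$$ is compact.
   Context: $\dot H^1(\mathbb{R}^N)$ is the homogeneous Sobolev space with norm $\|\nabla f\|_{L^2}$. $L^{2\sigma+2}_b(\mathbb{R}^N)$ is the space of measurable functions $f:\mathbb{R}^N\to\mathbb{C}$ with $\int|x|^{-b}|f|^{2\sigma+2}\,dx<\infty$, equipped with the norm $\|f\|_{L^{2\sigma+2}_b}=\left(\int|x|^{-b}|f|^{2\sigma+2}\,dx\right)^{\frac1{2\sigma+2}}$.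
   Formalization: The hypothesis b < N is added; it excludes only N = 1 with 1 ≤ b < 2, where the claim fails: a smooth compactly supported f with f(0) = 1 lies in the intersection, but |x|^{-b}|f|^{2σ+2} is not integrable at 0. *)

theory Defs
  imports "HOL-Analysis.Analysis"
begin

text \<open>
  Function spaces are sets of genuine functions; functions that agree almost everywhere are not
  identified, so the "norms" below are seminorms that vanish exactly on the class of zero.
\<close>

text \<open>
  Infinite differentiability, witnessed by the family of all iterated partial derivatives:
  \<open>D [i, j, ...]\<close> is the partial derivative in direction \<open>i\<close> of \<open>D [j, ...]\<close>. Each member is
  required to be (totally) differentiable, so all of them are continuous.
\<close>

definition smooth :: "(real^'n \<Rightarrow> real) \<Rightarrow> bool" where
  "smooth \<phi> \<longleftrightarrow> (\<exists>D :: 'n list \<Rightarrow> real^'n \<Rightarrow> real. D [] = \<phi> \<and>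
     (\<forall>is x. (D is has_derivative (\<lambda>h. \<Sum>i\<in>UNIV. h $ i * D (i # is) x)) (at x)))"

definition test_function :: "(real^'n \<Rightarrow> real) \<Rightarrow> bool" where
  "test_function \<phi> \<longleftrightarrow> smooth \<phi> \<and> compact (closure {x. \<phi> x \<noteq> 0})"

definition partial_deriv :: "'n \<Rightarrow> (real^'n \<Rightarrow> real) \<Rightarrow> real^'n \<Rightarrow> real" where
  "partial_deriv i \<phi> x = frechet_derivative \<phi> (at x) (axis i 1)"

definition locally_integrable ::
    "(real^'n \<Rightarrow> 'b::{banach, second_countable_topology}) \<Rightarrow> bool" where
  "locally_integrable f \<longleftrightarrow> f \<in> borel_measurable lebesgue \<and>
     (\<forall>K. compact K \<longrightarrow> set_integrable lebesgue K f)"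

definition has_weak_gradient :: "(real^'n \<Rightarrow> complex) \<Rightarrow> (real^'n \<Rightarrow> complex^'n) \<Rightarrow> bool" where
  "has_weak_gradient f g \<longleftrightarrow> locally_integrable f \<and> locally_integrable g \<and>
     (\<forall>\<phi> i. test_function \<phi> \<longrightarrow>
        (LINT x|lebesgue. partial_deriv i \<phi> x *\<^sub>R f x) = - (LINT x|lebesgue. \<phi> x *\<^sub>R (g x $ i)))"

text \<open>Weak gradients are unique up to null sets; a representative is chosen.\<close>

definition weak_gradient :: "(real^'n \<Rightarrow> complex) \<Rightarrow> real^'n \<Rightarrow> complex^'n" where
  "weak_gradient f = (SOME g. has_weak_gradient f g)"

definition Lp_space :: "real \<Rightarrow> (real^'n \<Rightarrow> 'b::{banach, second_countable_topology}) set" where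
  "Lp_space p = {f. f \<in> borel_measurable lebesgue \<and>
     integrable lebesgue (\<lambda>x. norm (f x) powr p)}"

definition Lp_norm :: "real \<Rightarrow> (real^'n \<Rightarrow> 'b::{banach, second_countable_topology}) \<Rightarrow> real" where
  "Lp_norm p f = (LINT x|lebesgue. norm (f x) powr p) powr (1 / p)"

text \<open>
  The space of functions with \<open>\<integral> |x|\<^sup>-\<^sup>b |f|\<^sup>p dx\<close> finite. At the origin \<open>norm x powr (- b)\<close> is 0
  instead of infinity, which is immaterial because a point is a null set.
\<close>

definition weighted_Lp_space :: "real \<Rightarrow> real \<Rightarrow> (real^'n \<Rightarrow> complex) set" where
  "weighted_Lp_space b p = {f. f \<in> borel_measurable lebesgue \<and>
     integrable lebesgue (\<lambda>x. norm x powr (- b) * norm (f x) powr p)}"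

definition weighted_Lp_norm :: "real \<Rightarrow> real \<Rightarrow> (real^'n \<Rightarrow> complex) \<Rightarrow> real" where
  "weighted_Lp_norm b p f =
     (LINT x|lebesgue. norm x powr (- b) * norm (f x) powr p) powr (1 / p)"

definition hom_sobolev :: "(real^'n \<Rightarrow> complex) set" where
  "hom_sobolev = {f. \<exists>g. has_weak_gradient f g \<and> g \<in> Lp_space 2}"

definition hom_sobolev_norm :: "(real^'n \<Rightarrow> complex) \<Rightarrow> real" where
  "hom_sobolev_norm f = Lp_norm 2 (weak_gradient f)"

text \<open>
  \<open>X\<close>, \<open>Y\<close> are linear spaces of functions with (semi)norms \<open>normX\<close>, \<open>normY\<close>: \<open>X\<close> is contained in
  \<open>Y\<close>, the inclusion is bounded, and it maps bounded sequences to sequences with a subsequence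
  converging in \<open>Y\<close>.
\<close>

definition compact_embedding ::
    "('a \<Rightarrow> complex) set \<Rightarrow> (('a \<Rightarrow> complex) \<Rightarrow> real) \<Rightarrow>
     ('a \<Rightarrow> complex) set \<Rightarrow> (('a \<Rightarrow> complex) \<Rightarrow> real) \<Rightarrow> bool" where
  "compact_embedding X normX Y normY \<longleftrightarrow>
     X \<subseteq> Y \<and>
     (\<exists>C. \<forall>f\<in>X. normY f \<le> C * normX f) \<and>
     (\<forall>u :: nat \<Rightarrow> 'a \<Rightarrow> complex. (\<forall>n. u n \<in> X) \<and> (\<exists>M. \<forall>n. normX (u n) \<le> M) \<longrightarrow>
        (\<exists>l\<in>Y. \<exists>r :: nat \<Rightarrow> nat. strict_mono r \<and>
           (\<lambda>k. normY (\<lambda>x. u (r k) x - l x)) \<longlonglongrightarrow> 0))"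

end

theory Submission
  imports Defs "HOL-Complex_Analysis.Great_Picard"
begin

text \<open>
  Write \<open>N\<close> for the dimension, \<open>p = 2 \<sigma> + 2\<close>, and \<open>f\<^sub>t\<close> for the mollification of \<open>f\<close> at scale \<open>t\<close>.
  Everything rests on comparing \<open>f\<close> with \<open>f\<^sub>t\<close> along the scales \<open>t = 2^(-k)\<close>.

  Differentiating the kernel in the scale gives the divergence of a compactly supported field,
  so the weak gradient \<open>g\<close> controls one dyadic step (\<open>mollify_dyadic_difference\<close>):
  \<open>|f\<^sub>t(x) - f_(t/2)(x)| \<le> C t^(1-N) \<integral> |g|\<close> over the ball of radius \<open>t\<close> about \<open>x\<close>. Cauchy-Schwarz and
  Tonelli turn this into the bounds \<open>C t^(1-N/2) G\<close> in the supremum norm and \<open>C t G\<close> in \<open>L\<^sup>2\<close>, where \<open>G\<close>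
  is the \<open>L\<^sup>2\<close> norm of \<open>g\<close>. Using the first bound inside the ball of radius \<open>t\<close> about the origin and
  both bounds outside it yields \<open>\<integral> |x|^(-b) |f\<^sub>t - f_(t/2)|\<^sup>p dx \<le> C t\<^sup>\<alpha> G\<^sup>p\<close> with
  \<open>\<alpha> = N - b - p (N/2 - 1)\<close> (\<open>dyadic_difference_weighted\<close>), and \<open>\<alpha> > 0\<close> is exactly the condition
  \<open>\<sigma> (N - 2) < 2 - b\<close>. The steps therefore sum up geometrically: \<open>f - f\<^sub>t\<close> is small in the weighted
  norm, uniformly over functions with bounded \<open>G\<close> (\<open>mollify_approximation\<close>). The same estimate with
  \<open>b = 0\<close> and the exponent \<open>\<sigma>\<^sub>c\<close> in place of \<open>p\<close> keeps the \<open>\<sigma>\<^sub>c\<close> norm of \<open>f\<^sub>t\<close> bounded.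

  For a bounded sequence and a fixed scale, the mollified functions are uniformly bounded and
  equicontinuous, so a diagonal subsequence converges pointwise at all dyadic scales
  (\<open>mollify_subsequence_pointwise\<close>). Pointwise convergence becomes convergence in the weighted
  norm because \<open>|x|^(-b)\<close> is integrable at the origin and, far away, the decay of the weight
  together with the bound on the \<open>\<sigma>\<^sub>c\<close> norm leaves a uniformly small tail
  (\<open>weighted_energy_tendsto_0\<close>); this again uses \<open>\<sigma> (N - 2) < 2 - b\<close>. The pointwise limits inherit
  the dyadic step estimate, so they converge in turn as the scale tends to 0, and their limit is
  the limit of the subsequence (\<open>bounded_sequence_has_convergent_subsequence\<close>).
\<close>

section \<open>Smooth functions generated by the exponential of a reciprocal\<close>

text \<open>
  The derivative of \<open>flat m\<close> is a combination of \<open>flat (m + 2)\<close> and \<open>flat (m + 1)\<close>; carrying the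
  negative power of \<open>s\<close> along makes the family closed under differentiation.
\<close>

definition flat :: "nat \<Rightarrow> real \<Rightarrow> real" where
  "flat m s = (if 0 < s then exp (- (1 / s)) / s ^ m else 0)"

lemma flat_nonneg: "0 \<le> flat m s"
  by (simp add: flat_def)

lemma power_le_fact_exp: "0 \<le> u \<Longrightarrow> u ^ n \<le> fact n * exp (u::real)"
proof -
  assume u: "0 \<le> u"
  have "(\<Sum>k\<in>{n}. u ^ k /\<^sub>R fact k) \<le> (\<Sum>k. u ^ k /\<^sub>R fact k)"
    using u by (intro sum_le_suminf summable_exp_generic) auto
  then have "u ^ n / fact n \<le> exp u"
    by (simp add: exp_def divide_inverse mult.commute)
  then show ?thesis by (simp add: field_simps)
qed

text \<open>
  Flatness at 0 of every order: \<open>exp u\<close> dominates its Taylor term \<open>u^(m+k) / (m + k)!\<close> at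
  \<open>u = 1 / s\<close>.
\<close>

lemma flat_le_power: "0 \<le> s \<Longrightarrow> flat m s \<le> fact (m + k) * s ^ k"
proof (cases "0 < s")
  case True
  have "(1/s) ^ (m+k) \<le> fact (m+k) * exp (1/s)"
    using True by (intro power_le_fact_exp) auto
  then have "exp (-(1/s)) * (1/s) ^ (m+k) \<le> exp (-(1/s)) * (fact (m+k) * exp (1/s))"
    by (intro mult_left_mono) auto
  also have "\<dots> = fact (m+k) * (exp (-(1/s)) * exp (1/s))"
    by (simp only: ac_simps)
  also have "\<dots> = fact (m+k)"
    by (simp add: exp_minus)
  finally have "exp (-(1/s)) * (1/s) ^ (m+k) \<le> fact (m+k)" .
  then have "exp (-(1/s)) * (1/s) ^ (m+k) * s ^ k \<le> fact (m+k) * s ^ k"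
    using True by (intro mult_right_mono) auto
  moreover have "exp (-(1/s)) * (1/s) ^ (m+k) * s ^ k = flat m s"
    using True by (simp add: flat_def power_add field_simps)
  ultimately show ?thesis by simp
qed (auto simp: flat_def)

lemma flat_le_fact: "flat m s \<le> fact m"
  using flat_le_power[of s m 0] by (cases "0 \<le> s") (auto simp: flat_def)

lemma flat_le_quadratic: "flat m s \<le> fact (m + 2) * s\<^sup>2"
  using flat_le_power[of s m 2] by (cases "0 \<le> s") (auto simp: flat_def)

lemma flat_has_real_derivative:
  "(flat m has_real_derivative (flat (m + 2) s - real m * flat (Suc m) s)) (at s)"
proof -
  consider "s < 0" | "s = 0" | "0 < s" by linarith
  then show ?thesis
  proof cases
    case 1
    have "((\<lambda>_. 0) has_real_derivative 0) (at s)" by simp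
    then have "(flat m has_real_derivative 0) (at s)"
      by (rule has_field_derivative_transform_within_open[where S="{..<0}"])
         (use 1 in \<open>auto simp: flat_def\<close>)
    then show ?thesis using 1 by (simp add: flat_def)
  next
    case 2
    have "((\<lambda>h. flat m h / h) \<longlongrightarrow> 0) (at 0)"
    proof (rule Lim_null_comparison)
      show "\<forall>\<^sub>F h in at 0. norm (flat m h / h) \<le> fact (m + 2) * \<bar>h\<bar>"
      proof (rule eventually_at_filter[THEN iffD2], rule always_eventually, intro allI impI)
        fix h :: real assume "h \<noteq> 0"
        then have "\<bar>flat m h\<bar> / \<bar>h\<bar> \<le> fact (m + 2) * \<bar>h\<bar>\<^sup>2 / \<bar>h\<bar>"
          using flat_le_quadratic[of m h] flat_nonneg[of m h]
          by (intro divide_right_mono) (simp_all del: fact_Suc add: )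
        also have "\<dots> = fact (m + 2) * \<bar>h\<bar>"
          using \<open>h \<noteq> 0\<close> by (simp only: power2_eq_square times_divide_eq_right[symmetric]) simp
        finally show "norm (flat m h / h) \<le> fact (m + 2) * \<bar>h\<bar>"
          by simp
      qed
      show "((\<lambda>h. fact (m + 2) * \<bar>h\<bar>) \<longlongrightarrow> 0) (at (0::real))"
        by (auto intro!: tendsto_eq_intros)
    qed
    then show ?thesis using 2
      by (simp add: has_field_derivative_iff flat_def)
  next
    case 3
    have "((\<lambda>s. exp (- (1 / s)) / s ^ m) has_real_derivative
        (exp (- (1 / s)) * (1 / s\<^sup>2) * s ^ m - exp (- (1 / s)) * (real m * s ^ (m - 1))) / (s ^ m * s ^ m)) (at s)"
      using 3 by (auto intro!: derivative_eq_intros simp: power2_eq_square)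
    also have "(exp (- (1 / s)) * (1 / s\<^sup>2) * s ^ m - exp (- (1 / s)) * (real m * s ^ (m - 1))) / (s ^ m * s ^ m)
      = flat (m + 2) s - real m * flat (Suc m) s"
      using 3 by (cases m) (simp_all add: flat_def field_simps power2_eq_square)
    finally have "((\<lambda>s. exp (- (1 / s)) / s ^ m) has_real_derivative
        (flat (m + 2) s - real m * flat (Suc m) s)) (at s)" .
    then show ?thesis
      by (rule has_field_derivative_transform_within_open[where S="{0<..}"])
         (use 3 in \<open>auto simp: flat_def\<close>)
  qed
qed

lemma flat_isCont: "isCont (flat m) s"
  using flat_has_real_derivative DERIV_isCont by blast

text \<open>
  Smoothness asks for a whole family of iterated partial derivatives. It is enough to exhibit a
  class of functions that contains the function in question and the partial derivatives of all
  its members; this class is generated just richly enough to contain the mollifier and its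
  products with coordinates.
\<close>

inductive flat_alg :: "(real^'n \<Rightarrow> real) \<Rightarrow> bool" where
  const: "flat_alg (\<lambda>_. c)"
| coord: "flat_alg (\<lambda>x. x $ i)"
| flat: "flat_alg q \<Longrightarrow> flat_alg (\<lambda>x. flat m (q x))"
| add: "flat_alg p \<Longrightarrow> flat_alg q \<Longrightarrow> flat_alg (\<lambda>x. p x + q x)"
| mult: "flat_alg p \<Longrightarrow> flat_alg q \<Longrightarrow> flat_alg (\<lambda>x. p x * q x)"

lemma flat_alg_sum: "finite I \<Longrightarrow> (\<And>i. i \<in> I \<Longrightarrow> flat_alg (p i)) \<Longrightarrow> flat_alg (\<lambda>x. \<Sum>i\<in>I. p i x)"
  by (induction I rule: finite_induct) (auto intro: flat_alg.intros)

lemma flat_alg_deriv: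
  "flat_alg (p :: real^'n \<Rightarrow> real) \<Longrightarrow> \<exists>d. (\<forall>i. flat_alg (d i)) \<and>
     (\<forall>x. (p has_derivative (\<lambda>h. \<Sum>i\<in>UNIV. h $ i * d i x)) (at x))"
proof (induction rule: flat_alg.induct)
  case (const c)
  then show ?case by (intro exI[of _ "\<lambda>_ _. 0"]) (auto intro: flat_alg.intros)
next
  case (coord j)
  have "((\<lambda>x::real^'n. x $ j) has_derivative (\<lambda>h. h $ j)) (at x)" for x
    by (simp add: bounded_linear_imp_has_derivative bounded_linear_vec_nth)
  moreover have "(\<Sum>i\<in>UNIV. h $ i * (if i = j then 1 else 0)) = h $ j" for h :: "real^'n"
    by (simp add: if_distrib cong: if_cong)
  ultimately show ?case
    by (intro exI[of _ "\<lambda>i _. if i = j then 1 else 0"]) (auto intro: flat_alg.intros)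
next
  case (flat q m)
  then obtain d where d: "\<And>i. flat_alg (d i)"
    "\<And>x. (q has_derivative (\<lambda>h. \<Sum>i\<in>UNIV. h $ i * d i x)) (at x)" by blast
  let ?d = "\<lambda>i x. (flat (m + 2) (q x) + (- real m) * flat (Suc m) (q x)) * d i x"
  have "((\<lambda>x. flat m (q x)) has_derivative (\<lambda>h. \<Sum>i\<in>UNIV. h $ i * ?d i x)) (at x)" for x
  proof -
    have "((\<lambda>x. flat m (q x)) has_derivative
        (\<lambda>h. (\<Sum>i\<in>UNIV. h $ i * d i x) * (flat (m + 2) (q x) - real m * flat (Suc m) (q x)))) (at x)"
      using has_derivative_compose[OF d(2) flat_has_real_derivative[of m "q x", unfolded has_field_derivative_def]]
      by (simp add: mult.commute)
    moreover have "(\<Sum>i\<in>UNIV. h $ i * d i x) * (flat (m + 2) (q x) - real m * flat (Suc m) (q x))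
      = (\<Sum>i\<in>UNIV. h $ i * ?d i x)" for h :: "real^'n"
      unfolding sum_distrib_right by (intro sum.cong refl) (simp add: algebra_simps)
    ultimately show ?thesis by simp
  qed
  moreover have "flat_alg (?d i)" for i
    by (rule flat_alg.mult[OF flat_alg.add[OF flat_alg.flat[OF flat.hyps]
          flat_alg.mult[OF flat_alg.const flat_alg.flat[OF flat.hyps]]] d(1)])
  ultimately show ?case by (intro exI[of _ ?d]) auto
next
  case (add p q)
  then obtain d e where d: "\<And>i. flat_alg (d i)"
    "\<And>x. (p has_derivative (\<lambda>h. \<Sum>i\<in>UNIV. h $ i * d i x)) (at x)" and
    e: "\<And>i. flat_alg (e i)"
    "\<And>x. (q has_derivative (\<lambda>h. \<Sum>i\<in>UNIV. h $ i * e i x)) (at x)" by blast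
  have "((\<lambda>x. p x + q x) has_derivative (\<lambda>h. \<Sum>i\<in>UNIV. h $ i * (d i x + e i x))) (at x)" for x
    using has_derivative_add[OF d(2) e(2)] by (simp add: sum.distrib algebra_simps)
  moreover have "flat_alg (\<lambda>x. d i x + e i x)" for i
    by (rule flat_alg.add[OF d(1) e(1)])
  ultimately show ?case by (intro exI[of _ "\<lambda>i x. d i x + e i x"]) auto
next
  case (mult p q)
  then obtain d e where d: "\<And>i. flat_alg (d i)"
    "\<And>x. (p has_derivative (\<lambda>h. \<Sum>i\<in>UNIV. h $ i * d i x)) (at x)" and
    e: "\<And>i. flat_alg (e i)"
    "\<And>x. (q has_derivative (\<lambda>h. \<Sum>i\<in>UNIV. h $ i * e i x)) (at x)" by blast
  have "((\<lambda>x. p x * q x) has_derivative (\<lambda>h. \<Sum>i\<in>UNIV. h $ i * (p x * e i x + d i x * q x))) (at x)" for x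
    using has_derivative_mult[OF d(2) e(2)]
    by (simp add: sum.distrib sum_distrib_left sum_distrib_right algebra_simps)
  moreover have "flat_alg (\<lambda>x. p x * e i x + d i x * q x)" for i
    by (rule flat_alg.add[OF flat_alg.mult[OF mult.hyps(1) e(1)] flat_alg.mult[OF d(1) mult.hyps(2)]])
  ultimately show ?case by (intro exI[of _ "\<lambda>i x. p x * e i x + d i x * q x"]) auto
qed

lemma flat_alg_smooth:
  assumes "flat_alg (p :: real^'n \<Rightarrow> real)"
  shows "smooth p"
proof -
  have "\<forall>p. \<exists>d. flat_alg p \<longrightarrow> (\<forall>i. flat_alg (d i)) \<and>
     (\<forall>x. ((p :: real^'n \<Rightarrow> real) has_derivative (\<lambda>h. \<Sum>i\<in>UNIV. h $ i * d i x)) (at x))"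
    using flat_alg_deriv by blast
  then obtain \<delta> :: "(real^'n \<Rightarrow> real) \<Rightarrow> 'n \<Rightarrow> real^'n \<Rightarrow> real"
    where \<delta>': "\<forall>p. flat_alg p \<longrightarrow> (\<forall>i. flat_alg (\<delta> p i)) \<and>
     (\<forall>x. (p has_derivative (\<lambda>h. \<Sum>i\<in>UNIV. h $ i * \<delta> p i x)) (at x))"
    by (rule choice[THEN exE])
  have \<delta>: "\<And>p i. flat_alg p \<Longrightarrow> flat_alg (\<delta> p i)"
      "\<And>p x. flat_alg p \<Longrightarrow> (p has_derivative (\<lambda>h. \<Sum>i\<in>UNIV. h $ i * \<delta> p i x)) (at x)"
    using \<delta>' by blast+
  \<comment> \<open>the family demanded by \<open>smooth\<close>: iterate the chosen partial derivatives\<close>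
  define D where "D is = foldr (\<lambda>i q. \<delta> q i) is p" for "is"
  have alg: "flat_alg (D is)" for "is"
    by (induction "is") (auto simp: D_def assms \<delta>)
  show ?thesis unfolding smooth_def
    by (rule exI[of _ D]) (use \<delta>(2)[OF alg] in \<open>auto simp: D_def\<close>)
qed

section \<open>Mollification and its dependence on the scale\<close>

text \<open>
  Differentiation under the integral sign, by dominated convergence of the difference
  quotients; the mean value theorem bounds them by the supremum \<open>B\<close> of the derivative of the
  kernel.
\<close>

lemma has_vector_derivative_parametric_integral:
  fixes k k' :: "real \<Rightarrow> 'a \<Rightarrow> real" and f :: "'a \<Rightarrow> 'b::{banach,second_countable_topology}"
  assumes U: "convex U" "t \<in> U"
    and der: "\<And>s y. s \<in> U \<Longrightarrow> ((\<lambda>s. k s y) has_field_derivative k' s y) (at s within U)"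
    and bd: "\<And>s y. s \<in> U \<Longrightarrow> \<bar>k' s y\<bar> \<le> B y"
    and int_k: "\<And>s. s \<in> U \<Longrightarrow> integrable M (\<lambda>y. k s y *\<^sub>R f y)"
    and int_k': "integrable M (\<lambda>y. k' t y *\<^sub>R f y)"
    and int_B: "integrable M (\<lambda>y. B y * norm (f y))"
  shows "((\<lambda>s. LINT y|M. k s y *\<^sub>R f y) has_vector_derivative (LINT y|M. k' t y *\<^sub>R f y)) (at t within U)"
proof -
  let ?F = "\<lambda>s. LINT y|M. k s y *\<^sub>R f y" and ?D = "LINT y|M. k' t y *\<^sub>R f y"
  have "((\<lambda>s. norm ((?F s - ?F t) - (s - t) *\<^sub>R ?D) / norm (s - t)) \<longlongrightarrow> 0) (at t within U)"
    unfolding tendsto_at_iff_sequentially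
  proof (intro allI impI)
    fix X :: "nat \<Rightarrow> real"
    assume X: "\<forall>i. X i \<in> U - {t}" "X \<longlonglongrightarrow> t"
    let ?q = "\<lambda>i y. ((k (X i) y - k t y) / (X i - t) - k' t y) *\<^sub>R f y"
    have q_eq: "?q i y = (1 / (X i - t)) *\<^sub>R (k (X i) y *\<^sub>R f y - k t y *\<^sub>R f y) - k' t y *\<^sub>R f y" for i y
      by (simp add: scaleR_diff_left diff_divide_distrib scaleR_diff_right)
    have int_q: "integrable M (?q i)" for i
      unfolding q_eq using X U by (intro Bochner_Integration.integrable_diff integrable_scaleR_right int_k int_k') auto
    have "(\<lambda>i. LINT y|M. ?q i y) \<longlonglongrightarrow> (LINT y|M. 0)"
    proof (rule integral_dominated_convergence[where w="\<lambda>y. 2 * (B y * norm (f y))"])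
      show "integrable M (\<lambda>y. 2 * (B y * norm (f y)))" using int_B by simp
      show "(\<lambda>y. 0) \<in> borel_measurable M" by simp
      show "?q i \<in> borel_measurable M" for i using int_q by (rule borel_measurable_integrable)
      show "AE y in M. (\<lambda>i. ?q i y) \<longlonglongrightarrow> 0"
      proof (rule AE_I2)
        fix y
        have "((\<lambda>s. (k s y - k t y) / (s - t)) \<longlongrightarrow> k' t y) (at t within U)"
          using der[OF U(2), of y] by (simp add: has_field_derivative_iff)
        then have "(\<lambda>i. (k (X i) y - k t y) / (X i - t)) \<longlonglongrightarrow> k' t y"
          using X unfolding tendsto_at_iff_sequentially by (auto simp: o_def)
        from tendsto_scaleR[OF tendsto_diff[OF this tendsto_const[of "k' t y"]] tendsto_const[of "f y"]]
        show "(\<lambda>i. ?q i y) \<longlonglongrightarrow> 0" by simp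
      qed
      show "AE y in M. norm (?q i y) \<le> 2 * (B y * norm (f y))" for i
      proof (rule AE_I2)
        fix y
        have "norm (k (X i) y - k t y) \<le> B y * norm (X i - t)"
          by (rule field_differentiable_bound[OF U(1) der]) (use X U bd in auto)
        then have "\<bar>(k (X i) y - k t y) / (X i - t)\<bar> \<le> B y"
          using X by (auto simp: divide_le_eq abs_divide)
        moreover have "\<bar>k' t y\<bar> \<le> B y" using bd U by auto
        ultimately have "\<bar>(k (X i) y - k t y) / (X i - t) - k' t y\<bar> \<le> 2 * B y" by linarith
        from mult_right_mono[OF this norm_ge_zero[of "f y"]]
        show "norm (?q i y) \<le> 2 * (B y * norm (f y))" by simp
      qed
    qed
    then have "(\<lambda>i. norm (LINT y|M. ?q i y)) \<longlonglongrightarrow> 0"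
      using tendsto_norm by fastforce
    moreover have "norm (LINT y|M. ?q i y)
      = norm ((?F (X i) - ?F t) - (X i - t) *\<^sub>R ?D) / norm (X i - t)" for i
    proof -
      have nz: "X i - t \<noteq> 0" and Xi: "X i \<in> U" using X by auto
      have "(LINT y|M. ?q i y) = (1 / (X i - t)) *\<^sub>R (?F (X i) - ?F t) - ?D"
        unfolding q_eq using Xi U
        by (simp add: int_k int_k' Bochner_Integration.integral_diff)
      also have "\<dots> = (1 / (X i - t)) *\<^sub>R ((?F (X i) - ?F t) - (X i - t) *\<^sub>R ?D)"
        using nz by (simp add: scaleR_diff_right)
      finally show ?thesis by simp
    qed
    ultimately show "((\<lambda>s. norm ((?F s - ?F t) - (s - t) *\<^sub>R ?D) / norm (s - t)) \<circ> X) \<longlonglongrightarrow> 0"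
      by (simp add: o_def)
  qed
  then show ?thesis
    unfolding has_vector_derivative_def has_derivative_iff_norm
    by (auto intro: bounded_linear_scaleR_left)
qed

abbreviation Lp_energy :: "real \<Rightarrow> (real^'n \<Rightarrow> 'b::real_normed_vector) \<Rightarrow> ennreal" where
  "Lp_energy p f \<equiv> (\<integral>\<^sup>+x. ennreal (norm (f x) powr p) \<partial>lebesgue)"

abbreviation L2_energy :: "(real^'n \<Rightarrow> 'b::real_normed_vector) \<Rightarrow> ennreal" where
  "L2_energy f \<equiv> (\<integral>\<^sup>+x. ennreal ((norm (f x))\<^sup>2) \<partial>lebesgue)"

text \<open>
  The profile \<open>exp (- 1 / (1 - |z|\<^sup>2))\<close> on the unit ball, normalised to integral 1.
\<close>

definition bump :: "real^'n \<Rightarrow> real" where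
  "bump z = flat 0 (1 - (norm z)\<^sup>2) / (LINT w|lebesgue. flat 0 (1 - (norm (w::real^'n))\<^sup>2))"

definition mollifier :: "real \<Rightarrow> real^'n \<Rightarrow> real" where
  "mollifier t z = bump (z /\<^sub>R t) / t ^ CARD('n)"

definition mollify :: "real \<Rightarrow> (real^'n \<Rightarrow> 'b::{banach,second_countable_topology}) \<Rightarrow> real^'n \<Rightarrow> 'b" where
  "mollify t f x = (LINT y|lebesgue. mollifier t (x - y) *\<^sub>R f y)"

abbreviation bump_mass :: "'n::finite itself \<Rightarrow> real" where
  "bump_mass _ \<equiv> (LINT w|lebesgue. flat 0 (1 - (norm (w::real^'n))\<^sup>2))"

lemma borel_measurable_lebesgue_continuous:
  "continuous_on UNIV f \<Longrightarrow> f \<in> borel_measurable lebesgue"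
  by (intro measurable_completion) (auto intro: borel_measurable_continuous_onI)

lemma integrable_lebesgue_compact_support:
  fixes f :: "real^'n \<Rightarrow> 'b::{banach,second_countable_topology}" and \<psi> :: "real^'n \<Rightarrow> real"
  assumes f: "locally_integrable f" and K: "compact K" and \<psi>: "continuous_on UNIV \<psi>"
    and supp: "\<And>x. x \<notin> K \<Longrightarrow> \<psi> x = 0"
  shows "integrable lebesgue (\<lambda>x. \<psi> x *\<^sub>R f x)"
proof -
  have "compact (\<psi> ` K)" using K \<psi> compact_continuous_image continuous_on_subset by blast
  then obtain B where B: "\<And>x. x \<in> K \<Longrightarrow> \<bar>\<psi> x\<bar> \<le> B"
    using compact_imp_bounded bounded_iff by (metis image_eqI real_norm_def)
  have "set_integrable lebesgue K f" using f K by (auto simp: locally_integrable_def)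
  then have "integrable lebesgue (\<lambda>x. B *\<^sub>R (indicator K x *\<^sub>R f x))"
    unfolding set_integrable_def by (intro integrable_scaleR_right)
  then show ?thesis
  proof (rule Bochner_Integration.integrable_bound)
    show "(\<lambda>x. \<psi> x *\<^sub>R f x) \<in> borel_measurable lebesgue"
      using f borel_measurable_lebesgue_continuous[OF \<psi>]
      by (intro borel_measurable_scaleR) (auto simp: locally_integrable_def)
    show "AE x in lebesgue. norm (\<psi> x *\<^sub>R f x) \<le> norm (B *\<^sub>R (indicator K x *\<^sub>R f x))"
    proof (rule AE_I2)
      fix x show "norm (\<psi> x *\<^sub>R f x) \<le> norm (B *\<^sub>R (indicator K x *\<^sub>R f x))"
        using B[of x] supp[of x] by (cases "x \<in> K") (auto intro!: mult_right_mono)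
    qed
  qed
qed

lemma locally_integrable_const: "locally_integrable (\<lambda>_::real^'n. 1::real)"
  unfolding locally_integrable_def set_integrable_def
  using emeasure_compact_finite
  by (auto intro!: integrable_real_indicator simp: lmeasurable_compact fmeasurableD borel_compact)

lemma continuous_on_flat [continuous_intros]:
  "continuous_on S g \<Longrightarrow> continuous_on S (\<lambda>x. flat m (g x))"
  using continuous_on_compose2[of UNIV "flat m"] flat_isCont
  by (auto simp: continuous_at_imp_continuous_on)

lemma bump_profile_integrable: "integrable lebesgue (\<lambda>w::real^'n. flat 0 (1 - (norm w)\<^sup>2))"
proof -
  have "integrable lebesgue (\<lambda>w::real^'n. flat 0 (1 - (norm w)\<^sup>2) *\<^sub>R (1::real))"
  proof (rule integrable_lebesgue_compact_support[OF locally_integrable_const])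
    show "compact (cball (0::real^'n) 1)" by simp
    show "continuous_on UNIV (\<lambda>w::real^'n. flat 0 (1 - (norm w)\<^sup>2))" by (intro continuous_intros)
    fix w :: "real^'n" assume "w \<notin> cball 0 1"
    then show "flat 0 (1 - (norm w)\<^sup>2) = 0" by (auto simp: flat_def abs_square_less_1)
  qed
  then show ?thesis by simp
qed

lemma bump_mass_pos: "bump_mass TYPE('n::finite) > 0"
proof -
  let ?g = "\<lambda>w::real^'n. flat 0 (1 - (norm w)\<^sup>2)"
  have "bump_mass TYPE('n) \<noteq> 0"
  proof
    assume "bump_mass TYPE('n) = 0"
    then have "AE w in lebesgue. ?g w = 0"
      using integral_nonneg_eq_0_iff_AE[OF bump_profile_integrable] flat_nonneg by auto
    then have "AE w in lebesgue. w \<notin> ball (0::real^'n) 1"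
      by eventually_elim (auto simp: flat_def abs_square_less_1 split: if_splits)
    then have "negligible (ball (0::real^'n) 1)"
      by (simp add: negligible_iff_null_sets AE_iff_null_sets)
    then show False using open_not_negligible[of "ball (0::real^'n) 1"] by simp
  qed
  moreover have "bump_mass TYPE('n) \<ge> 0" by (intro integral_nonneg_AE) (simp add: flat_nonneg)
  ultimately show ?thesis by linarith
qed

lemma bump_nonneg: "0 \<le> bump (z::real^'n)"
  unfolding bump_def using bump_mass_pos[where 'n='n] by (simp add: flat_nonneg)

lemma mollifier_nonneg: "0 \<le> t \<Longrightarrow> 0 \<le> mollifier t z"
  unfolding mollifier_def by (simp add: bump_nonneg)

lemma mollifier_eq:
  "0 < t \<Longrightarrow> mollifier t (z::real^'n) = flat 0 (1 - (norm z)\<^sup>2 / t\<^sup>2) / (bump_mass TYPE('n) * t ^ CARD('n))"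
  by (simp add: mollifier_def bump_def divide_inverse power_mult_distrib power_inverse mult.commute)

lemma flat_eq_0: "s \<le> 0 \<Longrightarrow> flat m s = 0"
  by (simp add: flat_def)

lemma flat_profile_eq_0: "0 < t \<Longrightarrow> t \<le> norm z \<Longrightarrow> flat m (1 - (norm z)\<^sup>2 / t\<^sup>2) = 0"
  using power_mono[of t "norm z" 2] by (intro flat_eq_0) (auto simp: field_simps)

lemma mollifier_eq_0: "0 < t \<Longrightarrow> t \<le> norm z \<Longrightarrow> mollifier t z = 0"
  by (simp add: mollifier_eq flat_profile_eq_0)

lemma mollifier_le: "0 < t \<Longrightarrow> mollifier t (z::real^'n) \<le> 1 / (bump_mass TYPE('n) * t ^ CARD('n))"
  using bump_mass_pos[where 'n='n] flat_le_fact[of 0]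
  by (simp add: mollifier_eq divide_right_mono)

lemma continuous_on_mollifier: "0 < t \<Longrightarrow> continuous_on S (mollifier t :: real^'n \<Rightarrow> real)"
proof -
  assume "0 < t"
  then have "mollifier t = (\<lambda>z::real^'n. flat 0 (1 - (norm z)\<^sup>2 / t\<^sup>2) / (bump_mass TYPE('n) * t ^ CARD('n)))"
    by (intro ext mollifier_eq)
  then show ?thesis using bump_mass_pos[where 'n='n] \<open>0 < t\<close>
    by (auto intro!: continuous_intros)
qed

lemma continuous_on_mollifier_reflected:
  "0 < t \<Longrightarrow> continuous_on UNIV (\<lambda>y::real^'n. mollifier t (x - y))"
  by (intro continuous_on_compose2[OF continuous_on_mollifier[of t UNIV]] continuous_intros) auto

lemma integrable_mollifier:
  assumes "locally_integrable f" "0 < t"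
  shows "integrable lebesgue (\<lambda>y. mollifier t (x - y) *\<^sub>R f y)"
proof (rule integrable_lebesgue_compact_support[OF assms(1)])
  show "compact (cball x t)" by simp
  show "continuous_on UNIV (\<lambda>y. mollifier t (x - y))"
    by (rule continuous_on_mollifier_reflected[OF assms(2)])
  show "mollifier t (x - y) = 0" if "y \<notin> cball x t" for y
    using that assms(2) by (intro mollifier_eq_0) (auto simp: dist_norm)
qed

text \<open>
  The derivative of \<open>mollifier t z\<close> with respect to \<open>t\<close>.
\<close>

definition mollifier_rate :: "real \<Rightarrow> real^'n \<Rightarrow> real" where
  "mollifier_rate t z = (2 * (norm z)\<^sup>2 / t\<^sup>2 * flat 2 (1 - (norm z)\<^sup>2 / t\<^sup>2)
     - real CARD('n) * flat 0 (1 - (norm z)\<^sup>2 / t\<^sup>2)) / (bump_mass TYPE('n) * t ^ Suc CARD('n))"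

lemma mollifier_has_rate:
  fixes z :: "real^'n"
  assumes "0 < t"
  shows "((\<lambda>t. mollifier t z) has_field_derivative mollifier_rate t z) (at t)"
proof -
  let ?N = "CARD('n)"
  let ?w = "1 - (norm z)\<^sup>2 / t\<^sup>2"
  have "((\<lambda>t. 1 - (norm z)\<^sup>2 / t\<^sup>2) has_field_derivative (2 * (norm z)\<^sup>2 / t ^ 3)) (at t)"
    using assms by (auto intro!: derivative_eq_intros simp: power2_eq_square power3_eq_cube field_simps)
  from DERIV_chain2[OF flat_has_real_derivative[of 0 ?w] this]
  have fl: "((\<lambda>t. flat 0 (1 - (norm z)\<^sup>2 / t\<^sup>2)) has_field_derivative (flat 2 ?w * (2 * (norm z)\<^sup>2 / t ^ 3))) (at t)"
    by (simp add: numeral_2_eq_2)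
  have "((\<lambda>t. flat 0 (1 - (norm z)\<^sup>2 / t\<^sup>2) / (bump_mass TYPE('n) * t ^ ?N)) has_field_derivative
     (flat 2 ?w * (2 * (norm z)\<^sup>2 / t ^ 3) * (bump_mass TYPE('n) * t ^ ?N)
       - flat 0 ?w * (bump_mass TYPE('n) * (real ?N * t ^ (?N - 1)))) / ((bump_mass TYPE('n) * t ^ ?N) * (bump_mass TYPE('n) * t ^ ?N))) (at t)"
    using assms bump_mass_pos[where 'n='n] by (auto intro!: derivative_eq_intros fl)
  also have "(flat 2 ?w * (2 * (norm z)\<^sup>2 / t ^ 3) * (bump_mass TYPE('n) * t ^ ?N)
       - flat 0 ?w * (bump_mass TYPE('n) * (real ?N * t ^ (?N - 1)))) / ((bump_mass TYPE('n) * t ^ ?N) * (bump_mass TYPE('n) * t ^ ?N))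
     = mollifier_rate t z"
  proof -
    \<comment> \<open>the dimension is a successor, so that \<open>t ^ (?N - 1)\<close> in the quotient rule can be
      simplified\<close>
    obtain m where m: "?N = Suc m" using zero_less_card_finite[where 'a='n] gr0_conv_Suc by blast
    have ne: "t \<noteq> 0" "bump_mass TYPE('n) \<noteq> 0" using assms bump_mass_pos[where 'n='n] by auto
    show ?thesis unfolding mollifier_rate_def m diff_Suc_1
      using ne by (simp add: divide_simps) (simp add: algebra_simps power2_eq_square power3_eq_cube)
  qed
  finally have "((\<lambda>t. flat 0 (1 - (norm z)\<^sup>2 / t\<^sup>2) / (bump_mass TYPE('n) * t ^ ?N)) has_field_derivative mollifier_rate t z) (at t)" .
  then show ?thesis
    by (rule has_field_derivative_transform_within_open[where S="{0<..}"])
       (use assms in \<open>auto simp: mollifier_eq\<close>)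
qed

lemma mollifier_rate_eq_0: "0 < t \<Longrightarrow> t \<le> norm z \<Longrightarrow> mollifier_rate t z = 0"
  by (simp add: mollifier_rate_def flat_profile_eq_0)

lemma continuous_on_mollifier_rate: "0 < t \<Longrightarrow> continuous_on S (mollifier_rate t :: real^'n \<Rightarrow> real)"
  unfolding mollifier_rate_def using bump_mass_pos[where 'n='n] by (auto intro!: continuous_intros)

lemma abs_mollifier_rate_le:
  fixes z :: "real^'n"
  assumes "0 < t"
  shows "\<bar>mollifier_rate t z\<bar> \<le> (4 + real CARD('n)) / (bump_mass TYPE('n) * t ^ Suc CARD('n))"
proof (cases "t \<le> norm z")
  case True
  then show ?thesis using mollifier_rate_eq_0[OF assms True] bump_mass_pos[where 'n='n] assms by simp
next
  case False
  let ?w = "1 - (norm z)\<^sup>2 / t\<^sup>2"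
  have q: "0 \<le> (norm z)\<^sup>2 / t\<^sup>2" "(norm z)\<^sup>2 / t\<^sup>2 \<le> 1"
    using False assms power_mono[of "norm z" t 2] by auto
  have f: "0 \<le> flat 2 ?w" "flat 2 ?w \<le> 2" "0 \<le> flat 0 ?w" "flat 0 ?w \<le> 1"
    using flat_nonneg flat_le_fact[of 2 ?w] flat_le_fact[of 0 ?w] by (auto simp: numeral_2_eq_2)
  have "(norm z)\<^sup>2 / t\<^sup>2 * flat 2 ?w \<le> 1 * 2" using q f by (intro mult_mono) auto
  moreover have "0 \<le> (norm z)\<^sup>2 / t\<^sup>2 * flat 2 ?w" using q f by (intro mult_nonneg_nonneg) auto
  moreover have "real CARD('n) * flat 0 ?w \<le> real CARD('n) * 1" using f by (intro mult_left_mono) auto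
  moreover have "0 \<le> real CARD('n) * flat 0 ?w" using f by auto
  ultimately have "\<bar>2 * (norm z)\<^sup>2 / t\<^sup>2 * flat 2 ?w - real CARD('n) * flat 0 ?w\<bar> \<le> 4 + real CARD('n)"
    unfolding mult.assoc times_divide_eq_right[symmetric] times_divide_eq_left
    by (simp only: abs_le_iff mult_1_right) linarith
  then show ?thesis using bump_mass_pos[where 'n='n] assms
    unfolding mollifier_rate_def abs_divide by (simp add: divide_right_mono)
qed

lemma integrable_mollifier_rate:
  assumes "locally_integrable f" "0 < t"
  shows "integrable lebesgue (\<lambda>y. mollifier_rate t (x - y) *\<^sub>R f y)"
proof (rule integrable_lebesgue_compact_support[OF assms(1)])
  show "compact (cball x t)" by simp
  show "continuous_on UNIV (\<lambda>y. mollifier_rate t (x - y))"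
    by (intro continuous_on_compose2[OF continuous_on_mollifier_rate[OF assms(2), of UNIV]] continuous_intros) auto
  show "mollifier_rate t (x - y) = 0" if "y \<notin> cball x t" for y
    using that assms(2) by (intro mollifier_rate_eq_0) (auto simp: dist_norm)
qed

lemma norm_power2_vec: "(norm (z::real^'n))\<^sup>2 = (\<Sum>j\<in>UNIV. (z $ j)\<^sup>2)"
  unfolding power2_norm_eq_inner inner_vec_def by (simp add: power2_eq_square)

lemma flat_alg_profile:
  fixes x :: "real^'n"
  shows "flat_alg (\<lambda>y. flat m (1 - (norm (x - y))\<^sup>2 / t\<^sup>2))"
proof -
  let ?q = "\<lambda>y. 1 - (norm (x - y))\<^sup>2 / t\<^sup>2"
  have q: "?q = (\<lambda>y. 1 + (- 1 / t\<^sup>2) * (\<Sum>j\<in>UNIV. (x $ j + (-1) * y $ j) * (x $ j + (-1) * y $ j)))"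
    by (intro ext) (simp add: norm_power2_vec flip: power2_eq_square)
  have diff: "flat_alg (\<lambda>y::real^'n. x $ j + (-1) * y $ j)" for j
    by (intro flat_alg.add flat_alg.const flat_alg.mult flat_alg.coord)
  have "flat_alg ?q"
    unfolding q
    by (intro flat_alg.add flat_alg.const flat_alg.mult[OF flat_alg.const] flat_alg_sum
        flat_alg.mult[OF diff diff] finite)
  then show ?thesis by (rule flat_alg.flat)
qed

lemma flat_alg_test_function:
  fixes x :: "real^'n"
  assumes alg: "flat_alg P" and supp: "\<And>y. t \<le> norm (x - y) \<Longrightarrow> P y = 0"
  shows "test_function P"
proof -
  have "closure {y. P y \<noteq> 0} \<subseteq> cball x t"
  proof (rule closure_minimal)
    show "{y. P y \<noteq> 0} \<subseteq> cball x t"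
      using supp by (force simp: dist_norm)
  qed simp
  then have "compact (closure {y. P y \<noteq> 0})"
    by (meson bounded_cball bounded_subset closed_closure compact_eq_bounded_closed)
  then show ?thesis
    using flat_alg_smooth[OF alg] by (simp add: test_function_def)
qed

lemma test_function_mollifier:
  fixes x :: "real^'n"
  assumes t: "0 < t"
  shows "test_function (\<lambda>y. mollifier t (x - y))"
proof (rule flat_alg_test_function)
  have "(\<lambda>y. mollifier t (x - y)) = (\<lambda>y. 1 / (bump_mass TYPE('n) * t ^ CARD('n)) * flat 0 (1 - (norm (x - y))\<^sup>2 / t\<^sup>2))"
    using t by (intro ext) (simp add: mollifier_eq)
  then show "flat_alg (\<lambda>y. mollifier t (x - y))"
    by (simp only: flat_alg.mult[OF flat_alg.const flat_alg_profile])
qed (use t mollifier_eq_0 in auto)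

text \<open>
  Up to sign, \<open>mollifier_rate t\<close> is the divergence of the field \<open>z \<mapsto> mollifier t z * z / t\<close>,
  because increasing the scale transports the unit mass of the kernel along the dilation field
  \<open>z / t\<close>. The components of the flux are smooth and compactly supported, so a weak gradient may
  be tested with them.
\<close>

lemma test_function_mollifier_flux:
  fixes x :: "real^'n"
  assumes t: "0 < t"
  shows "test_function (\<lambda>y. mollifier t (x - y) * (x - y) $ i / t)"
    and "partial_deriv i (\<lambda>y. mollifier t (x - y) * (x - y) $ i / t) y =
      (2 * ((x - y) $ i)\<^sup>2 / t\<^sup>2 * flat 2 (1 - (norm (x - y))\<^sup>2 / t\<^sup>2)
        - flat 0 (1 - (norm (x - y))\<^sup>2 / t\<^sup>2)) / (bump_mass TYPE('n) * t ^ Suc CARD('n))"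
proof -
  let ?P = "\<lambda>y. mollifier t (x - y) * (x - y) $ i / t"
  let ?c = "1 / (bump_mass TYPE('n) * t ^ Suc CARD('n))"
  let ?q = "\<lambda>y. 1 - (norm (x - y))\<^sup>2 / t\<^sup>2"
  have P: "?P = (\<lambda>y. ?c * ((x - y) $ i * flat 0 (?q y)))"
    using t by (intro ext) (simp add: mollifier_eq mult.commute mult.left_commute)
  have "flat_alg (\<lambda>y::real^'n. x $ i + (-1) * y $ i)"
    by (intro flat_alg.add flat_alg.const flat_alg.mult flat_alg.coord)
  from flat_alg.mult[OF flat_alg.const[of ?c] flat_alg.mult[OF this flat_alg_profile[of 0 x t]]]
  have alg: "flat_alg ?P" unfolding P by simp
  show "test_function ?P"
    by (rule flat_alg_test_function[OF alg, of t x]) (simp add: mollifier_eq_0[OF t])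
  have "((\<lambda>y. x - y) has_derivative (\<lambda>h. 0 - h)) (at y)"
    by (intro has_derivative_diff has_derivative_const has_derivative_ident)
  then have dxy: "((\<lambda>y. x - y) has_derivative (\<lambda>h. - h)) (at y)"
    by simp
  have "((\<lambda>y. (x - y) \<bullet> (x - y)) has_derivative (\<lambda>h. (x - y) \<bullet> (- h) + (- h) \<bullet> (x - y))) (at y)"
    by (rule has_derivative_inner[OF dxy dxy])
  then have "((\<lambda>y. 1 - (1 / t\<^sup>2) * ((x - y) \<bullet> (x - y))) has_derivative
      (\<lambda>h. 0 - (1 / t\<^sup>2) * ((x - y) \<bullet> (- h) + (- h) \<bullet> (x - y)))) (at y)"
    by (intro has_derivative_diff has_derivative_const has_derivative_mult_right)
  moreover have "0 - (1 / t\<^sup>2) * ((x - y) \<bullet> (- h) + (- h) \<bullet> (x - y)) = 2 * ((x - y) \<bullet> h) / t\<^sup>2" for h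
    unfolding inner_commute[of "- h"] inner_minus_right by simp
  moreover have "?q = (\<lambda>y. 1 - (1 / t\<^sup>2) * ((x - y) \<bullet> (x - y)))"
    by (intro ext) (simp only: power2_norm_eq_inner times_divide_eq_left mult_1_left)
  ultimately have dq: "(?q has_derivative (\<lambda>h. 2 * ((x - y) \<bullet> h) / t\<^sup>2)) (at y)"
    by (simp only:)
  have df: "((\<lambda>y. flat 0 (?q y)) has_derivative (\<lambda>h. flat 2 (?q y) * (2 * ((x - y) \<bullet> h) / t\<^sup>2))) (at y)"
    using has_derivative_compose[OF dq flat_has_real_derivative[of 0 "?q y", unfolded has_field_derivative_def]]
    by (simp add: numeral_2_eq_2)
  have dc: "((\<lambda>y. (x - y) $ i) has_derivative (\<lambda>h. - (h $ i))) (at y)"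
    by (auto intro!: derivative_eq_intros bounded_linear_imp_has_derivative bounded_linear_vec_nth)
  have dP: "(?P has_derivative (\<lambda>h. ?c * ((x - y) $ i * (flat 2 (?q y) * (2 * ((x - y) \<bullet> h) / t\<^sup>2)) + - (h $ i) * flat 0 (?q y)))) (at y)"
    unfolding P by (rule has_derivative_mult_right[OF has_derivative_mult[OF dc df]])
  have "partial_deriv i ?P y = ?c * ((x - y) $ i * (flat 2 (?q y) * (2 * ((x - y) \<bullet> axis i 1) / t\<^sup>2)) + - (axis i 1 $ i) * flat 0 (?q y))"
    unfolding partial_deriv_def frechet_derivative_at[OF dP, symmetric] ..
  moreover have "1 / k * (a * (F * (2 * a / u)) + - 1 * G) = (2 * a\<^sup>2 / u * F - G) / k" for k a F G u :: real
    by (simp add: power2_eq_square mult_ac)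
  moreover have "(x - y) \<bullet> axis i 1 = (x - y) $ i" "axis i 1 $ i = (1::real)"
    by (simp_all add: inner_axis)
  ultimately show "partial_deriv i ?P y =
      (2 * ((x - y) $ i)\<^sup>2 / t\<^sup>2 * flat 2 (?q y) - flat 0 (?q y)) / (bump_mass TYPE('n) * t ^ Suc CARD('n))"
    by (simp only:)
qed

lemma locally_integrable_nth:
  fixes g :: "real^'n \<Rightarrow> complex^'n"
  assumes "locally_integrable g"
  shows "locally_integrable (\<lambda>y. g y $ i)"
  unfolding locally_integrable_def
proof (intro conjI allI impI)
  have "(\<lambda>v::complex^'n. v $ i) \<in> borel_measurable borel"
    by (intro borel_measurable_continuous_onI linear_continuous_on bounded_linear_vec_nth)
  then show "(\<lambda>y. g y $ i) \<in> borel_measurable lebesgue"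
    using assms measurable_compose[of g lebesgue borel "\<lambda>v. v $ i" borel] by (simp add: locally_integrable_def)
  fix K :: "(real^'n) set" assume "compact K"
  then have "integrable lebesgue (\<lambda>y. (indicator K y *\<^sub>R g y) $ i)"
    using assms unfolding locally_integrable_def set_integrable_def
    by (intro integrable_bounded_linear[OF bounded_linear_vec_nth]) auto
  then show "set_integrable lebesgue K (\<lambda>y. g y $ i)"
    by (simp add: set_integrable_def)
qed

lemma locally_integrable_norm:
  "locally_integrable g \<Longrightarrow> locally_integrable (\<lambda>y. norm (g y))"
  using integrable_norm[of lebesgue "\<lambda>x. indicator K x *\<^sub>R g x" for K]
  unfolding locally_integrable_def set_integrable_def by auto

lemma integrable_norm_on_cball:
  "locally_integrable g \<Longrightarrow> integrable lebesgue (\<lambda>y. indicator (cball x t) y * norm (g y))"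
  using locally_integrable_norm[of g] by (auto simp: locally_integrable_def set_integrable_def)

lemma integrable_on_box:
  assumes u: "locally_integrable u"
  shows "integrable lebesgue (\<lambda>x. indicator (box a b) x *\<^sub>R u x)"
proof -
  have "integrable lebesgue (\<lambda>x. indicator (cbox a b) x *\<^sub>R u x)"
    using u by (auto simp: locally_integrable_def set_integrable_def)
  from integrable_mult_indicator[OF _ this, of "box a b"]
  have "integrable lebesgue (\<lambda>x. indicator (box a b) x *\<^sub>R indicator (cbox a b) x *\<^sub>R u x)" by simp
  moreover have "indicator (box a b) x *\<^sub>R indicator (cbox a b) x *\<^sub>R u x = indicator (box a b) x *\<^sub>R u x" for x
    using box_subset_cbox[of a b] by (auto split: split_indicator)
  ultimately show ?thesis by (simp only:)
qed

lemma continuous_on_diff_component: "continuous_on S (\<lambda>y::real^'n. (x - y) $ i)"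
  by (simp add: continuous_intros)

text \<open>
  Integration by parts against the flux field, which trades the change of scale for the
  gradient.
\<close>

lemma mollifier_rate_weak_gradient:
  fixes f :: "real^'n \<Rightarrow> complex"
  assumes w: "has_weak_gradient f g" and t: "0 < t"
  shows "(LINT y|lebesgue. mollifier_rate t (x - y) *\<^sub>R f y) =
    - (LINT y|lebesgue. (\<Sum>i\<in>UNIV. (mollifier t (x - y) * (x - y) $ i / t) *\<^sub>R (g y $ i)))"
proof -
  let ?P = "\<lambda>i y. mollifier t (x - y) * (x - y) $ i / t"
  let ?d = "\<lambda>i y. (2 * ((x - y) $ i)\<^sup>2 / t\<^sup>2 * flat 2 (1 - (norm (x - y))\<^sup>2 / t\<^sup>2)
        - flat 0 (1 - (norm (x - y))\<^sup>2 / t\<^sup>2)) / (bump_mass TYPE('n) * t ^ Suc CARD('n))"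
  have f: "locally_integrable f" and g: "locally_integrable g"
    using w by (auto simp: has_weak_gradient_def)
  have d: "partial_deriv i (?P i) y = ?d i y" for i y
    by (rule test_function_mollifier_flux[OF t])
  have int_d: "integrable lebesgue (\<lambda>y. ?d i y *\<^sub>R f y)" for i
  proof (rule integrable_lebesgue_compact_support[OF f])
    show "compact (cball x t)" by simp
    show "continuous_on UNIV (?d i)"
      using t bump_mass_pos[where 'n='n] by (auto intro!: continuous_intros continuous_on_diff_component)
    show "?d i y = 0" if "y \<notin> cball x t" for y
      using that t flat_profile_eq_0[of t "x - y"] by (simp add: dist_norm)
  qed
  have int_P: "integrable lebesgue (\<lambda>y. ?P i y *\<^sub>R (g y $ i))" for i
  proof (rule integrable_lebesgue_compact_support[OF locally_integrable_nth[OF g]])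
    show "compact (cball x t)" by simp
    show "continuous_on UNIV (?P i)"
      using t by (intro continuous_intros continuous_on_diff_component continuous_on_mollifier_reflected) auto
    show "?P i y = 0" if "y \<notin> cball x t" for y
      using that t mollifier_eq_0[of t "x - y"] by (simp add: dist_norm)
  qed
  have "mollifier_rate t (x - y) = (\<Sum>i\<in>UNIV. ?d i y)" for y
  proof -
    let ?F = "flat 2 (1 - (norm (x - y))\<^sup>2 / t\<^sup>2)" and ?G = "flat 0 (1 - (norm (x - y))\<^sup>2 / t\<^sup>2)"
    have "2 * ((x - y) $ i)\<^sup>2 / t\<^sup>2 * ?F = ((x - y) $ i)\<^sup>2 * (2 / t\<^sup>2 * ?F)" for i
      by (simp add: mult.commute)
    then have "(\<Sum>i\<in>UNIV. 2 * ((x - y) $ i)\<^sup>2 / t\<^sup>2 * ?F - ?G) = (\<Sum>i\<in>UNIV. ((x - y) $ i)\<^sup>2 * (2 / t\<^sup>2 * ?F)) - real CARD('n) * ?G"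
      by (simp only: sum_subtractf) simp
    also have "(\<Sum>i\<in>UNIV. ((x - y) $ i)\<^sup>2 * (2 / t\<^sup>2 * ?F)) = (norm (x - y))\<^sup>2 * (2 / t\<^sup>2 * ?F)"
      unfolding norm_power2_vec[of "x - y"] by (rule sum_distrib_right[symmetric])
    finally show ?thesis
      unfolding sum_divide_distrib[symmetric] mollifier_rate_def by (simp add: mult.commute mult.left_commute)
  qed
  then have "(LINT y|lebesgue. mollifier_rate t (x - y) *\<^sub>R f y)
      = (LINT y|lebesgue. (\<Sum>i\<in>UNIV. ?d i y *\<^sub>R f y))"
    by (simp only: scaleR_sum_left)
  also have "\<dots> = (\<Sum>i\<in>UNIV. LINT y|lebesgue. ?d i y *\<^sub>R f y)"
    by (intro Bochner_Integration.integral_sum int_d)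
  also have "\<dots> = (\<Sum>i\<in>UNIV. - (LINT y|lebesgue. ?P i y *\<^sub>R (g y $ i)))"
  proof (intro sum.cong refl)
    fix i
    have "(LINT y|lebesgue. partial_deriv i (?P i) y *\<^sub>R f y) = - (LINT y|lebesgue. ?P i y *\<^sub>R (g y $ i))"
      using w[unfolded has_weak_gradient_def, THEN conjunct2, THEN conjunct2, rule_format,
        OF test_function_mollifier_flux(1)[OF t]] .
    then show "(LINT y|lebesgue. ?d i y *\<^sub>R f y) = - (LINT y|lebesgue. ?P i y *\<^sub>R (g y $ i))"
      unfolding d .
  qed
  also have "\<dots> = - (\<Sum>i\<in>UNIV. LINT y|lebesgue. ?P i y *\<^sub>R (g y $ i))"
    by (simp add: sum_negf)
  also have "(\<Sum>i\<in>UNIV. LINT y|lebesgue. ?P i y *\<^sub>R (g y $ i)) = (LINT y|lebesgue. (\<Sum>i\<in>UNIV. ?P i y *\<^sub>R (g y $ i)))"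
    by (intro Bochner_Integration.integral_sum[symmetric] int_P)
  finally show ?thesis .
qed

definition dyadic_const :: "'n::finite itself \<Rightarrow> real" where
  "dyadic_const _ = real CARD('n) * 2 ^ CARD('n) / bump_mass TYPE('n)"

lemma dyadic_const_nonneg: "0 \<le> dyadic_const TYPE('n::finite)"
  using bump_mass_pos[where 'n='n] by (simp add: dyadic_const_def)

text \<open>
  The mean value inequality in the scale variable on \<open>{t/2..t}\<close>, with the derivative rewritten
  through the weak gradient. The kernel of the flux is at most of size \<open>t^(-N)\<close> and vanishes
  outside the ball of radius \<open>t\<close>.
\<close>

lemma mollify_dyadic_difference:
  fixes f :: "real^'n \<Rightarrow> complex"
  assumes w: "has_weak_gradient f g" and t: "0 < t"
  shows "norm (mollify t f x - mollify (t/2) f x) \<le>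
    dyadic_const TYPE('n) * t / t ^ CARD('n) * (LINT y|lebesgue. indicator (cball x t) y * norm (g y))"
proof -
  let ?N = "CARD('n)" and ?\<kappa> = "bump_mass TYPE('n)"
  let ?I = "LINT y|lebesgue. indicator (cball x t) y * norm (g y)"
  let ?U = "{t/2..t}"
  let ?D = "\<lambda>s. LINT y|lebesgue. mollifier_rate s (x - y) *\<^sub>R f y"
  have f: "locally_integrable f" and g: "locally_integrable g"
    using w by (auto simp: has_weak_gradient_def)
  have \<kappa>: "?\<kappa> > 0" by (rule bump_mass_pos)
  have int_g: "integrable lebesgue (\<lambda>y. indicator (cball x t) y * norm (g y))"
    by (rule integrable_norm_on_cball[OF g])
  have int_f: "integrable lebesgue (\<lambda>y. indicator (cball x t) y * norm (f y))"
    by (rule integrable_norm_on_cball[OF f])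
  have U: "0 < s" "s \<le> t" "t/2 \<le> s" if "s \<in> ?U" for s using that t by auto
  \<comment> \<open>a bound for the rate that is uniform over \<open>{t/2..t}\<close>; it is largest at the smallest
    scale\<close>
  let ?B = "(4 + real ?N) / (?\<kappa> * (t/2) ^ Suc ?N)"
  have der: "((\<lambda>s. mollify s f x) has_vector_derivative ?D s) (at s within ?U)" if s: "s \<in> ?U" for s
    unfolding mollify_def
  proof (rule has_vector_derivative_parametric_integral[where B="\<lambda>y. ?B * indicator (cball x t) y"])
    show "convex ?U" "s \<in> ?U" using s by auto
    fix r y assume r: "r \<in> ?U"
    show "((\<lambda>s. mollifier s (x - y)) has_real_derivative mollifier_rate r (x - y)) (at r within ?U)"
      using mollifier_has_rate[OF U(1)[OF r]] by (rule has_field_derivative_at_within)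
    show "integrable lebesgue (\<lambda>y. mollifier r (x - y) *\<^sub>R f y)"
      by (rule integrable_mollifier[OF f U(1)[OF r]])
    show "\<bar>mollifier_rate r (x - y)\<bar> \<le> ?B * indicator (cball x t) y"
    proof (cases "y \<in> cball x t")
      case True
      have "\<bar>mollifier_rate r (x - y)\<bar> \<le> (4 + real ?N) / (?\<kappa> * r ^ Suc ?N)"
        by (rule abs_mollifier_rate_le[OF U(1)[OF r]])
      also have "\<dots> \<le> ?B"
        using U[OF r] t \<kappa> by (intro divide_left_mono mult_left_mono power_mono mult_pos_pos zero_less_power) auto
      finally show ?thesis using True by simp
    next
      case False
      then show ?thesis using mollifier_rate_eq_0[OF U(1)[OF r], of "x - y"] U[OF r] by (simp add: dist_norm)
    qed
  next
    show "integrable lebesgue (\<lambda>y. mollifier_rate s (x - y) *\<^sub>R f y)"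
      by (rule integrable_mollifier_rate[OF f U(1)[OF s]])
    show "integrable lebesgue (\<lambda>y. ?B * indicator (cball x t) y * norm (f y))"
      unfolding mult.assoc by (intro integrable_mult_right int_f)
  qed
  let ?C = "real ?N * 2 ^ ?N / (?\<kappa> * t ^ ?N)"
  have D: "norm (?D s) \<le> ?C * ?I" if s: "s \<in> ?U" for s
  proof -
    have "norm (?D s) = norm (LINT y|lebesgue. (\<Sum>i\<in>UNIV. (mollifier s (x - y) * (x - y) $ i / s) *\<^sub>R (g y $ i)))"
      unfolding mollifier_rate_weak_gradient[OF w U(1)[OF s]] by simp
    also have "\<dots> \<le> (LINT y|lebesgue. ?C * (indicator (cball x t) y * norm (g y)))"
    proof (rule order_trans[OF integral_norm_bound integral_mono[OF integrable_norm]])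
      show "integrable lebesgue (\<lambda>y. \<Sum>i\<in>UNIV. (mollifier s (x - y) * (x - y) $ i / s) *\<^sub>R (g y $ i))"
      proof (intro Bochner_Integration.integrable_sum integrable_lebesgue_compact_support[OF locally_integrable_nth[OF g]])
        show "compact (cball x s)" by simp
        show "continuous_on UNIV (\<lambda>y. mollifier s (x - y) * (x - y) $ i / s)" for i
          using U(1)[OF s] by (intro continuous_intros continuous_on_diff_component continuous_on_mollifier_reflected) auto
        show "mollifier s (x - y) * (x - y) $ i / s = 0" if "y \<notin> cball x s" for y i
          using that U(1)[OF s] mollifier_eq_0[of s "x - y"] by (simp add: dist_norm)
      qed
      show "integrable lebesgue (\<lambda>y. ?C * (indicator (cball x t) y * norm (g y)))"
        by (intro integrable_mult_right int_g)
      fix y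
      show "norm (\<Sum>i\<in>UNIV. (mollifier s (x - y) * (x - y) $ i / s) *\<^sub>R (g y $ i))
          \<le> ?C * (indicator (cball x t) y * norm (g y))"
      proof (cases "norm (x - y) < s")
        case False
        then have "mollifier s (x - y) = 0" using U(1)[OF s] by (intro mollifier_eq_0) auto
        then show ?thesis using \<kappa> t by simp
      next
        case True
        have y: "y \<in> cball x t" using True U[OF s] by (simp add: dist_norm)
        have "norm (\<Sum>i\<in>UNIV. (mollifier s (x - y) * (x - y) $ i / s) *\<^sub>R (g y $ i))
          \<le> (\<Sum>i\<in>(UNIV::'n set). 2 ^ ?N / (?\<kappa> * t ^ ?N) * norm (g y))"
        proof (rule sum_norm_le)
          fix i
          have m: "mollifier s (x - y) \<le> 2 ^ ?N / (?\<kappa> * t ^ ?N)"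
          proof -
            have "mollifier s (x - y) \<le> 1 / (?\<kappa> * s ^ ?N)"
              by (rule mollifier_le[OF U(1)[OF s]])
            also have "\<dots> \<le> 1 / (?\<kappa> * (t/2) ^ ?N)"
              using U[OF s] t \<kappa> by (intro divide_left_mono mult_left_mono power_mono mult_pos_pos zero_less_power) auto
            finally show ?thesis by (simp add: power_divide)
          qed
          have z: "\<bar>(x - y) $ i\<bar> / s \<le> 1"
            using component_le_norm_cart[of "x - y" i] True U(1)[OF s] by (simp add: divide_le_eq)
          have "\<bar>mollifier s (x - y) * (x - y) $ i / s\<bar> = mollifier s (x - y) * (\<bar>(x - y) $ i\<bar> / s)"
            using U(1)[OF s] mollifier_nonneg[of s "x - y"] by (simp add: abs_mult)
          also have "\<dots> \<le> 2 ^ ?N / (?\<kappa> * t ^ ?N) * 1"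
            using m z U(1)[OF s] mollifier_nonneg[of s "x - y"] \<kappa> t by (intro mult_mono) auto
          finally have "\<bar>mollifier s (x - y) * (x - y) $ i / s\<bar> \<le> 2 ^ ?N / (?\<kappa> * t ^ ?N)" by simp
          then show "norm ((mollifier s (x - y) * (x - y) $ i / s) *\<^sub>R (g y $ i)) \<le> 2 ^ ?N / (?\<kappa> * t ^ ?N) * norm (g y)"
            unfolding norm_scaleR using Finite_Cartesian_Product.norm_nth_le[of "g y" i] \<kappa> t
            by (intro mult_mono) auto
        qed
        also have "\<dots> = ?C * norm (g y)" by simp
        finally show ?thesis using y by simp
      qed
    qed
    also have "\<dots> = ?C * ?I" by simp
    finally show ?thesis .
  qed
  have I0: "0 \<le> ?I" by (intro integral_nonneg_AE) simp
  have "norm (mollify t f x - mollify (t/2) f x) \<le> (?C * ?I) * norm (t - t/2)"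
  proof (rule differentiable_bound[where S="?U" and f="\<lambda>s. mollify s f x"])
    show "((\<lambda>s. mollify s f x) has_derivative (\<lambda>h. h *\<^sub>R ?D s)) (at s within ?U)" if "s \<in> ?U" for s
      using der[OF that] by (simp add: has_vector_derivative_def)
    show "onorm (\<lambda>h. h *\<^sub>R ?D s) \<le> ?C * ?I" if "s \<in> ?U" for s
    proof (rule onorm_le)
      fix h :: real
      show "norm (h *\<^sub>R ?D s) \<le> ?C * ?I * norm h"
        using mult_left_mono[OF D[OF that] norm_ge_zero[of h]] unfolding norm_scaleR real_norm_def mult.commute[of "\<bar>h\<bar>"] .
    qed
    show "convex ?U" by (rule convex_real_interval)
    show "t \<in> ?U" "t/2 \<in> ?U" using t by (simp_all only: atLeastAtMost_iff) linarith+
  qed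
  also have "\<dots> \<le> (?C * ?I) * t"
  proof (rule mult_left_mono)
    show "norm (t - t/2) \<le> t" using t by simp
    show "0 \<le> ?C * ?I" using t I0 \<kappa> by (intro mult_nonneg_nonneg divide_nonneg_nonneg) auto
  qed
  also have "\<dots> = dyadic_const TYPE('n) * t / t ^ ?N * ?I"
    unfolding dyadic_const_def by (simp only: times_divide_eq_left times_divide_eq_right divide_divide_eq_left mult_ac)
  finally show ?thesis .
qed

section \<open>Continuity of mollified functions\<close>

lemma mollifier_uniformly_continuous:
  assumes t: "0 < t" and e: "0 < e"
  obtains d where "0 < d" "d \<le> 1" "\<And>z z' :: real^'n. dist z z' < d \<Longrightarrow> \<bar>mollifier t z - mollifier t z'\<bar> < e"
proof -
  have "uniformly_continuous_on (cball 0 (t + 1)) (mollifier t :: real^'n \<Rightarrow> real)"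
    using continuous_on_mollifier[OF t] by (intro compact_uniformly_continuous) auto
  then obtain d where d: "0 < d" "\<And>z z' :: real^'n. z \<in> cball 0 (t + 1) \<Longrightarrow> z' \<in> cball 0 (t + 1) \<Longrightarrow> dist z' z < d
     \<Longrightarrow> dist (mollifier t z') (mollifier t z) < e"
    using e unfolding uniformly_continuous_on_def by metis
  show ?thesis
  proof (rule that[of "min d 1"])
    fix z z' :: "real^'n" assume zz: "dist z z' < min d 1"
    show "\<bar>mollifier t z - mollifier t z'\<bar> < e"
    proof (cases "norm z \<le> t \<or> norm z' \<le> t")
      case True
      have "norm z \<le> norm z' + dist z z'" "norm z' \<le> norm z + dist z z'"
        using norm_triangle_sub[of z z'] norm_triangle_sub[of z' z] by (simp_all add: dist_norm norm_minus_commute)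
      then show ?thesis using True zz d(2)[of z' z] by (auto simp: dist_real_def)
    next
      case False
      then show ?thesis using mollifier_eq_0[OF t, of z] mollifier_eq_0[OF t, of z'] e by simp
    qed
  qed (use d in auto)
qed

text \<open>
  The modulus \<open>d\<close> does not depend on \<open>f\<close>: it is the modulus of continuity of the kernel.
\<close>

lemma mollify_equicontinuous:
  assumes t: "0 < t" and e: "0 < e"
  shows "\<exists>d>0. \<forall>(f :: real^'n \<Rightarrow> 'b::{banach,second_countable_topology}) x x'. locally_integrable f \<longrightarrow> dist x x' < d \<longrightarrow>
       norm (mollify t f x - mollify t f x') \<le> e * (LINT y|lebesgue. indicator (cball x (t + 1)) y * norm (f y))"
proof -
  obtain d where d: "0 < d" "d \<le> 1" "\<And>z z' :: real^'n. dist z z' < d \<Longrightarrow> \<bar>mollifier t z - mollifier t z'\<bar> < e"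
    using mollifier_uniformly_continuous[OF t e] by blast
  show ?thesis
  proof (intro exI[of _ d] conjI d(1) allI impI)
    fix f :: "real^'n \<Rightarrow> 'b::{banach,second_countable_topology}" and x x' :: "real^'n"
    assume f: "locally_integrable f" and xx: "dist x x' < d"
    have int_f: "integrable lebesgue (\<lambda>y. e * (indicator (cball x (t + 1)) y * norm (f y)))"
      using locally_integrable_norm[OF f] by (auto simp: locally_integrable_def set_integrable_def)
    have "norm (mollify t f x - mollify t f x') = norm (LINT y|lebesgue. mollifier t (x - y) *\<^sub>R f y - mollifier t (x' - y) *\<^sub>R f y)"
      unfolding mollify_def by (simp add: Bochner_Integration.integral_diff integrable_mollifier[OF f t])
    also have "\<dots> \<le> (LINT y|lebesgue. e * (indicator (cball x (t + 1)) y * norm (f y)))"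
    proof (rule order_trans[OF integral_norm_bound integral_mono[OF integrable_norm int_f]])
      show "integrable lebesgue (\<lambda>y. mollifier t (x - y) *\<^sub>R f y - mollifier t (x' - y) *\<^sub>R f y)"
        by (intro Bochner_Integration.integrable_diff integrable_mollifier f t)
      fix y
      have eq: "norm (mollifier t (x - y) *\<^sub>R f y - mollifier t (x' - y) *\<^sub>R f y)
          = \<bar>mollifier t (x - y) - mollifier t (x' - y)\<bar> * norm (f y)"
        by (simp flip: scaleR_diff_left)
      show "norm (mollifier t (x - y) *\<^sub>R f y - mollifier t (x' - y) *\<^sub>R f y)
          \<le> e * (indicator (cball x (t + 1)) y * norm (f y))"
      proof (cases "y \<in> cball x (t + 1)")
        case True
        have "\<bar>mollifier t (x - y) - mollifier t (x' - y)\<bar> < e"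
          using xx by (intro d(3)) (simp add: dist_norm)
        then show ?thesis unfolding eq using True by (simp add: mult_right_mono)
      next
        case False
        then have "t \<le> norm (x - y)" "t \<le> norm (x' - y)"
          using xx d(2) dist_triangle[of x y x'] by (auto simp: dist_norm)
        then show ?thesis unfolding eq using False t by (simp add: mollifier_eq_0)
      qed
    qed
    also have "\<dots> = e * (LINT y|lebesgue. indicator (cball x (t + 1)) y * norm (f y))" by simp
    finally show "norm (mollify t f x - mollify t f x') \<le> e * (LINT y|lebesgue. indicator (cball x (t + 1)) y * norm (f y))" .
  qed
qed

lemma continuous_on_mollify:
  fixes f :: "real^'n \<Rightarrow> 'b::{banach,second_countable_topology}"
  assumes f: "locally_integrable f" and t: "0 < t"
  shows "continuous_on UNIV (mollify t f)"
  unfolding continuous_on_iff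
proof (intro ballI allI impI)
  fix x :: "real^'n" and e :: real assume e: "0 < e"
  let ?I = "LINT y|lebesgue. indicator (cball x (t + 1)) y * norm (f y)"
  have I: "0 \<le> ?I" by (intro integral_nonneg_AE) simp
  have "0 < e / (?I + 1)" using e I by (intro divide_pos_pos) linarith+
  from mollify_equicontinuous[OF t this, where 'n='n] obtain d where d0: "0 < d"
    and d1: "\<forall>(f :: real^'n \<Rightarrow> 'b::{banach,second_countable_topology}) x x'. locally_integrable f \<longrightarrow> dist x x' < d \<longrightarrow>
       norm (mollify t f x - mollify t f x') \<le> e / (?I + 1) * (LINT y|lebesgue. indicator (cball x (t + 1)) y * norm (f y))"
    by (elim exE conjE)
  have d: "0 < d" "\<And>x'. dist x x' < d \<Longrightarrow> norm (mollify t f x - mollify t f x') \<le> e / (?I + 1) * ?I"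
    using d0 d1[rule_format, OF f] by blast+
  have "e / (a + 1) * a < e" if "0 \<le> a" for a :: real
    using that e by (simp add: field_simps)
  from this[OF I] have "dist (mollify t f x') (mollify t f x) < e" if "dist x' x < d" for x'
    using d(2)[of x'] that by (simp add: dist_norm norm_minus_commute)
  then show "\<exists>d>0. \<forall>x'\<in>UNIV. dist x' x < d \<longrightarrow> dist (mollify t f x') (mollify t f x) < e"
    using d(1) by blast
qed

lemma measurable_mollify:
  fixes f :: "real^'n \<Rightarrow> 'b::{banach,second_countable_topology}"
  shows "locally_integrable f \<Longrightarrow> 0 < t \<Longrightarrow> mollify t f \<in> borel_measurable lebesgue"
  by (intro borel_measurable_lebesgue_continuous continuous_on_mollify)

section \<open>Power weights on dyadic shells\<close>

abbreviation unit_ball_content :: "'n::finite itself \<Rightarrow> real" where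
  "unit_ball_content _ \<equiv> measure lebesgue (ball (0::real^'n) 1)"

lemma emeasure_lebesgue_ball: "0 \<le> r \<Longrightarrow> emeasure lebesgue (ball (c::real^'n) r) = ennreal (r ^ CARD('n) * unit_ball_content TYPE('n))"
  using content_ball_conv_unit_ball[of r c] emeasure_lborel_ball_finite[of c r]
  by (subst emeasure_eq_ennreal_measure) auto

lemma emeasure_lebesgue_cball: "0 \<le> r \<Longrightarrow> emeasure lebesgue (cball (c::real^'n) r) = ennreal (r ^ CARD('n) * unit_ball_content TYPE('n))"
  using content_ball_conv_unit_ball[of r c] content_cball_conv_ball[of c r] emeasure_lborel_cball_finite[of c r]
  by (subst emeasure_eq_ennreal_measure) auto

lemma nn_integral_power_shell:
  assumes s: "0 \<le> s" and r: "0 < r"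
  shows "(\<integral>\<^sup>+x\<in>{x::real^'n. r \<le> norm x \<and> norm x < 2 * r}. ennreal (norm x powr (- s)) \<partial>lebesgue)
    \<le> ennreal (2 ^ CARD('n) * unit_ball_content TYPE('n) * r powr (real CARD('n) - s))"
proof -
  let ?S = "{x::real^'n. r \<le> norm x \<and> norm x < 2 * r}"
  have "(\<integral>\<^sup>+x\<in>?S. ennreal (norm x powr (- s)) \<partial>lebesgue) \<le> (\<integral>\<^sup>+x. ennreal (r powr (- s)) * indicator (ball (0::real^'n) (2 * r)) x \<partial>lebesgue)"
  proof (rule nn_integral_mono)
    fix x :: "real^'n"
    show "ennreal (norm x powr (- s)) * indicator ?S x \<le> ennreal (r powr (- s)) * indicator (ball 0 (2 * r)) x"
      using s r by (auto split: split_indicator intro!: ennreal_leI powr_mono2')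
  qed
  also have "\<dots> = ennreal (r powr (- s)) * ennreal ((2 * r) ^ CARD('n) * unit_ball_content TYPE('n))"
    using r emeasure_lebesgue_ball[of "2 * r" "0::real^'n"] by (subst nn_integral_cmult_indicator) auto
  also have "\<dots> = ennreal (2 ^ CARD('n) * unit_ball_content TYPE('n) * r powr (real CARD('n) - s))"
    using r by (simp add: ennreal_mult[symmetric] power_mult_distrib powr_diff powr_minus powr_realpow divide_simps mult_ac)
  finally show ?thesis .
qed

lemma measurable_power_weight [measurable]: "(\<lambda>x::real^'n. norm x powr s) \<in> borel_measurable lebesgue"
proof -
  have "(\<lambda>x::real^'n. norm x powr s) \<in> borel_measurable borel" by measurable
  then show ?thesis by (intro measurable_completion) simp
qed

text \<open>
  A power of \<open>|x|\<close> is essentially constant on a shell \<open>r \<le> |x| < 2 r\<close>, so integrating it over a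
  region covered by shells reduces to a series in the radii. The origin lies in no shell, but
  the weight has the value 0 there.
\<close>

lemma nn_integral_power_shells:
  fixes r :: "nat \<Rightarrow> real"
  assumes s: "0 \<le> s" and r: "\<And>j. 0 < r j" and A: "A \<in> sets lebesgue"
    and cover: "\<And>x::real^'n. x \<in> A \<Longrightarrow> x \<noteq> 0 \<Longrightarrow> \<exists>j. r j \<le> norm x \<and> norm x < 2 * r j"
    and sums: "(\<lambda>j. r j powr (real CARD('n) - s)) sums c"
  shows "(\<integral>\<^sup>+x\<in>A. ennreal (norm x powr (- s)) \<partial>lebesgue) \<le> ennreal (2 ^ CARD('n) * unit_ball_content TYPE('n) * c)"
proof -
  let ?S = "\<lambda>j. {x::real^'n. r j \<le> norm x \<and> norm x < 2 * r j}"
  have S [measurable]: "?S j \<in> sets lebesgue" for j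
  proof -
    have "?S j \<in> sets borel" by measurable
    then show ?thesis by simp
  qed
  have "(\<integral>\<^sup>+x\<in>A. ennreal (norm x powr (- s)) \<partial>lebesgue)
      \<le> (\<integral>\<^sup>+x. (\<Sum>j. ennreal (norm x powr (- s)) * indicator (?S j) x) \<partial>lebesgue)"
  proof (rule nn_integral_mono)
    fix x :: "real^'n"
    show "ennreal (norm x powr (- s)) * indicator A x \<le> (\<Sum>j. ennreal (norm x powr (- s)) * indicator (?S j) x)"
    proof (cases "x \<in> A \<and> x \<noteq> 0")
      case True
      then obtain j where "x \<in> ?S j" using cover by blast
      then have "ennreal (norm x powr (- s)) * indicator A x \<le> (\<Sum>j\<in>{j}. ennreal (norm x powr (- s)) * indicator (?S j) x)"
        using True by simp
      also have "\<dots> \<le> (\<Sum>j. ennreal (norm x powr (- s)) * indicator (?S j) x)"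
        by (intro sum_le_suminf) auto
      finally show ?thesis .
    qed auto
  qed
  also have "\<dots> = (\<Sum>j. \<integral>\<^sup>+x\<in>?S j. ennreal (norm x powr (- s)) \<partial>lebesgue)"
    by (intro nn_integral_suminf borel_measurable_times_ennreal measurable_compose[OF measurable_power_weight measurable_ennreal]
       borel_measurable_indicator S)
  also have "\<dots> \<le> (\<Sum>j. ennreal (2 ^ CARD('n) * unit_ball_content TYPE('n) * r j powr (real CARD('n) - s)))"
    by (intro suminf_le nn_integral_power_shell s r) auto
  also have "\<dots> = ennreal (2 ^ CARD('n) * unit_ball_content TYPE('n) * c)"
    by (intro suminf_ennreal_eq sums_mult sums) auto
  finally show ?thesis .
qed

lemma geometric_powr_sums:
  assumes a: "0 < a" and r: "0 < (r::real)"
  shows "(\<lambda>j. (r / 2 ^ j) powr a) sums (r powr a / (1 - 2 powr (- a)))"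
proof -
  have eq: "(r / 2 ^ j) powr a = r powr a * (2 powr (- a)) ^ j" for j :: nat
  proof -
    have "(r / 2 ^ j) powr a = r powr a / (2 powr real j) powr a"
      using r by (simp add: powr_divide powr_realpow)
    also have "\<dots> = r powr a * 2 powr (- a * real j)"
      by (simp add: powr_powr powr_minus_divide mult.commute)
    also have "2 powr (- a * real j) = (2 powr (- a)) ^ j"
      using powr_realpow[of "2 powr (- a)" j] by (simp add: powr_powr)
    finally show ?thesis .
  qed
  have "2 powr (- a) < (1::real)" using a by (simp add: powr_less_one)
  then show ?thesis unfolding eq
    using sums_mult[OF geometric_sums[of "2 powr (- a) :: real"], of "r powr a"] by simp
qed

text \<open>
  Cover the ball by the shells of inner radius \<open>r / 2^(j+1)\<close>.
\<close>

lemma power_weight_near_origin: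
  assumes s: "0 \<le> s" "s < real CARD('n)"
  obtains C where "0 \<le> C" "\<And>r. 0 < r \<Longrightarrow>
    (\<integral>\<^sup>+x\<in>ball (0::real^'n) r. ennreal (norm x powr (- s)) \<partial>lebesgue) \<le> ennreal (C * r powr (real CARD('n) - s))"
proof (rule that)
  let ?a = "real CARD('n) - s"
  let ?C = "2 ^ CARD('n) * unit_ball_content TYPE('n) / (1 - 2 powr (- ?a))"
  have q: "2 powr (- ?a) < (1::real)" using s by (simp add: powr_less_one)
  then show "0 \<le> ?C" by simp
  fix r :: real assume r: "0 < r"
  have "(\<integral>\<^sup>+x\<in>ball (0::real^'n) r. ennreal (norm x powr (- s)) \<partial>lebesgue)
     \<le> ennreal (2 ^ CARD('n) * unit_ball_content TYPE('n) * ((r/2) powr ?a / (1 - 2 powr (- ?a))))"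
  proof (rule nn_integral_power_shells[OF s(1)])
    show "0 < r / 2 / 2 ^ j" for j :: nat using r by simp
    show "(\<lambda>j. (r / 2 / 2 ^ j) powr ?a) sums ((r/2) powr ?a / (1 - 2 powr (- ?a)))"
      using s r by (intro geometric_powr_sums) auto
    fix x :: "real^'n" assume x: "x \<in> ball 0 r" "x \<noteq> 0"
    obtain j :: nat where "(1/2) ^ j < norm x / r" using real_arch_pow_inv[of "norm x / r" "1/2"] x r by auto
    then have "r / 2 / 2 ^ j \<le> norm x" using r x by (auto simp: field_simps power_divide)
    then have ex: "\<exists>j::nat. r / 2 / 2 ^ j \<le> norm x" by blast
    define j where "j = (LEAST j::nat. r / 2 / 2 ^ j \<le> norm x)"
    have "r / 2 / 2 ^ j \<le> norm x" unfolding j_def using ex by (rule LeastI_ex)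
    moreover have "norm x < 2 * (r / 2 / 2 ^ j)"
    proof (cases j)
      case 0 then show ?thesis using x by simp
    next
      case (Suc i)
      then have "\<not> r / 2 / 2 ^ i \<le> norm x" unfolding j_def using not_less_Least lessI by metis
      then show ?thesis using Suc by simp
    qed
    ultimately show "\<exists>j. r / 2 / 2 ^ j \<le> norm x \<and> norm x < 2 * (r / 2 / 2 ^ j)" by blast
  qed simp
  also have "\<dots> \<le> ennreal (?C * r powr ?a)"
  proof (rule ennreal_leI)
    have "(r/2) powr ?a \<le> r powr ?a" using r s by (intro powr_mono2) auto
    then show "2 ^ CARD('n) * unit_ball_content TYPE('n) * ((r/2) powr ?a / (1 - 2 powr (- ?a))) \<le> ?C * r powr ?a"
      using q by (simp add: divide_right_mono mult_left_mono)
  qed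
  finally show "(\<integral>\<^sup>+x\<in>ball (0::real^'n) r. ennreal (norm x powr (- s)) \<partial>lebesgue) \<le> ennreal (?C * r powr ?a)" .
qed

text \<open>
  Cover the exterior by the shells of inner radius \<open>r * 2\<^sup>j\<close>.
\<close>

lemma power_weight_far:
  assumes s: "real CARD('n) < s"
  obtains C where "0 \<le> C" "\<And>r. 0 < r \<Longrightarrow>
    (\<integral>\<^sup>+x\<in>- ball (0::real^'n) r. ennreal (norm x powr (- s)) \<partial>lebesgue) \<le> ennreal (C * r powr (real CARD('n) - s))"
proof (rule that)
  let ?a = "s - real CARD('n)"
  let ?C = "2 ^ CARD('n) * unit_ball_content TYPE('n) / (1 - 2 powr (- ?a))"
  have q: "2 powr (- ?a) < (1::real)" using s by (simp add: powr_less_one)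
  then show "0 \<le> ?C" by simp
  fix r :: real assume r: "0 < r"
  have "(\<integral>\<^sup>+x\<in>- ball (0::real^'n) r. ennreal (norm x powr (- s)) \<partial>lebesgue)
     \<le> ennreal (2 ^ CARD('n) * unit_ball_content TYPE('n) * ((1 / r) powr ?a / (1 - 2 powr (- ?a))))"
  proof (rule nn_integral_power_shells)
    show "0 \<le> s" using s by simp
    show "0 < r * 2 ^ j" for j :: nat using r by simp
    have "(\<lambda>j. (1 / r / 2 ^ j) powr ?a) sums ((1 / r) powr ?a / (1 - 2 powr (- ?a)))"
      using s r by (intro geometric_powr_sums) auto
    moreover have "(1 / r / 2 ^ j) powr ?a = (r * 2 ^ j) powr (real CARD('n) - s)" for j :: nat
    proof -
      have "(1 / r / 2 ^ j) powr ?a = (1 / (r * 2 ^ j)) powr ?a" by simp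
      also have "\<dots> = (r * 2 ^ j) powr (- ?a)"
        using r powr_minus_divide[of "r * 2 ^ j" ?a] by (subst powr_divide) auto
      finally have "(1 / r / 2 ^ j) powr ?a = (r * 2 ^ j) powr (- ?a)" .
      then show ?thesis by simp
    qed
    ultimately show "(\<lambda>j. (r * 2 ^ j) powr (real CARD('n) - s)) sums ((1 / r) powr ?a / (1 - 2 powr (- ?a)))" by simp
    fix x :: "real^'n" assume x: "x \<in> - ball 0 r"
    obtain j :: nat where "norm x / r < 2 ^ j" using real_arch_pow[of 2 "norm x / r"] by auto
    then have ex: "\<exists>j::nat. norm x < 2 * (r * 2 ^ j)"
    proof (intro exI[of _ j])
      have "norm x < r * 2 ^ j" using \<open>norm x / r < 2 ^ j\<close> r by (simp add: field_simps)
      moreover have "0 < r * 2 ^ j" using r by simp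
      ultimately show "norm x < 2 * (r * 2 ^ j)" by linarith
    qed
    define j where "j = (LEAST j::nat. norm x < 2 * (r * 2 ^ j))"
    have "norm x < 2 * (r * 2 ^ j)" unfolding j_def using ex by (rule LeastI_ex)
    moreover have "r * 2 ^ j \<le> norm x"
    proof (cases j)
      case 0 then show ?thesis using x by simp
    next
      case (Suc i)
      then have "\<not> norm x < 2 * (r * 2 ^ i)" unfolding j_def using not_less_Least lessI by metis
      then show ?thesis using Suc by simp
    qed
    ultimately show "\<exists>j. r * 2 ^ j \<le> norm x \<and> norm x < 2 * (r * 2 ^ j)" by blast
  qed (auto intro: borel_comp)
  also have "\<dots> = ennreal (?C * r powr (real CARD('n) - s))"
    using r powr_minus_divide[of r ?a] by (simp add: powr_divide mult.commute)
  finally show "(\<integral>\<^sup>+x\<in>- ball (0::real^'n) r. ennreal (norm x powr (- s)) \<partial>lebesgue) \<le> ennreal (?C * r powr (real CARD('n) - s))" .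
qed

section \<open>Bounds for one dyadic step\<close>

lemma sigma_finite_lebesgue: "sigma_finite_measure (lebesgue :: 'a::euclidean_space measure)"
proof -
  obtain A :: "'a set set" where A: "countable A" "A \<subseteq> sets lborel" "\<Union>A = space lborel" "\<forall>a\<in>A. emeasure lborel a \<noteq> \<infinity>"
    using sigma_finite_measure.sigma_finite_countable[OF sigma_finite_lborel] by blast
  then show ?thesis
    unfolding sigma_finite_measure_def by (intro exI[of _ A]) auto
qed

interpretation lebesgue_pair: pair_sigma_finite "lebesgue :: (real^'n) measure" "lebesgue :: (real^'n) measure"
  by (intro pair_sigma_finite.intro sigma_finite_lebesgue)

text \<open>
  The product of two completed measures is not complete, but it contains the Borel sets of the
  product space.
\<close>

lemma measurable_continuous_pair_lebesgue:
  fixes h :: "(real^'n) \<times> (real^'n) \<Rightarrow> real"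
  assumes "continuous_on UNIV h"
  shows "h \<in> borel_measurable (lebesgue \<Otimes>\<^sub>M lebesgue)"
proof -
  have "(\<lambda>p :: (real^'n) \<times> (real^'n). (fst p, snd p)) \<in> lebesgue \<Otimes>\<^sub>M lebesgue \<rightarrow>\<^sub>M (borel :: (real^'n) measure) \<Otimes>\<^sub>M borel"
  proof (rule measurable_Pair)
    have id: "(\<lambda>x::real^'n. x) \<in> lebesgue \<rightarrow>\<^sub>M borel"
      by (intro measurable_completion) simp
    show "(fst :: (real^'n) \<times> (real^'n) \<Rightarrow> _) \<in> lebesgue \<Otimes>\<^sub>M lebesgue \<rightarrow>\<^sub>M borel"
      using measurable_compose[OF measurable_fst id] .
    show "(snd :: (real^'n) \<times> (real^'n) \<Rightarrow> _) \<in> lebesgue \<Otimes>\<^sub>M lebesgue \<rightarrow>\<^sub>M borel"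
      using measurable_compose[OF measurable_snd id] .
  qed
  then have "(\<lambda>p. p) \<in> lebesgue \<Otimes>\<^sub>M lebesgue \<rightarrow>\<^sub>M (borel :: ((real^'n) \<times> (real^'n)) measure)"
    by (simp add: borel_prod)
  from measurable_compose[OF this borel_measurable_continuous_onI[OF assms]] show ?thesis .
qed

text \<open>
  Tonelli: each point \<open>y\<close> is counted with the measure of the ball about \<open>y\<close>.
\<close>

lemma
  fixes u :: "real^'n \<Rightarrow> ennreal"
  assumes u: "u \<in> borel_measurable lebesgue"
  shows measurable_ball_average: "(\<lambda>x. \<integral>\<^sup>+y\<in>cball x t. u y \<partial>lebesgue) \<in> borel_measurable lebesgue"
    and nn_integral_ball_average: "0 \<le> t \<Longrightarrow> (\<integral>\<^sup>+x. (\<integral>\<^sup>+y\<in>cball x t. u y \<partial>lebesgue) \<partial>lebesgue)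
    = ennreal (t ^ CARD('n) * unit_ball_content TYPE('n)) * (\<integral>\<^sup>+y. u y \<partial>lebesgue)"
proof -
  have d: "(\<lambda>p::(real^'n) \<times> (real^'n). dist (fst p) (snd p)) \<in> borel_measurable (lebesgue \<Otimes>\<^sub>M lebesgue)"
    by (intro measurable_continuous_pair_lebesgue continuous_intros)
  have m: "(\<lambda>(x, y). u y * indicator (cball x t) y) \<in> borel_measurable ((lebesgue :: (real^'n) measure) \<Otimes>\<^sub>M lebesgue)"
  proof -
    have [measurable]: "(\<lambda>p::(real^'n) \<times> (real^'n). u (snd p)) \<in> borel_measurable (lebesgue \<Otimes>\<^sub>M lebesgue)"
      using measurable_compose[OF measurable_snd u] .
    have [measurable]: "{p::(real^'n) \<times> (real^'n). dist (fst p) (snd p) \<le> t} \<in> sets (lebesgue \<Otimes>\<^sub>M lebesgue)"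
      using borel_measurable_le[OF d borel_measurable_const[of t]] by (simp add: space_pair_measure)
    have "(\<lambda>p. u (snd p) * indicator {p::(real^'n) \<times> (real^'n). dist (fst p) (snd p) \<le> t} p) \<in> borel_measurable (lebesgue \<Otimes>\<^sub>M lebesgue)"
      by measurable
    then show ?thesis by (simp add: case_prod_beta' indicator_def)
  qed
  from sigma_finite_measure.borel_measurable_nn_integral[OF sigma_finite_lebesgue m]
  show "(\<lambda>x. \<integral>\<^sup>+y\<in>cball x t. u y \<partial>lebesgue) \<in> borel_measurable lebesgue" .
  assume t: "0 \<le> t"
  have "(\<integral>\<^sup>+x. (\<integral>\<^sup>+y\<in>cball x t. u y \<partial>lebesgue) \<partial>lebesgue)
      = (\<integral>\<^sup>+y. (\<integral>\<^sup>+x. u y * indicator (cball x t) y \<partial>lebesgue) \<partial>lebesgue)"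
    using lebesgue_pair.Fubini[OF m] by simp
  also have "\<dots> = (\<integral>\<^sup>+y. u y * ennreal (t ^ CARD('n) * unit_ball_content TYPE('n)) \<partial>lebesgue)"
  proof (intro nn_integral_cong)
    fix y :: "real^'n"
    have "(\<integral>\<^sup>+x. u y * indicator (cball x t) y \<partial>lebesgue) = (\<integral>\<^sup>+x. u y * indicator (cball y t) x \<partial>lebesgue)"
      by (intro nn_integral_cong) (simp add: indicator_def dist_commute)
    also have "\<dots> = u y * ennreal (t ^ CARD('n) * unit_ball_content TYPE('n))"
      using t emeasure_lebesgue_cball[OF t, of y] by (subst nn_integral_cmult_indicator) auto
    finally show "(\<integral>\<^sup>+x. u y * indicator (cball x t) y \<partial>lebesgue) = \<dots>" .
  qed
  also have "\<dots> = ennreal (t ^ CARD('n) * unit_ball_content TYPE('n)) * (\<integral>\<^sup>+y. u y \<partial>lebesgue)"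
    using u by (simp add: nn_integral_multc mult.commute)
  finally show "(\<integral>\<^sup>+x. (\<integral>\<^sup>+y\<in>cball x t. u y \<partial>lebesgue) \<partial>lebesgue)
    = ennreal (t ^ CARD('n) * unit_ball_content TYPE('n)) * (\<integral>\<^sup>+y. u y \<partial>lebesgue)" .
qed

text \<open>
  Cauchy-Schwarz on the ball; its measure \<open>t\<^sup>N\<close> cancels one of the two factors \<open>t^(-N)\<close>.
\<close>

lemma dyadic_difference_square:
  fixes f :: "real^'n \<Rightarrow> complex"
  assumes w: "has_weak_gradient f g" and t: "0 < t"
  shows "ennreal ((norm (mollify t f x - mollify (t/2) f x))\<^sup>2) \<le>
    ennreal ((dyadic_const TYPE('n))\<^sup>2 * unit_ball_content TYPE('n) * t\<^sup>2 / t ^ CARD('n))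
      * (\<integral>\<^sup>+y\<in>cball x t. ennreal ((norm (g y))\<^sup>2) \<partial>lebesgue)"
proof -
  let ?N = "CARD('n)" and ?v = "unit_ball_content TYPE('n)" and ?D = "dyadic_const TYPE('n)"
  let ?I = "LINT y|lebesgue. indicator (cball x t) y * norm (g y)"
  have g: "locally_integrable g" using w by (auto simp: has_weak_gradient_def)
  have gm: "g \<in> borel_measurable lebesgue" using g by (simp add: locally_integrable_def)
  have int_g: "integrable lebesgue (\<lambda>y. indicator (cball x t) y * norm (g y))"
    by (rule integrable_norm_on_cball[OF g])
  have I0: "0 \<le> ?I" by (intro integral_nonneg_AE) simp
  have gn [measurable]: "(\<lambda>y. ennreal (norm (g y))) \<in> borel_measurable lebesgue"
    using gm by measurable
  have cb [measurable]: "cball x t \<in> sets lebesgue" by simp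
  have "ennreal ?I = (\<integral>\<^sup>+y. (ennreal (norm (g y)) * indicator (cball x t) y) * indicator (cball x t) y \<partial>lebesgue)"
  proof -
    have "ennreal ?I = (\<integral>\<^sup>+y. ennreal (indicator (cball x t) y * norm (g y)) \<partial>lebesgue)"
      using nn_integral_eq_integral[OF int_g] by simp
    also have "\<dots> = (\<integral>\<^sup>+y. (ennreal (norm (g y)) * indicator (cball x t) y) * indicator (cball x t) y \<partial>lebesgue)"
      by (intro nn_integral_cong) (simp split: split_indicator)
    finally show ?thesis .
  qed
  then have "(ennreal ?I)\<^sup>2 \<le> (\<integral>\<^sup>+y. (ennreal (norm (g y)) * indicator (cball x t) y)\<^sup>2 \<partial>lebesgue) * (\<integral>\<^sup>+y. (indicator (cball x t) y)\<^sup>2 \<partial>lebesgue)"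
    by (simp only:) (rule Cauchy_Schwarz_nn_integral, measurable)
  also have "(\<integral>\<^sup>+y. (ennreal (norm (g y)) * indicator (cball x t) y)\<^sup>2 \<partial>lebesgue) = (\<integral>\<^sup>+y\<in>cball x t. ennreal ((norm (g y))\<^sup>2) \<partial>lebesgue)"
    by (intro nn_integral_cong) (simp add: indicator_def ennreal_power)
  also have "(\<integral>\<^sup>+y. (indicator (cball x t) y)\<^sup>2 \<partial>lebesgue) = (\<integral>\<^sup>+y. indicator (cball x t) y \<partial>lebesgue)"
    by (intro nn_integral_cong) (simp add: indicator_def)
  also have "(\<integral>\<^sup>+y. indicator (cball x t) y \<partial>lebesgue) = ennreal (t ^ ?N * ?v)"
    using t emeasure_lebesgue_cball[of t x] by (subst nn_integral_indicator) auto
  finally have CS: "ennreal (?I\<^sup>2) \<le> (\<integral>\<^sup>+y\<in>cball x t. ennreal ((norm (g y))\<^sup>2) \<partial>lebesgue) * ennreal (t ^ ?N * ?v)"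
    using I0 by (simp add: ennreal_power)
  have "(norm (mollify t f x - mollify (t/2) f x))\<^sup>2 \<le> (?D * t / t ^ ?N * ?I)\<^sup>2"
    by (intro power_mono mollify_dyadic_difference[OF w t]) simp
  also have "\<dots> = (?D * t / t ^ ?N)\<^sup>2 * ?I\<^sup>2"
    by (rule power_mult_distrib)
  finally have "ennreal ((norm (mollify t f x - mollify (t/2) f x))\<^sup>2) \<le> ennreal ((?D * t / t ^ ?N)\<^sup>2) * ennreal (?I\<^sup>2)"
    by (simp add: ennreal_mult[symmetric])
  also have "\<dots> \<le> ennreal ((?D * t / t ^ ?N)\<^sup>2) * ((\<integral>\<^sup>+y\<in>cball x t. ennreal ((norm (g y))\<^sup>2) \<partial>lebesgue) * ennreal (t ^ ?N * ?v))"
    by (intro mult_left_mono CS) simp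
  also have "\<dots> = (ennreal ((?D * t / t ^ ?N)\<^sup>2) * ennreal (t ^ ?N * ?v)) * (\<integral>\<^sup>+y\<in>cball x t. ennreal ((norm (g y))\<^sup>2) \<partial>lebesgue)"
    by (simp only: mult_ac)
  also have "ennreal ((?D * t / t ^ ?N)\<^sup>2) * ennreal (t ^ ?N * ?v) = ennreal (?D\<^sup>2 * ?v * t\<^sup>2 / t ^ ?N)"
    using t by (simp add: ennreal_mult[symmetric] power2_eq_square mult_ac)
  finally show ?thesis .
qed

text \<open>
  One constant that serves for both norms in the two bounds below.
\<close>

definition difference_const :: "'n::finite itself \<Rightarrow> real" where
  "difference_const _ = dyadic_const TYPE('n) * (1 + unit_ball_content TYPE('n)) + 1"

lemma difference_const_pos: "0 < difference_const TYPE('n::finite)"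
  unfolding difference_const_def
  using mult_nonneg_nonneg[OF dyadic_const_nonneg[where 'n='n], of "1 + unit_ball_content TYPE('n)"] by simp

lemma
  fixes f :: "real^'n \<Rightarrow> complex"
  assumes w: "has_weak_gradient f g"
    and gG: "L2_energy g \<le> ennreal (G\<^sup>2)"
    and G: "0 \<le> G" and t: "0 < t"
  shows dyadic_difference_sup:
      "norm (mollify t f x - mollify (t/2) f x) \<le> difference_const TYPE('n) * t powr (1 - real CARD('n) / 2) * G"
    and dyadic_difference_L2:
      "(\<integral>\<^sup>+x. ennreal ((norm (mollify t f x - mollify (t/2) f x))\<^sup>2) \<partial>lebesgue)
        \<le> ennreal ((difference_const TYPE('n))\<^sup>2 * t\<^sup>2 * G\<^sup>2)"
proof -
  let ?N = "CARD('n)" and ?v = "unit_ball_content TYPE('n)" and ?D = "dyadic_const TYPE('n)"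
  define C where "C = difference_const TYPE('n)"
  have D0: "0 \<le> ?D" by (rule dyadic_const_nonneg)
  have v0: "0 \<le> ?v" by simp
  have C: "0 < C" "?D * (1 + ?v) \<le> C"
    unfolding C_def using difference_const_pos[where 'n='n] by (simp_all add: difference_const_def)
  \<comment> \<open>\<open>?D\<^sup>2 * ?v\<close> is the squared constant of the supremum bound, \<open>?D\<^sup>2 * ?v * ?v\<close> that of the
    \<open>L\<^sup>2\<close> bound\<close>
  have C1: "?D\<^sup>2 * ?v \<le> C\<^sup>2"
  proof -
    have "?v \<le> (1 + ?v)\<^sup>2" using v0 by (simp add: power2_eq_square algebra_simps)
    then have "?D\<^sup>2 * ?v \<le> (?D * (1 + ?v))\<^sup>2" by (simp add: power_mult_distrib mult_left_mono)
    also have "\<dots> \<le> C\<^sup>2" using C D0 v0 by (intro power_mono) auto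
    finally show ?thesis .
  qed
  have C2: "?D\<^sup>2 * ?v * ?v \<le> C\<^sup>2"
  proof -
    have "?v * ?v \<le> (1 + ?v)\<^sup>2" using v0 by (simp add: power2_eq_square algebra_simps)
    then have "?D\<^sup>2 * (?v * ?v) \<le> (?D * (1 + ?v))\<^sup>2" unfolding power_mult_distrib by (intro mult_left_mono) auto
    also have "\<dots> \<le> C\<^sup>2" using C D0 v0 by (intro power_mono) auto
    finally show ?thesis by (simp add: mult.assoc)
  qed
  let ?a = "\<lambda>x. mollify t f x - mollify (t/2) f x"
  have gm: "(\<lambda>y. ennreal ((norm (g y))\<^sup>2)) \<in> borel_measurable lebesgue"
    using w by (auto simp: has_weak_gradient_def locally_integrable_def)
  have sq: "ennreal ((norm (?a x))\<^sup>2) \<le> ennreal (?D\<^sup>2 * ?v * t\<^sup>2 / t ^ ?N) * (\<integral>\<^sup>+y\<in>cball x t. ennreal ((norm (g y))\<^sup>2) \<partial>lebesgue)" for x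
    by (rule dyadic_difference_square[OF w t])
  show "norm (?a x) \<le> difference_const TYPE('n) * t powr (1 - real ?N / 2) * G" for x

    proof -
      have "(\<integral>\<^sup>+y\<in>cball x t. ennreal ((norm (g y))\<^sup>2) \<partial>lebesgue) \<le> L2_energy g"
        by (intro nn_integral_mono) (simp split: split_indicator)
      then have "ennreal ((norm (?a x))\<^sup>2) \<le> ennreal (?D\<^sup>2 * ?v * t\<^sup>2 / t ^ ?N) * ennreal (G\<^sup>2)"
        using sq[of x] gG by (meson mult_left_mono order_trans zero_le)
      also have "\<dots> = ennreal (?D\<^sup>2 * ?v * t\<^sup>2 / t ^ ?N * G\<^sup>2)"
        using t by (intro ennreal_mult[symmetric]) auto
      finally have "(norm (?a x))\<^sup>2 \<le> ?D\<^sup>2 * ?v * (t\<^sup>2 / t ^ ?N * G\<^sup>2)"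
        using t by (subst (asm) ennreal_le_iff) auto
      also have "\<dots> \<le> C\<^sup>2 * (t\<^sup>2 / t ^ ?N * G\<^sup>2)"
        using t by (intro mult_right_mono C1) auto
      also have "t\<^sup>2 / t ^ ?N = (t powr (1 - real ?N / 2))\<^sup>2"
      proof -
        have "(t powr (1 - real ?N / 2))\<^sup>2 = t powr (2 - real ?N)"
          by (simp add: power2_eq_square powr_add[symmetric])
        also have "\<dots> = t\<^sup>2 / t ^ ?N" using t by (simp add: powr_diff powr_realpow)
        finally show ?thesis by simp
      qed
      finally have "(norm (?a x))\<^sup>2 \<le> (C * t powr (1 - real ?N / 2) * G)\<^sup>2"
        by (simp add: power_mult_distrib mult.assoc)
      then have "norm (?a x) \<le> C * t powr (1 - real ?N / 2) * G"
        using C(1) G by (intro power2_le_imp_le[of "norm (?a x)"]) auto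
      then show ?thesis by (simp only: C_def)
    qed
  show "L2_energy ?a \<le> ennreal ((difference_const TYPE('n))\<^sup>2 * t\<^sup>2 * G\<^sup>2)"

    proof -
      have "L2_energy ?a
        \<le> (\<integral>\<^sup>+x. ennreal (?D\<^sup>2 * ?v * t\<^sup>2 / t ^ ?N) * (\<integral>\<^sup>+y\<in>cball x t. ennreal ((norm (g y))\<^sup>2) \<partial>lebesgue) \<partial>lebesgue)"
        by (intro nn_integral_mono sq)
      also have "\<dots> \<le> ennreal (?D\<^sup>2 * ?v * t\<^sup>2 / t ^ ?N) * (\<integral>\<^sup>+x. (\<integral>\<^sup>+y\<in>cball x t. ennreal ((norm (g y))\<^sup>2) \<partial>lebesgue) \<partial>lebesgue)"
      proof (rule eq_refl, rule nn_integral_cmult)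
        show "(\<lambda>x. \<integral>\<^sup>+y\<in>cball x t. ennreal ((norm (g y))\<^sup>2) \<partial>lebesgue) \<in> borel_measurable lebesgue"
          by (rule measurable_ball_average[OF gm])
      qed
      also have "\<dots> \<le> ennreal (?D\<^sup>2 * ?v * t\<^sup>2 / t ^ ?N) * (ennreal (t ^ ?N * ?v) * ennreal (G\<^sup>2))"
        using t by (subst nn_integral_ball_average[OF gm]) (auto intro!: mult_left_mono gG)
      also have "\<dots> = ennreal (?D\<^sup>2 * ?v * ?v * (t\<^sup>2 * G\<^sup>2))"
        using t by (simp add: ennreal_mult[symmetric] mult_ac)
      also have "\<dots> \<le> ennreal (C\<^sup>2 * t\<^sup>2 * G\<^sup>2)"
        unfolding mult.assoc[of "C\<^sup>2"] by (intro ennreal_leI mult_right_mono C2) auto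
      finally show ?thesis by (simp only: C_def)
    qed
qed

text \<open>
  Inside the ball of radius \<open>t\<close> about the origin the supremum bound meets the integral \<open>t^(N-b)\<close> of
  the weight; outside it the weight is at most \<open>t^(-b)\<close>, and \<open>p - 2\<close> factors are estimated by the
  supremum and the remaining two in \<open>L\<^sup>2\<close>. Both regions contribute the same power of \<open>t\<close>.
\<close>

lemma dyadic_difference_weighted:
  fixes b p :: real
  assumes b: "0 \<le> b" "b < real CARD('n)" and p: "2 \<le> p"
  shows "\<exists>C\<ge>0. \<forall>(f :: real^'n \<Rightarrow> complex) g G t. has_weak_gradient f g \<longrightarrow>
      L2_energy g \<le> ennreal (G\<^sup>2) \<longrightarrow> 0 \<le> G \<longrightarrow> 0 < t \<longrightarrow>
      (\<integral>\<^sup>+x. ennreal (norm x powr (- b) * norm (mollify t f x - mollify (t/2) f x) powr p) \<partial>lebesgue)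
        \<le> ennreal (C * t powr (real CARD('n) - b - p * (real CARD('n) / 2 - 1)) * G powr p)"
proof -
  let ?N = "real CARD('n)"
  let ?\<alpha> = "?N - b - p * (?N / 2 - 1)"
  let ?C1 = "difference_const TYPE('n)"
  note sup = dyadic_difference_sup and sq = dyadic_difference_L2
  have C1: "0 < ?C1" by (rule difference_const_pos)
  obtain C2 where C2: "0 \<le> C2" "\<And>r. 0 < r \<Longrightarrow>
    (\<integral>\<^sup>+x\<in>ball (0::real^'n) r. ennreal (norm x powr (- b)) \<partial>lebesgue) \<le> ennreal (C2 * r powr (?N - b))"
    using power_weight_near_origin[OF b] by blast
  show ?thesis
  proof (intro exI[of _ "?C1 powr p * (C2 + 1)"] conjI allI impI)
    show "0 \<le> ?C1 powr p * (C2 + 1)" using C2 by simp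
    fix f :: "real^'n \<Rightarrow> complex" and g G t
    assume w: "has_weak_gradient f g" and gG: "L2_energy g \<le> ennreal (G\<^sup>2)"
      and G: "0 \<le> G" and t: "0 < (t::real)"
    let ?a = "\<lambda>x. mollify t f x - mollify (t/2) f x"
    let ?S = "?C1 * t powr (1 - ?N / 2) * G"
    have S0: "0 \<le> ?S" using C1 G by simp
    have f: "locally_integrable f" using w by (simp add: has_weak_gradient_def)
    have am: "?a \<in> borel_measurable lebesgue"
      using measurable_mollify[OF f t] measurable_mollify[OF f, of "t/2"] t by auto
    then have am2 [measurable]: "(\<lambda>x. ennreal ((norm (?a x))\<^sup>2)) \<in> borel_measurable lebesgue" by measurable
    have wm [measurable]: "(\<lambda>x::real^'n. ennreal (norm x powr (- b))) \<in> borel_measurable lebesgue"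
      using measurable_power_weight[of "- b"] by measurable
    have bl [measurable]: "ball 0 t \<in> sets lebesgue" by simp
    have pt: "ennreal (norm x powr (- b) * norm (?a x) powr p) \<le>
        ennreal (?S powr p) * (ennreal (norm x powr (- b)) * indicator (ball (0::real^'n) t) x)
        + ennreal (t powr (- b) * ?S powr (p - 2)) * ennreal ((norm (?a x))\<^sup>2)" for x
    proof (cases "norm x < t")
      case True
      have "norm (?a x) powr p \<le> ?S powr p"
        using sup[OF w gG G t, of x] p by (intro powr_mono2) auto
      then have "norm x powr (- b) * norm (?a x) powr p \<le> ?S powr p * norm x powr (- b)"
        using mult_right_mono[of "norm (?a x) powr p" "?S powr p" "norm x powr (- b)"] by (simp add: mult.commute)
      then have "ennreal (norm x powr (- b) * norm (?a x) powr p) \<le>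
        ennreal (?S powr p) * (ennreal (norm x powr (- b)) * indicator (ball (0::real^'n) t) x)"
        using True by (simp add: ennreal_mult[symmetric] ennreal_leI)
      then show ?thesis by (rule order_trans) simp
    next
      case False
      have "norm (?a x) powr p = norm (?a x) powr (p - 2) * (norm (?a x))\<^sup>2"
        by (cases "norm (?a x) = 0") (auto simp: powr_diff)
      also have "\<dots> \<le> ?S powr (p - 2) * (norm (?a x))\<^sup>2"
        using sup[OF w gG G t, of x] p by (intro mult_right_mono powr_mono2) auto
      finally have 1: "norm (?a x) powr p \<le> ?S powr (p - 2) * (norm (?a x))\<^sup>2" .
      have 2: "norm x powr (- b) \<le> t powr (- b)"
        using False t b by (intro powr_mono2') auto
      have "norm x powr (- b) * norm (?a x) powr p \<le> t powr (- b) * (?S powr (p - 2) * (norm (?a x))\<^sup>2)"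
        using 1 2 by (intro mult_mono) auto
      then have "ennreal (norm x powr (- b) * norm (?a x) powr p) \<le> ennreal (t powr (- b) * ?S powr (p - 2)) * ennreal ((norm (?a x))\<^sup>2)"
        by (simp add: ennreal_mult[symmetric] ennreal_leI mult.assoc)
      then show ?thesis using False by simp
    qed
    have "(\<integral>\<^sup>+x. ennreal (norm x powr (- b) * norm (?a x) powr p) \<partial>lebesgue) \<le>
      (\<integral>\<^sup>+x. ennreal (?S powr p) * (ennreal (norm x powr (- b)) * indicator (ball (0::real^'n) t) x)
        + ennreal (t powr (- b) * ?S powr (p - 2)) * ennreal ((norm (?a x))\<^sup>2) \<partial>lebesgue)"
      by (intro nn_integral_mono pt)
    also have "\<dots> = (\<integral>\<^sup>+x. ennreal (?S powr p) * (ennreal (norm x powr (- b)) * indicator (ball (0::real^'n) t) x) \<partial>lebesgue)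
        + (\<integral>\<^sup>+x. ennreal (t powr (- b) * ?S powr (p - 2)) * ennreal ((norm (?a x))\<^sup>2) \<partial>lebesgue)"
      by (rule nn_integral_add) measurable
    also have "(\<integral>\<^sup>+x. ennreal (?S powr p) * (ennreal (norm x powr (- b)) * indicator (ball (0::real^'n) t) x) \<partial>lebesgue)
        = ennreal (?S powr p) * (\<integral>\<^sup>+x\<in>ball (0::real^'n) t. ennreal (norm x powr (- b)) \<partial>lebesgue)"
      by (rule nn_integral_cmult) measurable
    also have "(\<integral>\<^sup>+x. ennreal (t powr (- b) * ?S powr (p - 2)) * ennreal ((norm (?a x))\<^sup>2) \<partial>lebesgue)
        = ennreal (t powr (- b) * ?S powr (p - 2)) * L2_energy ?a"
      by (rule nn_integral_cmult) measurable
    also have "ennreal (?S powr p) * (\<integral>\<^sup>+x\<in>ball (0::real^'n) t. ennreal (norm x powr (- b)) \<partial>lebesgue)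
        + ennreal (t powr (- b) * ?S powr (p - 2)) * L2_energy ?a
      \<le> ennreal (?S powr p) * ennreal (C2 * t powr (?N - b))
        + ennreal (t powr (- b) * ?S powr (p - 2)) * ennreal (?C1\<^sup>2 * t\<^sup>2 * G\<^sup>2)"
      by (intro add_mono mult_left_mono C2(2) sq[OF w gG G t] t) auto
    also have "\<dots> = ennreal (?S powr p * (C2 * t powr (?N - b)) + t powr (- b) * ?S powr (p - 2) * (?C1\<^sup>2 * t\<^sup>2 * G\<^sup>2))"
      using C2(1) by (simp add: ennreal_mult[symmetric] ennreal_plus[symmetric] del: ennreal_plus)
    also have "?S powr p * (C2 * t powr (?N - b)) + t powr (- b) * ?S powr (p - 2) * (?C1\<^sup>2 * t\<^sup>2 * G\<^sup>2)
      = ?C1 powr p * (C2 + 1) * t powr ?\<alpha> * G powr p"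
    proof (cases "G = 0")
      case True then show ?thesis using p by simp
    next
      case False
      then have G': "0 < G" using G by simp
      have Sp: "?S powr q = ?C1 powr q * t powr (q * (1 - ?N / 2)) * G powr q" for q
        using C1 G' t by (simp add: powr_mult powr_powr mult.commute)
      have cg: "?C1 powr (p - 2) * ?C1\<^sup>2 = ?C1 powr p" "G powr (p - 2) * G\<^sup>2 = G powr p"
        using C1 G' by (simp_all add: powr_diff)
      have ta: "t powr (- b) * t powr ((p - 2) * (1 - ?N / 2)) * t\<^sup>2 = t powr ?\<alpha>"
      proof -
        have "t\<^sup>2 = t powr 2" using t by simp
        moreover have "- b + (p - 2) * (1 - ?N / 2) + 2 = ?\<alpha>" by (simp add: field_simps)
        ultimately show ?thesis by (simp only: powr_add[symmetric])
      qed
      have tb: "t powr (p * (1 - ?N / 2)) * t powr (?N - b) = t powr ?\<alpha>"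
        by (simp add: powr_add[symmetric] algebra_simps)
      have reorder: "x1 * x2 * x3 * (C2 * x4) + x5 * (y1 * y2 * y3) * (z1 * z2 * z3)
         = x1 * C2 * (x2 * x4) * x3 + (y1 * z1) * (x5 * y2 * z2) * (y3 * z3)" for x1 x2 x3 x4 x5 y1 y2 y3 z1 z2 z3 :: real
        by (simp add: mult_ac)
      show ?thesis unfolding Sp reorder cg ta tb by (simp add: algebra_simps)
    qed
    finally show "(\<integral>\<^sup>+x. ennreal (norm x powr (- b) * norm (?a x) powr p) \<partial>lebesgue)
        \<le> ennreal (?C1 powr p * (C2 + 1) * t powr ?\<alpha> * G powr p)" .
  qed
qed

section \<open>Summing the dyadic steps\<close>

text \<open>
  If the weighted series \<open>T\<close> of the \<open>p\<close>-th powers of the increments is finite, the increments decay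
  geometrically with ratio \<open>\<beta>^(1/p)\<close>, and the sum of the geometric series bounds the distance to
  the limit.
\<close>

lemma telescoping_limit_bound:
  fixes z :: "nat \<Rightarrow> complex"
  assumes p: "0 < p" and \<beta>: "0 < \<beta>" "\<beta> < 1" and W: "0 < W"
    and T: "(\<Sum>j. ennreal ((1 / \<beta>) ^ j * (W * norm (z (Suc j) - z j) powr p))) = T" "T < \<infinity>"
  shows "convergent z"
    and "z \<longlonglongrightarrow> l \<Longrightarrow> ennreal (W * norm (l - z 0) powr p) \<le> ennreal (1 / (1 - \<beta> powr (1/p)) powr p) * T"
proof -
  obtain \<tau> where \<tau>: "0 \<le> \<tau>" "T = ennreal \<tau>" using T(2) by (cases T) auto
  let ?\<gamma> = "\<beta> powr (1/p)"
  let ?s = "(\<tau> / W) powr (1/p)"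
  have \<gamma>: "0 < ?\<gamma>" "?\<gamma> < 1" using \<beta> p powr_less_mono2[of "1/p" \<beta> 1] by auto
  have d: "norm (z (Suc j) - z j) \<le> ?s * ?\<gamma> ^ j" for j
  proof -
    have "(\<Sum>i\<in>{j}. ennreal ((1 / \<beta>) ^ i * (W * norm (z (Suc i) - z i) powr p))) \<le> T"
      unfolding T(1)[symmetric] by (intro sum_le_suminf) auto
    then have "(1 / \<beta>) ^ j * (W * norm (z (Suc j) - z j) powr p) \<le> \<tau>"
      using \<tau> by simp
    then have "norm (z (Suc j) - z j) powr p \<le> (\<tau> / W) * \<beta> ^ j"
      using W \<beta> by (simp add: field_simps power_divide)
    then have "(norm (z (Suc j) - z j) powr p) powr (1/p) \<le> ((\<tau> / W) * \<beta> ^ j) powr (1/p)"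
      using p by (intro powr_mono2) auto
    also have "(norm (z (Suc j) - z j) powr p) powr (1/p) = norm (z (Suc j) - z j)"
      using p by (simp add: powr_powr)
    also have "((\<tau> / W) * \<beta> ^ j) powr (1/p) = ?s * ?\<gamma> ^ j"
    proof -
      have "(\<beta> ^ j) powr (1/p) = ?\<gamma> ^ j"
        using \<beta> \<gamma> by (simp add: powr_realpow[symmetric] powr_powr mult.commute)
      then show ?thesis using \<tau> W \<beta> powr_mult[of "\<tau> / W" "\<beta> ^ j" "1/p"] by (simp only:)
    qed
    finally show ?thesis .
  qed
  have geo: "summable (\<lambda>j. ?s * ?\<gamma> ^ j)" using \<gamma> by (intro summable_mult summable_geometric) auto
  have sm: "summable (\<lambda>j. z (Suc j) - z j)"
    by (rule summable_comparison_test'[OF geo d])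
  have tele: "(\<Sum>j<n. z (Suc j) - z j) = z n - z 0" for n
    by (induction n) auto
  have "(\<lambda>n. z n - z 0) \<longlonglongrightarrow> (\<Sum>j. z (Suc j) - z j)"
    using summable_LIMSEQ[OF sm] by (simp add: tele)
  from tendsto_add[OF this tendsto_const[of "z 0"]] show "convergent z"
    by (auto simp: convergent_def)
  assume l: "z \<longlonglongrightarrow> l"
  have bd: "norm (z n - z 0) \<le> ?s / (1 - ?\<gamma>)" for n
  proof -
    have "norm (z n - z 0) \<le> (\<Sum>j<n. ?s * ?\<gamma> ^ j)"
      unfolding tele[symmetric] by (intro sum_norm_le d)
    also have "\<dots> \<le> (\<Sum>j. ?s * ?\<gamma> ^ j)"
      using \<gamma> by (intro sum_le_suminf geo) auto
    also have "\<dots> = ?s / (1 - ?\<gamma>)"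
      using \<gamma> by (subst suminf_mult) (auto simp: suminf_geometric summable_geometric)
    finally show ?thesis .
  qed
  have "(\<lambda>n. norm (z n - z 0)) \<longlonglongrightarrow> norm (l - z 0)"
    by (intro tendsto_norm tendsto_diff l tendsto_const)
  then have "norm (l - z 0) \<le> ?s / (1 - ?\<gamma>)"
    by (rule LIMSEQ_le_const2) (use bd in auto)
  then have "norm (l - z 0) powr p \<le> (?s / (1 - ?\<gamma>)) powr p"
    using p by (intro powr_mono2) auto
  also have "\<dots> = ?s powr p / (1 - ?\<gamma>) powr p"
    by (rule powr_divide)
  also have "?s powr p = \<tau> / W"
    using \<tau> W p by (simp add: powr_powr)
  finally have "W * norm (l - z 0) powr p \<le> 1 / (1 - ?\<gamma>) powr p * \<tau>"
    using W \<gamma> by (auto simp: field_simps)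
  then show "ennreal (W * norm (l - z 0) powr p) \<le> ennreal (1 / (1 - \<beta> powr (1/p)) powr p) * T"
    using \<tau> \<gamma> by (simp add: ennreal_mult[symmetric] ennreal_leI del: times_divide_eq_left)
qed

definition telescoping_const :: "real \<Rightarrow> real \<Rightarrow> real" where
  "telescoping_const p q = 1 / (1 - sqrt q powr (1/p)) powr p / (1 - sqrt q)"

lemma telescoping_const_nonneg: "0 < q \<Longrightarrow> q < 1 \<Longrightarrow> 0 \<le> telescoping_const p q"
  by (simp add: telescoping_const_def)

text \<open>
  Increments of size \<open>q\<^sup>j\<close> in a weighted \<open>L\<^sup>p\<close> energy leave room for the factors \<open>q^(-j/2)\<close>: the
  series with these factors still has finite integral, hence is finite almost everywhere, and
  the pointwise lemma applies from any index \<open>k\<close> on.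
\<close>

lemma
  fixes w :: "nat \<Rightarrow> 'a \<Rightarrow> complex" and W :: "'a \<Rightarrow> real"
  assumes p: "0 < p" and q: "0 < q" "q < 1" and K: "0 \<le> K"
    and w: "\<And>j. w j \<in> borel_measurable M" and W: "W \<in> borel_measurable M" "\<And>x. 0 \<le> W x"
    and bd: "\<And>j. (\<integral>\<^sup>+x. ennreal (W x * norm (w (Suc j) x - w j x) powr p) \<partial>M) \<le> ennreal (K * q ^ j)"
  shows telescoping_AE_convergent: "AE x in M. 0 < W x \<longrightarrow> convergent (\<lambda>j. w j x)"
    and telescoping_bound: "(AE x in M. 0 < W x \<longrightarrow> (\<lambda>j. w j x) \<longlonglongrightarrow> l x) \<Longrightarrow>
      (\<integral>\<^sup>+x. ennreal (W x * norm (l x - w k x) powr p) \<partial>M) \<le> ennreal (telescoping_const p q * K * q ^ k)"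
proof -
  \<comment> \<open>half of the decay pays for the pointwise convergence, the other half for the
    convergence of the integrals\<close>
  define \<beta> where "\<beta> = sqrt q"
  have \<beta>: "0 < \<beta>" "\<beta> < 1" "\<beta> * \<beta> = q" using q by (auto simp: \<beta>_def)
  let ?c = "1 / (1 - \<beta> powr (1/p)) powr p"
  let ?T = "\<lambda>k x. (\<Sum>j. ennreal ((1 / \<beta>) ^ j * (W x * norm (w (k + Suc j) x - w (k + j) x) powr p)))"
  note [measurable] = w W(1)
  have m: "(\<lambda>x. ennreal ((1 / \<beta>) ^ j * (W x * norm (w (k + Suc j) x - w (k + j) x) powr p))) \<in> borel_measurable M" for j k
    by measurable
  have meas_T: "?T k \<in> borel_measurable M" for k using m by measurable
  have int_T: "(\<integral>\<^sup>+x. ?T k x \<partial>M) \<le> ennreal (K * q ^ k / (1 - \<beta>))" for k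
  proof -
    have "(\<integral>\<^sup>+x. ?T k x \<partial>M) = (\<Sum>j. \<integral>\<^sup>+x. ennreal ((1 / \<beta>) ^ j * (W x * norm (w (k + Suc j) x - w (k + j) x) powr p)) \<partial>M)"
      by (intro nn_integral_suminf m)
    also have "\<dots> \<le> (\<Sum>j. ennreal (K * q ^ k * \<beta> ^ j))"
    proof (intro suminf_le)
      fix j
      have "(\<integral>\<^sup>+x. ennreal ((1 / \<beta>) ^ j * (W x * norm (w (k + Suc j) x - w (k + j) x) powr p)) \<partial>M)
        = ennreal ((1 / \<beta>) ^ j) * (\<integral>\<^sup>+x. ennreal (W x * norm (w (k + Suc j) x - w (k + j) x) powr p) \<partial>M)"
        using \<beta> W(2) by (subst nn_integral_cmult[symmetric]) (auto simp: ennreal_mult)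
      also have "\<dots> \<le> ennreal ((1 / \<beta>) ^ j) * ennreal (K * q ^ (k + j))"
        using bd[of "k + j"] by (intro mult_left_mono) auto
      also have "\<dots> = ennreal ((1 / \<beta>) ^ j * (K * q ^ (k + j)))"
        using \<beta> K q by (intro ennreal_mult[symmetric]) auto
      also have "(1 / \<beta>) ^ j * (K * q ^ (k + j)) = K * q ^ k * \<beta> ^ j"
        using \<beta>(1) unfolding \<beta>(3)[symmetric] by (simp add: power_add power_mult_distrib power_divide)
      finally show "(\<integral>\<^sup>+x. ennreal ((1 / \<beta>) ^ j * (W x * norm (w (k + Suc j) x - w (k + j) x) powr p)) \<partial>M) \<le> ennreal (K * q ^ k * \<beta> ^ j)" .
    qed auto
    also have "\<dots> = ennreal (K * q ^ k * (1 / (1 - \<beta>)))"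
      using \<beta> K q by (intro suminf_ennreal_eq sums_mult geometric_sums) auto
    finally show "(\<integral>\<^sup>+x. ?T k x \<partial>M) \<le> ennreal (K * q ^ k / (1 - \<beta>))" by simp
  qed
  have fin_T: "AE x in M. ?T k x < \<infinity>" for k
  proof -
    have "(\<integral>\<^sup>+x. ?T k x \<partial>M) < \<infinity>" using int_T[of k] by (simp add: le_less_trans)
    then have "AE x in M. ?T k x \<noteq> \<infinity>" by (intro nn_integral_PInf_AE meas_T) auto
    then show ?thesis by eventually_elim (simp add: less_top)
  qed
    show "AE x in M. 0 < W x \<longrightarrow> convergent (\<lambda>j. w j x)"
      using fin_T[of 0]
    proof eventually_elim
      case (elim x)
      then show ?case
        using telescoping_limit_bound(1)[OF p \<beta>(1,2), of "W x" "\<lambda>j. w j x"] by auto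
    qed
    assume l: "AE x in M. 0 < W x \<longrightarrow> (\<lambda>j. w j x) \<longlonglongrightarrow> l x"
    have "(\<integral>\<^sup>+x. ennreal (W x * norm (l x - w k x) powr p) \<partial>M) \<le> (\<integral>\<^sup>+x. ennreal ?c * ?T k x \<partial>M)"
    proof (rule nn_integral_mono_AE)
      show "AE x in M. ennreal (W x * norm (l x - w k x) powr p) \<le> ennreal ?c * ?T k x"
        using fin_T[of k] l
      proof eventually_elim
        case (elim x)
        show ?case
        proof (cases "0 < W x")
          case True
          have "(\<lambda>j. w (j + k) x) \<longlonglongrightarrow> l x" using elim(2) True LIMSEQ_ignore_initial_segment by blast
          then have "(\<lambda>j. w (k + j) x) \<longlonglongrightarrow> l x" by (simp add: add.commute)
          from telescoping_limit_bound(2)[OF p \<beta>(1,2) True, of "\<lambda>j. w (k + j) x", OF refl elim(1) this]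
          show ?thesis by simp
        next
          case False
          then have "W x = 0" using W(2)[of x] by linarith
          then show ?thesis by simp
        qed
      qed
    qed
    also have "\<dots> = ennreal ?c * (\<integral>\<^sup>+x. ?T k x \<partial>M)"
      by (intro nn_integral_cmult meas_T)
    also have "\<dots> \<le> ennreal ?c * ennreal (K * q ^ k / (1 - \<beta>))"
      by (intro mult_left_mono int_T) auto
    also have "\<dots> = ennreal (?c / (1 - \<beta>) * K * q ^ k)"
      using \<beta> K q by (subst ennreal_mult[symmetric]) auto
    finally show "(\<integral>\<^sup>+x. ennreal (W x * norm (l x - w k x) powr p) \<partial>M) \<le> ennreal (telescoping_const p q * K * q ^ k)" unfolding telescoping_const_def \<beta>_def .
qed

section \<open>Box integrals determine a function\<close>

lemma integral_bump: "(LINT z|lebesgue. bump (z::real^'n)) = 1"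
  unfolding bump_def using bump_mass_pos[where 'n='n] by simp

lemma integral_mollifier:
  assumes t: "0 < t"
  shows "(LINT x|lebesgue. mollifier t (x - (y::real^'n))) = 1"
proof -
  let ?f = "\<lambda>x. mollifier t (x - y)"
  have cont: "continuous_on UNIV ?f"
    by (intro continuous_on_compose2[OF continuous_on_mollifier[OF t, of UNIV]] continuous_intros) auto
  have fm [measurable]: "?f \<in> borel_measurable borel" by (intro borel_measurable_continuous_onI cont)
  have bc: "continuous_on UNIV (bump :: real^'n \<Rightarrow> real)"
    unfolding bump_def using bump_mass_pos[where 'n='n] by (auto intro!: continuous_intros)
  have bm: "(bump :: real^'n \<Rightarrow> real) \<in> borel_measurable borel" by (intro borel_measurable_continuous_onI bc)
  have "(LINT x|lebesgue. ?f x) = (LINT x|lborel. ?f x)"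
    by (intro integral_completion) simp
  also have "\<dots> = (LINT x|density (distr lborel borel (\<lambda>x. y + t *\<^sub>R x)) (\<lambda>_. \<bar>t\<bar> ^ DIM(real^'n)). ?f x)"
    using t by (subst lborel_affine[of t y]) auto
  also have "\<dots> = (LINT x|distr lborel borel (\<lambda>x. y + t *\<^sub>R x). t ^ CARD('n) *\<^sub>R ?f x)"
    using t by (subst integral_density) auto
  also have "\<dots> = (LINT x|lborel. t ^ CARD('n) *\<^sub>R ?f (y + t *\<^sub>R x))"
    by (subst integral_distr) auto
  also have "\<dots> = (LINT x|lborel. bump (x::real^'n))"
    using t by (intro Bochner_Integration.integral_cong) (auto simp: mollifier_def)
  also have "\<dots> = (LINT x|lebesgue. bump (x::real^'n))"
    using bm by (intro integral_completion[symmetric]) simp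
  finally show ?thesis by (simp add: integral_bump)
qed

text \<open>
  \<open>c\<close> is the mollified indicator of \<open>B\<close>: it differs from the indicator only within distance \<open>t\<close> of
  the boundary.
\<close>

lemma mollified_indicator:
  fixes B :: "(real^'n) set"
  assumes B: "B \<in> sets lebesgue" and t: "0 < t"
  defines "c \<equiv> \<lambda>y. LINT x|lebesgue. indicator B x * mollifier t (x - y)"
  shows "integrable lebesgue (\<lambda>x. mollifier t (x - y))" "0 \<le> c y" "c y \<le> 1"
    "ball y t \<subseteq> B \<Longrightarrow> c y = 1" "ball y t \<inter> B = {} \<Longrightarrow> c y = 0"
proof -
  show int: "integrable lebesgue (\<lambda>x. mollifier t (x - y))"
  proof -
    have "integrable lebesgue (\<lambda>x. mollifier t (x - y) *\<^sub>R (1::real))"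
    proof (rule integrable_lebesgue_compact_support[OF locally_integrable_const])
      show "compact (cball y t)" by simp
      show "continuous_on UNIV (\<lambda>x. mollifier t (x - y))"
        by (intro continuous_on_compose2[OF continuous_on_mollifier[OF t, of UNIV]] continuous_intros) auto
      show "mollifier t (x - y) = 0" if "x \<notin> cball y t" for x
        using that t by (intro mollifier_eq_0) (auto simp: dist_norm norm_minus_commute)
    qed
    then show ?thesis by simp
  qed
  have intB: "integrable lebesgue (\<lambda>x. indicator B x * mollifier t (x - y))"
    using integrable_mult_indicator[OF B int] by simp
  show "0 \<le> c y" unfolding c_def using t by (intro integral_nonneg_AE AE_I2) (simp add: mollifier_nonneg)
  have "c y \<le> (LINT x|lebesgue. mollifier t (x - y))"
    unfolding c_def using t by (intro integral_mono intB int) (auto split: split_indicator simp: mollifier_nonneg)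
  then show "c y \<le> 1" by (simp add: integral_mollifier[OF t])
  show "c y = 1" if "ball y t \<subseteq> B"
  proof -
    have "indicator B x * mollifier t (x - y) = mollifier t (x - y)" for x
    proof (cases "x \<in> ball y t")
      case True
      then show ?thesis using that by auto
    next
      case False
      then have "mollifier t (x - y) = 0" using t by (intro mollifier_eq_0) (auto simp: dist_norm norm_minus_commute)
      then show ?thesis by simp
    qed
    then show ?thesis unfolding c_def by (simp only: integral_mollifier[OF t])
  qed
  show "c y = 0" if "ball y t \<inter> B = {}"
  proof -
    have "indicator B x * mollifier t (x - y) = 0" for x
    proof (cases "x \<in> ball y t")
      case True
      then have "x \<notin> B" using that by blast
      then show ?thesis by simp
    next
      case False
      then have "mollifier t (x - y) = 0" using t by (intro mollifier_eq_0) (auto simp: dist_norm norm_minus_commute)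
      then show ?thesis by simp
    qed
    then show ?thesis unfolding c_def by (simp only: integral_zero)
  qed
qed

lemma dyadic_scale: "(\<lambda>k. 1 / 2 ^ k :: real) \<longlonglongrightarrow> 0"
  using LIMSEQ_realpow_zero[of "1/2 :: real"] by (simp add: power_divide)

lemma integrable_indicator_continuous:
  fixes \<phi> :: "real^'n \<Rightarrow> 'b::{banach,second_countable_topology}"
  assumes "continuous_on UNIV \<phi>" "bounded B" "B \<in> sets lebesgue"
  shows "integrable lebesgue (\<lambda>x. indicator B x *\<^sub>R \<phi> x)"
proof -
  obtain R where R: "B \<subseteq> cball 0 R" using assms(2) by (metis bounded_subset_ballD ball_subset_cball order_trans)
  have "integrable lborel (\<lambda>x. indicator (cball 0 R) x *\<^sub>R \<phi> x)"
    using assms(1) by (intro borel_integrable_compact) (auto intro: continuous_on_subset)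
  then have "integrable lebesgue (\<lambda>x. indicator (cball 0 R) x *\<^sub>R \<phi> x)"
    by (subst integrable_completion) (auto dest: borel_measurable_integrable)
  from integrable_mult_indicator[OF assms(3) this]
  have "integrable lebesgue (\<lambda>x. indicator B x *\<^sub>R indicator (cball 0 R) x *\<^sub>R \<phi> x)" .
  moreover have "indicator B x *\<^sub>R indicator (cball 0 R) x *\<^sub>R \<phi> x = indicator B x *\<^sub>R \<phi> x" for x
    using R by (auto split: split_indicator)
  ultimately show ?thesis by (simp only:)
qed

text \<open>
  Fubini moves the mollification from \<open>h\<close> to the indicator of \<open>B\<close>.
\<close>

lemma set_integral_mollify:
  fixes h :: "real^'n \<Rightarrow> complex"
  assumes h: "locally_integrable h" and B: "bounded B" "B \<in> sets lebesgue" and t: "0 < t"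
  shows "(LINT x|lebesgue. indicator B x *\<^sub>R mollify t h x)
    = (LINT y|lebesgue. (LINT x|lebesgue. indicator B x * mollifier t (x - y)) *\<^sub>R h y)"
proof -
  let ?F = "\<lambda>x y. (indicator B x * mollifier t (x - y)) *\<^sub>R h y"
  have hm: "h \<in> borel_measurable lebesgue" using h by (simp add: locally_integrable_def)
  have Fm: "case_prod ?F \<in> borel_measurable (lebesgue \<Otimes>\<^sub>M lebesgue)"
  proof -
    have 1: "(\<lambda>p::(real^'n) \<times> (real^'n). mollifier t (fst p - snd p)) \<in> borel_measurable (lebesgue \<Otimes>\<^sub>M lebesgue)"
      by (intro measurable_continuous_pair_lebesgue continuous_on_compose2[OF continuous_on_mollifier[OF t, of UNIV]] continuous_intros) auto
    have 2: "(\<lambda>p::(real^'n) \<times> (real^'n). h (snd p)) \<in> borel_measurable (lebesgue \<Otimes>\<^sub>M lebesgue)"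
      using measurable_compose[OF measurable_snd hm] .
    have 3: "(\<lambda>p::(real^'n) \<times> (real^'n). indicator B (fst p) :: real) \<in> borel_measurable (lebesgue \<Otimes>\<^sub>M lebesgue)"
      using measurable_compose[OF measurable_fst borel_measurable_indicator[OF B(2)]] .
    show ?thesis unfolding case_prod_beta' by (intro borel_measurable_scaleR borel_measurable_times 1 2 3)
  qed
  have "integrable (lebesgue \<Otimes>\<^sub>M lebesgue) (case_prod ?F)"
  proof (rule lebesgue_pair.Fubini_integrable[OF Fm])
    have "(LINT y|lebesgue. norm (?F x y)) = indicator B x *\<^sub>R mollify t (\<lambda>y. norm (h y)) x" for x
      using t by (simp add: mollify_def abs_mult mollifier_nonneg mult.assoc)
    then show "integrable lebesgue (\<lambda>x. LINT y|lebesgue. norm (case_prod ?F (x, y)))"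
      using integrable_indicator_continuous[OF continuous_on_mollify[OF locally_integrable_norm[OF h] t] B] by simp
    have "integrable lebesgue (\<lambda>y. indicator B x *\<^sub>R (mollifier t (x - y) *\<^sub>R h y))" for x
      by (intro integrable_scaleR_right integrable_mollifier h t)
    then show "AE x in lebesgue. integrable lebesgue (\<lambda>y. case_prod ?F (x, y))" by simp
  qed
  from lebesgue_pair.Fubini_integral[OF this]
  have "(LINT y|lebesgue. LINT x|lebesgue. ?F x y) = (LINT x|lebesgue. LINT y|lebesgue. ?F x y)" .
  moreover have "(LINT y|lebesgue. ?F x y) = indicator B x *\<^sub>R mollify t h x" for x
    unfolding mollify_def by (subst integral_scaleR_right[symmetric]) simp
  moreover have "(LINT x|lebesgue. ?F x y) = (LINT x|lebesgue. indicator B x * mollifier t (x - y)) *\<^sub>R h y" for y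
  proof (rule integral_scaleR_left)
    show "integrable lebesgue (\<lambda>x. indicator B x * mollifier t (x - y))"
      using integrable_mult_indicator[OF B(2) mollified_indicator(1)[OF B(2) t]] by simp
  qed
  ultimately show ?thesis by simp
qed

text \<open>
  The mollified indicators of a box converge boundedly off its boundary, a null set, and they
  all live on one bounded set, on which \<open>h\<close> itself dominates.
\<close>

lemma box_integral_mollify_tendsto:
  fixes h :: "real^'n \<Rightarrow> complex"
  assumes h: "locally_integrable h"
  shows "(\<lambda>k. LINT x|lebesgue. indicator (box a b) x *\<^sub>R mollify (1 / 2 ^ k) h x)
    \<longlonglongrightarrow> (LINT x|lebesgue. indicator (box a b) x *\<^sub>R h x)"
proof -
  let ?B = "box a b"
  let ?t = "\<lambda>k. 1 / 2 ^ k :: real"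
  let ?c = "\<lambda>t y. LINT x|lebesgue. indicator ?B x * mollifier t (x - y)"
  have hm: "h \<in> borel_measurable lebesgue" using h by (simp add: locally_integrable_def)
  have B: "bounded ?B" "?B \<in> sets lebesgue" by auto
  obtain R where R: "?B \<subseteq> ball 0 R" using B(1) bounded_subset_ballD by blast
  have "(\<lambda>k. LINT y|lebesgue. ?c (?t k) y *\<^sub>R h y) \<longlonglongrightarrow> (LINT y|lebesgue. indicator ?B y *\<^sub>R h y)"
  proof (rule integral_dominated_convergence[where w="\<lambda>y. indicator (cball 0 (R + 1)) y * norm (h y)"])
    show "(\<lambda>y. indicator ?B y *\<^sub>R h y) \<in> borel_measurable lebesgue"
      by (intro borel_measurable_scaleR borel_measurable_indicator B hm)
    show "integrable lebesgue (\<lambda>y. indicator (cball 0 (R + 1)) y * norm (h y))"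
      using locally_integrable_norm[OF h] by (auto simp: locally_integrable_def set_integrable_def)
    fix k :: nat
    show "(\<lambda>y. ?c (?t k) y *\<^sub>R h y) \<in> borel_measurable lebesgue"
    proof (intro borel_measurable_scaleR hm)
      have 1: "(\<lambda>p::(real^'n) \<times> (real^'n). mollifier (?t k) (snd p - fst p)) \<in> borel_measurable (lebesgue \<Otimes>\<^sub>M lebesgue)"
        by (intro measurable_continuous_pair_lebesgue continuous_on_compose2[OF continuous_on_mollifier[of "?t k" UNIV]] continuous_intros) auto
      have 3: "(\<lambda>p::(real^'n) \<times> (real^'n). indicator ?B (snd p) :: real) \<in> borel_measurable (lebesgue \<Otimes>\<^sub>M lebesgue)"
        using measurable_compose[OF measurable_snd borel_measurable_indicator[OF B(2)]] .
      have "(\<lambda>(y, x). indicator ?B x * mollifier (?t k) (x - y)) \<in> borel_measurable ((lebesgue :: (real^'n) measure) \<Otimes>\<^sub>M lebesgue)"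
        unfolding case_prod_beta' by (intro borel_measurable_times 1 3)
      from sigma_finite_measure.borel_measurable_lebesgue_integral[OF sigma_finite_lebesgue this]
      show "?c (?t k) \<in> borel_measurable lebesgue" .
    qed
    show "AE y in lebesgue. norm (?c (?t k) y *\<^sub>R h y) \<le> indicator (cball 0 (R + 1)) y * norm (h y)"
    proof (rule AE_I2)
      fix y
      have c: "0 \<le> ?c (?t k) y" "?c (?t k) y \<le> 1"
        using mollified_indicator(2,3)[OF B(2), of "?t k" y] by auto
      show "norm (?c (?t k) y *\<^sub>R h y) \<le> indicator (cball 0 (R + 1)) y * norm (h y)"
      proof (cases "y \<in> cball 0 (R + 1)")
        case True
        then show ?thesis using c mult_right_mono[of "?c (?t k) y" 1 "norm (h y)"] by simp
      next
        case False
        have "ball y (?t k) \<inter> ?B = {}"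
        proof (rule ccontr)
          assume "\<not> ?thesis"
          then obtain x where "x \<in> ball y (?t k)" "x \<in> ?B" by blast
          then have x: "dist y x < ?t k" "norm x < R" using R by (auto simp: subset_iff)
          have "norm y \<le> norm x + dist y x" using norm_triangle_sub[of y x] by (simp add: dist_norm)
          moreover have "?t k \<le> 1" by (simp add: field_simps)
          moreover have "R + 1 < norm y" using False by simp
          ultimately show False using x by linarith
        qed
        then have "?c (?t k) y = 0" by (intro mollified_indicator(5)[OF B(2)]) auto
        then show ?thesis by simp
      qed
    qed
  next
    have "AE y in lebesgue. y \<notin> cbox a b - ?B"
      using negligible_frontier_interval[of a b] by (intro AE_not_in) (simp add: negligible_iff_null_sets)
    then show "AE y in lebesgue. (\<lambda>k. ?c (?t k) y *\<^sub>R h y) \<longlonglongrightarrow> indicator ?B y *\<^sub>R h y"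
    proof eventually_elim
      case (elim y)
      have "eventually (\<lambda>k. ?c (?t k) y = indicator ?B y) sequentially"
      proof (cases "y \<in> ?B")
        case True
        then obtain e where e: "0 < e" "ball y e \<subseteq> ?B" using open_box open_contains_ball by blast
        have "eventually (\<lambda>k. ?t k < e) sequentially" using order_tendstoD(2)[OF dyadic_scale e(1)] .
        then show ?thesis
        proof eventually_elim
          case (elim k)
          then have "ball y (?t k) \<subseteq> ?B" using e(2) by (meson ball_subset_ball_iff less_imp_le order_trans subset_ball)
          then show ?case using True by (subst mollified_indicator(4)[OF B(2)]) auto
        qed
      next
        case False
        then have "y \<in> - cbox a b" using elim by auto
        then obtain e where e: "0 < e" "ball y e \<subseteq> - cbox a b" using open_contains_ball by (metis open_Compl closed_cbox)
        have "eventually (\<lambda>k. ?t k < e) sequentially" using order_tendstoD(2)[OF dyadic_scale e(1)] .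
        then show ?thesis
        proof eventually_elim
          case (elim k)
          then have "ball y (?t k) \<subseteq> - cbox a b" using e(2) by (meson less_imp_le order_trans subset_ball)
          then have "ball y (?t k) \<inter> ?B = {}" using box_subset_cbox[of a b] by blast
          then show ?case using False by (subst mollified_indicator(5)[OF B(2)]) auto
        qed
      qed
      then have "(\<lambda>k. ?c (?t k) y) \<longlonglongrightarrow> indicator ?B y" by (rule tendsto_eventually)
      then show ?case by (intro tendsto_scaleR tendsto_const)
    qed
  qed
  moreover have "(LINT x|lebesgue. indicator ?B x *\<^sub>R mollify (?t k) h x) = (LINT y|lebesgue. ?c (?t k) y *\<^sub>R h y)" for k
    by (rule set_integral_mollify[OF h B]) simp
  ultimately show ?thesis by simp
qed

text \<open>
  Boxes form an intersection-stable generator of the Borel sets, so vanishing passes from boxes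
  to all Borel subsets of a fixed box. A Borel representative \<open>h'\<close> of \<open>h\<close> makes the level sets of
  the function Borel.
\<close>

lemma AE_zero_if_box_integrals_zero_real:
  fixes h :: "real^'n \<Rightarrow> real"
  assumes h: "locally_integrable h" and zero: "\<And>a b. (LINT x|lebesgue. indicator (box a b) x * h x) = 0"
  shows "AE x in lebesgue. h x = 0"
proof -
  have hm: "h \<in> borel_measurable lebesgue" using h by (simp add: locally_integrable_def)
  obtain h' where h': "h' \<in> borel_measurable lborel" "AE x in lborel. h x = h' x"
    using completion_ex_borel_measurable_real[OF hm] by blast
  let ?Q = "\<lambda>n::nat. box (- (real n *\<^sub>R One)) (real n *\<^sub>R One :: real^'n)"
  have int': "integrable lborel (\<lambda>x. indicator A x * (indicator (?Q n) x * h' x))"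
    and eq': "(LINT x|lborel. indicator A x * (indicator (?Q n) x * h' x)) = (LINT x|lebesgue. indicator A x * (indicator (?Q n) x * h x))"
    if A: "A \<in> sets borel" for A n
  proof -
    have m: "(\<lambda>x. indicator A x * (indicator (?Q n) x * h' x)) \<in> borel_measurable lborel"
      using h'(1) A by measurable
    have ae: "AE x in lebesgue. indicator A x * (indicator (?Q n) x * h x) = indicator A x * (indicator (?Q n) x * h' x)"
      using AE_completion[OF h'(2)] by eventually_elim simp
    have "bounded (?Q n)" by simp
    then obtain R where R: "?Q n \<subseteq> cball 0 R" by (metis bounded_subset_ballD ball_subset_cball order_trans)
    have "integrable lebesgue (\<lambda>x. indicator (cball 0 R) x *\<^sub>R h x)"
      using h by (auto simp: locally_integrable_def set_integrable_def)
    from integrable_mult_indicator[OF _ this, of "A \<inter> ?Q n"]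
    have "integrable lebesgue (\<lambda>x. indicator (A \<inter> ?Q n) x *\<^sub>R indicator (cball 0 R) x *\<^sub>R h x)" using A by auto
    moreover have "indicator (A \<inter> ?Q n) x *\<^sub>R indicator (cball 0 R) x *\<^sub>R h x = indicator A x * (indicator (?Q n) x * h x)" for x
      using R by (auto split: split_indicator)
    ultimately have i: "integrable lebesgue (\<lambda>x. indicator A x * (indicator (?Q n) x * h x))" by (simp only:)
    then have "integrable lebesgue (\<lambda>x. indicator A x * (indicator (?Q n) x * h' x))"
      using ae m by (subst (asm) integrable_cong_AE[OF borel_measurable_integrable[OF i] measurable_completion[OF m]]) auto
    then show "integrable lborel (\<lambda>x. indicator A x * (indicator (?Q n) x * h' x))"
      using integrable_completion[OF m] by simp
    show "(LINT x|lborel. indicator A x * (indicator (?Q n) x * h' x)) = (LINT x|lebesgue. indicator A x * (indicator (?Q n) x * h x))"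
      unfolding integral_completion[OF m, symmetric]
      by (rule integral_cong_AE[symmetric, OF borel_measurable_integrable[OF i] measurable_completion[OF m] ae])
  qed
  have "AE x in lborel. indicator (?Q n) x * h' x = 0" for n
  proof -
    let ?f = "\<lambda>x. indicator (?Q n) x * h' x"
    have intf: "integrable lborel ?f" using int'[of UNIV n] by simp
    have "(LINT x:A|lborel. ?f x) = 0" if "A \<in> sets borel" for A
    proof -
      let ?G = "range (\<lambda>(a, b). box a b :: (real^'n) set)"
      have sb: "sets borel = sigma_sets UNIV ?G" by (simp add: borel_eq_box)
      have "Int_stable ?G" by (auto simp: Int_stable_def box_Int_box)
      moreover have "?G \<subseteq> Pow UNIV" by simp
      moreover have "A \<in> sigma_sets UNIV ?G" using that sb by simp
      ultimately show ?thesis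
      proof (induction A rule: sigma_sets_induct_disjoint)
        case (basic A)
        then obtain a b where A: "A = box a b" by auto
        obtain c d where cd: "A \<inter> ?Q n = box c d" unfolding A box_Int_box by blast
        have ind: "indicator A x * (indicator (?Q n) x * h x) = indicator (box c d) x * h x" for x
          unfolding cd[symmetric] by (simp split: split_indicator)
        have "(LINT x:A|lborel. ?f x) = (LINT x|lborel. indicator A x * (indicator (?Q n) x * h' x))"
          by (simp add: set_lebesgue_integral_def)
        also have "\<dots> = (LINT x|lebesgue. indicator (box c d) x * h x)"
          unfolding ind[symmetric] by (rule eq') (simp add: A)
        finally show ?case using zero by simp
      next
        case empty
        then show ?case by (simp add: set_lebesgue_integral_def)
      next
        case (compl A)
        have A: "A \<in> sets borel" using compl sb by simp
        have "(LINT x:UNIV|lborel. ?f x) = 0"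
          using eq'[of UNIV n] zero by (simp add: set_lebesgue_integral_def)
        moreover have "(LINT x:UNIV|lborel. ?f x) = (LINT x:A|lborel. ?f x) + (LINT x:UNIV - A|lborel. ?f x)"
          using set_integral_Un[of A "UNIV - A" lborel ?f] int'[OF A, of n] int'[of "UNIV - A" n] A
          by (simp add: set_integrable_def borel_comp Compl_eq_Diff_UNIV[symmetric])
        ultimately show ?case using compl by simp
      next
        case (union A)
        have A: "A i \<in> sets borel" for i using union sb by auto
        have "(LINT x:(\<Union>i. A i)|lborel. ?f x) = (\<Sum>i. (LINT x:(A i)|lborel. ?f x))"
        proof (rule lebesgue_integral_countable_add)
          show "A i \<inter> A j = {}" if "i \<noteq> j" for i j using union(1) that by (auto simp: disjoint_family_on_def)
          show "set_integrable lborel (\<Union>i. A i) ?f" using int'[of "\<Union>i. A i" n] A by (simp add: set_integrable_def)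
        qed (use A in auto)
        then show ?case using union by simp
      qed
    qed
    then have "AE x in lborel. ?f x = (\<lambda>_. 0) x"
      by (intro density_unique_real intf) (auto simp: set_lebesgue_integral_def)
    then show ?thesis by simp
  qed
  then have "AE x in lborel. \<forall>n. indicator (?Q n) x * h' x = 0" unfolding AE_all_countable by blast
  then have "AE x in lborel. h x = 0"
    using h'(2)
  proof eventually_elim
    case (elim x)
    obtain n where "x \<in> ?Q n" using UN_box_eq_UNIV by blast
    then show ?case using elim(1)[rule_format, of n] elim(2) by simp
  qed
  then show ?thesis by (rule AE_completion)
qed

lemma AE_zero_if_box_integrals_zero:
  fixes h :: "real^'n \<Rightarrow> complex"
  assumes h: "locally_integrable h" and zero: "\<And>a b. (LINT x|lebesgue. indicator (box a b) x *\<^sub>R h x) = 0"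
  shows "AE x in lebesgue. h x = 0"
proof -
  have int: "integrable lebesgue (\<lambda>x. indicator K x *\<^sub>R h x)" if "compact K" for K
    using h that by (auto simp: locally_integrable_def set_integrable_def)
  note intb = integrable_on_box[OF h]
  have hm: "h \<in> borel_measurable lebesgue" using h by (simp add: locally_integrable_def)
  have "AE x in lebesgue. Re (h x) = 0"
  proof (rule AE_zero_if_box_integrals_zero_real)
    show "locally_integrable (\<lambda>x. Re (h x))"
      unfolding locally_integrable_def set_integrable_def
      using hm integrable_Re[OF int] by (auto intro: borel_measurable_Re)
    show "(LINT x|lebesgue. indicator (box a b) x * Re (h x)) = 0" for a b
      using integral_Re[OF intb[of a b]] zero[of a b] by simp
  qed
  moreover have "AE x in lebesgue. Im (h x) = 0"
  proof (rule AE_zero_if_box_integrals_zero_real)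
    show "locally_integrable (\<lambda>x. Im (h x))"
      unfolding locally_integrable_def set_integrable_def
      using hm integrable_Im[OF int] by (auto intro: borel_measurable_Im)
    show "(LINT x|lebesgue. indicator (box a b) x * Im (h x)) = 0" for a b
      using integral_Im[OF intb[of a b]] zero[of a b] by simp
  qed
  ultimately show ?thesis by eventually_elim (simp add: complex_eq_iff)
qed

section \<open>Uniqueness of weak gradients and convergence of mollifications\<close>

lemma locally_integrable_diff:
  assumes "locally_integrable f" "locally_integrable g"
  shows "locally_integrable (\<lambda>x. f x - g x)"
  using assms unfolding locally_integrable_def set_integrable_def
  by (auto simp: scaleR_diff_right intro: borel_measurable_diff)

lemma locally_integrable_add:
  assumes "locally_integrable f" "locally_integrable g"
  shows "locally_integrable (\<lambda>x. f x + g x)"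
  using assms unfolding locally_integrable_def set_integrable_def
  by (auto simp: scaleR_add_right intro: borel_measurable_add)

text \<open>
  Mollifiers are test functions, so two weak gradients have the same mollifications, hence the
  same box integrals in every component.
\<close>

lemma weak_gradient_unique:
  fixes f :: "real^'n \<Rightarrow> complex"
  assumes g: "has_weak_gradient f g" and g': "has_weak_gradient f g'"
  shows "AE x in lebesgue. g x = g' x"
proof -
  have "AE x in lebesgue. g x $ i - g' x $ i = 0" for i
  proof -
    have li: "locally_integrable (\<lambda>x. g x $ i)" "locally_integrable (\<lambda>x. g' x $ i)"
      using g g' by (simp_all add: locally_integrable_nth has_weak_gradient_def)
    have eq: "mollify t (\<lambda>x. g x $ i) x = mollify t (\<lambda>x. g' x $ i) x" if "0 < t" for t x
    proof -
      note tf = test_function_mollifier[OF that, of x]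
      have "- mollify t (\<lambda>x. g x $ i) x = - mollify t (\<lambda>x. g' x $ i) x"
        unfolding mollify_def
        using g[unfolded has_weak_gradient_def, THEN conjunct2, THEN conjunct2, rule_format, OF tf, of i]
        g'[unfolded has_weak_gradient_def, THEN conjunct2, THEN conjunct2, rule_format, OF tf, of i]
        by (rule trans[OF sym])
      then show ?thesis by (simp only: neg_equal_iff_equal)
    qed
    let ?h = "\<lambda>x. g x $ i - g' x $ i"
    have h: "locally_integrable ?h" by (rule locally_integrable_diff[OF li])
    have "mollify t ?h x = 0" if "0 < t" for t x
      using eq[OF that, of x] integrable_mollifier[OF li(1) that, of x] integrable_mollifier[OF li(2) that, of x]
      unfolding mollify_def by (simp add: scaleR_diff_right)
    then have "(\<lambda>k. 0) \<longlonglongrightarrow> (LINT x|lebesgue. indicator (box a b) x *\<^sub>R ?h x)" for a b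
      using box_integral_mollify_tendsto[OF h, of a b] by simp
    then have "(LINT x|lebesgue. indicator (box a b) x *\<^sub>R ?h x) = 0" for a b
      using LIMSEQ_unique tendsto_const by blast
    then show ?thesis by (intro AE_zero_if_box_integrals_zero[OF h]) auto
  qed
  then have "AE x in lebesgue. \<forall>i\<in>UNIV. g x $ i - g' x $ i = 0"
    by (intro AE_finite_allI) auto
  then show ?thesis by eventually_elim (simp add: vec_eq_iff)
qed

lemma powr_2_eq_power2: "0 \<le> x \<Longrightarrow> x powr 2 = (x::real)\<^sup>2"
  by (cases "x = 0") auto

lemma dyadic_powr: "(1 / 2 ^ k) powr (a::real) = (2 powr (- a)) ^ (k::nat)"
proof -
  have "(1 / 2 ^ k) powr a = ((2::real) powr (- real k)) powr a"
    by (simp add: powr_minus_divide powr_realpow)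
  also have "\<dots> = 2 powr (- a * real k)" by (simp add: powr_powr mult.commute)
  also have "\<dots> = (2 powr (- a)) ^ k"
    using powr_realpow[of "2 powr (- a)" k] by (simp add: powr_powr)
  finally show ?thesis .
qed

lemma integrable_square_imp_locally_integrable:
  fixes u :: "real^'n \<Rightarrow> complex"
  assumes u: "u \<in> borel_measurable lebesgue" and sq: "L2_energy u < \<infinity>"
  shows "locally_integrable u"
  unfolding locally_integrable_def
proof (intro conjI allI impI u)
  fix K :: "(real^'n) set" assume K: "compact K"
  have int: "integrable lebesgue (\<lambda>x. (norm (u x))\<^sup>2)"
    using sq u by (intro integrableI_bounded) auto
  have "integrable lebesgue (\<lambda>x. indicator K x *\<^sub>R (1::real))"
    using locally_integrable_const K by (auto simp: locally_integrable_def set_integrable_def)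
  then have "integrable lebesgue (\<lambda>x. indicator K x *\<^sub>R (1::real) + (norm (u x))\<^sup>2)"
    using int by (intro Bochner_Integration.integrable_add)
  then show "set_integrable lebesgue K u"
    unfolding set_integrable_def
  proof (rule Bochner_Integration.integrable_bound)
    have "K \<in> sets lebesgue" using K lmeasurable_compact by blast
    then show "(\<lambda>x. indicator K x *\<^sub>R u x) \<in> borel_measurable lebesgue"
      using u by (intro borel_measurable_scaleR borel_measurable_indicator) auto
    have "norm (u x) \<le> 1 + (norm (u x))\<^sup>2" for x
    proof -
      have "0 \<le> (norm (u x) - 1)\<^sup>2" by simp
      also have "\<dots> = 1 + (norm (u x))\<^sup>2 - 2 * norm (u x)" by (simp add: power2_eq_square algebra_simps)
      finally show ?thesis using norm_ge_zero[of "u x"] by linarith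
    qed
    then show "AE x in lebesgue. norm (indicator K x *\<^sub>R u x) \<le> norm (indicator K x *\<^sub>R (1::real) + (norm (u x))\<^sup>2)"
      by (intro AE_I2) (auto split: split_indicator)
  qed
qed

text \<open>
  On a set of finite measure \<open>L\<^sup>2\<close> convergence implies convergence of the integrals, by splitting
  at the level \<open>2^(-k)\<close>.
\<close>

lemma set_integral_tendsto_0_if_L2_small:
  fixes u :: "nat \<Rightarrow> real^'n \<Rightarrow> complex"
  assumes u: "\<And>k. u k \<in> borel_measurable lebesgue"
    and sq: "\<And>k. L2_energy (u k) \<le> ennreal (K * (1/4) ^ k)" and K: "0 \<le> K"
    and B: "B \<in> sets lebesgue" "emeasure lebesgue B < \<infinity>"
  shows "(\<lambda>k. LINT x|lebesgue. indicator B x *\<^sub>R u k x) \<longlonglongrightarrow> 0"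
proof (rule Lim_null_comparison)
  let ?m = "measure lebesgue B"
  show "eventually (\<lambda>k. norm (LINT x|lebesgue. indicator B x *\<^sub>R u k x) \<le> (?m + K) * (1/2)^k) sequentially"
  proof (rule always_eventually, rule allI)
    fix k :: nat
    have "ennreal (norm (LINT x|lebesgue. indicator B x *\<^sub>R u k x)) \<le> (\<integral>\<^sup>+x. ennreal (norm (indicator B x *\<^sub>R u k x)) \<partial>lebesgue)"
    proof (cases "integrable lebesgue (\<lambda>x. indicator B x *\<^sub>R u k x)")
      case True then show ?thesis by (rule integral_norm_bound_ennreal)
    next
      case False then show ?thesis by (simp add: not_integrable_integral_eq)
    qed
    also have "\<dots> \<le> (\<integral>\<^sup>+x. ennreal ((1/2)^k) * indicator B x + ennreal (2^k) * ennreal ((norm (u k x))\<^sup>2) \<partial>lebesgue)"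
    proof (rule nn_integral_mono)
      fix x
      have "norm (u k x) \<le> (1/2)^k + 2^k * (norm (u k x))\<^sup>2"
      proof (cases "norm (u k x) \<le> (1/2)^k")
        case True then show ?thesis by (simp add: add_increasing2)
      next
        case False
        then have "1 \<le> 2^k * norm (u k x)" by (simp add: power_divide field_simps)
        from mult_right_mono[OF this norm_ge_zero[of "u k x"]]
        have "norm (u k x) \<le> 2^k * (norm (u k x))\<^sup>2" by (simp add: power2_eq_square mult.assoc)
        then show ?thesis by (simp add: add_increasing)
      qed
      then show "ennreal (norm (indicator B x *\<^sub>R u k x)) \<le> ennreal ((1/2)^k) * indicator B x + ennreal (2^k) * ennreal ((norm (u k x))\<^sup>2)"
        by (cases "x \<in> B") (auto simp: ennreal_mult[symmetric] ennreal_plus[symmetric] simp del: ennreal_plus intro!: ennreal_leI)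
    qed
    also have "\<dots> = ennreal ((1/2)^k) * emeasure lebesgue B + ennreal (2^k) * L2_energy (u k)"
    proof -
      note [measurable] = B(1) u[of k]
      have "(\<integral>\<^sup>+x. ennreal ((1/2)^k) * indicator B x + ennreal (2^k) * ennreal ((norm (u k x))\<^sup>2) \<partial>lebesgue)
        = (\<integral>\<^sup>+x. ennreal ((1/2)^k) * indicator B x \<partial>lebesgue) + (\<integral>\<^sup>+x. ennreal (2^k) * ennreal ((norm (u k x))\<^sup>2) \<partial>lebesgue)"
        by (rule nn_integral_add) measurable
      also have "(\<integral>\<^sup>+x. ennreal ((1/2)^k) * indicator B x \<partial>lebesgue) = ennreal ((1/2)^k) * emeasure lebesgue B"
        by (rule nn_integral_cmult_indicator[OF B(1)])
      also have "(\<integral>\<^sup>+x. ennreal (2^k) * ennreal ((norm (u k x))\<^sup>2) \<partial>lebesgue) = ennreal (2^k) * L2_energy (u k)"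
        by (rule nn_integral_cmult) measurable
      finally show ?thesis .
    qed
    also have "\<dots> \<le> ennreal ((1/2)^k) * ennreal ?m + ennreal (2^k) * ennreal (K * (1/4)^k)"
      using B by (intro add_mono mult_left_mono sq) (auto simp: emeasure_eq_ennreal_measure less_top)
    also have "\<dots> = ennreal ((1/2)^k * ?m + 2^k * (K * (1/4)^k))"
      using K by (simp add: ennreal_mult[symmetric] ennreal_plus[symmetric] del: ennreal_plus)
    also have "(1/2)^k * ?m + 2^k * (K * (1/4)^k) = (?m + K) * (1/2)^k"
    proof -
      have "2^k * (1/4::real)^k = (1/2)^k" by (simp add: power_mult_distrib[symmetric])
      then show ?thesis by (simp add: algebra_simps)
    qed
    finally show "norm (LINT x|lebesgue. indicator B x *\<^sub>R u k x) \<le> (?m + K) * (1/2)^k"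
      using K by (subst (asm) ennreal_le_iff) auto
  qed
  show "(\<lambda>k. (?m + K) * (1/2)^k) \<longlonglongrightarrow> 0"
    using tendsto_mult_right_zero[OF LIMSEQ_realpow_zero[of "1/2::real"]] by simp
qed

text \<open>
  The dyadic steps are summable in \<open>L\<^sup>2\<close>, so the mollifications converge almost everywhere to
  some \<open>l\<close>, and their distance to \<open>l\<close> in \<open>L\<^sup>2\<close> tends to 0. Box integrals identify \<open>l\<close> with \<open>f\<close>.
\<close>

lemma mollify_AE_tendsto:
  fixes f :: "real^'n \<Rightarrow> complex"
  assumes w: "has_weak_gradient f g" and G: "L2_energy g < \<infinity>"
  shows "AE x in lebesgue. (\<lambda>k. mollify (1 / 2^k) f x) \<longlonglongrightarrow> f x"
proof -
  obtain r where r: "0 \<le> r" "L2_energy g = ennreal r"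
    using G by (cases "L2_energy g") auto
  have f: "locally_integrable f" using w by (simp add: has_weak_gradient_def)
  let ?f = "\<lambda>k. mollify (1 / 2^k) f"
  have fm: "?f k \<in> borel_measurable lebesgue" for k by (intro measurable_mollify f) simp
  let ?C = "difference_const TYPE('n)"
  have step: "(\<integral>\<^sup>+x. ennreal (1 * norm (?f (Suc k) x - ?f k x) powr 2) \<partial>lebesgue) \<le> ennreal ((?C\<^sup>2 * r) * (1/4)^k)" for k
  proof -
    have "(\<integral>\<^sup>+x. ennreal ((norm (?f k x - mollify (1/2^k/2) f x))\<^sup>2) \<partial>lebesgue) \<le> ennreal (?C\<^sup>2 * (1/2^k)\<^sup>2 * (sqrt r)\<^sup>2)"
      by (rule dyadic_difference_L2[OF w]) (use r in auto)
    also have "?C\<^sup>2 * (1/2^k)\<^sup>2 * (sqrt r)\<^sup>2 = (?C\<^sup>2 * r) * (1/4)^k"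
    proof -
      have "(1/2^k)\<^sup>2 = ((1/2::real)^k)\<^sup>2" by (simp add: power_divide)
      also have "\<dots> = ((1/2)\<^sup>2)^k" by (simp only: power_mult[symmetric] mult.commute)
      also have "\<dots> = (1/4)^k" by (simp add: power2_eq_square)
      finally show ?thesis using r by simp
    qed
    finally show ?thesis by (simp add: powr_2_eq_power2 norm_minus_commute mult.commute)
  qed
  let ?D = "telescoping_const 2 (1/4)"
  have D0: "0 \<le> ?D" by (rule telescoping_const_nonneg) auto
  have K0: "0 \<le> ?C\<^sup>2 * r" using r by simp
  note hyps = K0 fm borel_measurable_const[of 1] zero_le_one step
  have conv: "AE x in lebesgue. convergent (\<lambda>k. ?f k x)"
    using telescoping_AE_convergent[OF _ _ _ hyps] by simp
  let ?l = "\<lambda>x. lim (\<lambda>k. ?f k x)"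
  have lim: "AE x in lebesgue. (\<lambda>k. ?f k x) \<longlonglongrightarrow> ?l x"
    using conv by eventually_elim (simp add: convergent_LIMSEQ_iff)
  have lm: "?l \<in> borel_measurable lebesgue" by (rule borel_measurable_lim_metric[OF fm])
  have lk: "(\<integral>\<^sup>+x. ennreal ((norm (?l x - ?f k x))\<^sup>2) \<partial>lebesgue) \<le> ennreal (?D * (?C\<^sup>2 * r) * (1/4)^k)" for k
    using telescoping_bound[OF _ _ _ hyps, of ?l k] lim by (simp add: powr_2_eq_power2)
  let ?h = "\<lambda>x. f x - ?l x"
  have "locally_integrable (\<lambda>x. ?l x - ?f 0 x)"
    by (rule integrable_square_imp_locally_integrable)
      (use lm fm[of 0] le_less_trans[OF lk[of 0]] in auto)
  note l_f0 = this
  have f0: "locally_integrable (?f k)" for k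
    unfolding locally_integrable_def set_integrable_def
  proof (intro conjI allI impI fm)
    fix K :: "(real^'n) set" assume "compact K"
    then show "integrable lebesgue (\<lambda>x. indicator K x *\<^sub>R ?f k x)"
      by (intro integrable_indicator_continuous continuous_on_mollify f compact_imp_bounded fmeasurableD lmeasurable_compact) auto
  qed
  have l_li: "locally_integrable ?l"
    using locally_integrable_add[OF l_f0 f0[of 0]] by simp
  have h: "locally_integrable ?h" by (rule locally_integrable_diff[OF f l_li])
  have "AE x in lebesgue. ?h x = 0"
  proof (rule AE_zero_if_box_integrals_zero[OF h])
    fix a b :: "real^'n"
    let ?I = "\<lambda>u :: real^'n \<Rightarrow> complex. LINT x|lebesgue. indicator (box a b) x *\<^sub>R u x"
    have "(\<lambda>k. ?I (\<lambda>x. ?l x - ?f k x)) \<longlonglongrightarrow> 0"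
    proof (rule set_integral_tendsto_0_if_L2_small[OF _ lk])
      show "(\<lambda>x. ?l x - ?f k x) \<in> borel_measurable lebesgue" for k using lm fm[of k] by simp
      show "0 \<le> ?D * (?C\<^sup>2 * r)" using D0 K0 by simp
      show "emeasure lebesgue (box a b) < \<infinity>" using emeasure_lborel_box_finite by simp
    qed simp
    moreover have "?I (\<lambda>x. ?l x - ?f k x) = ?I ?l - ?I (?f k)" for k
      using integrable_on_box[OF l_li, of a b] integrable_on_box[OF f0[of k], of a b] by (simp add: scaleR_diff_right)
    moreover have "(\<lambda>k. ?I (?f k)) \<longlonglongrightarrow> ?I f" by (rule box_integral_mollify_tendsto[OF f])
    ultimately have "(\<lambda>k. (?I ?l - ?I (?f k)) + ?I (?f k)) \<longlonglongrightarrow> 0 + ?I f"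
      by (intro tendsto_add) simp_all
    then have "(\<lambda>k::nat. ?I ?l) \<longlonglongrightarrow> ?I f" by simp
    then have "?I ?l = ?I f" by (simp add: LIMSEQ_const_iff)
    then show "?I ?h = 0" using integrable_on_box[OF f, of a b] integrable_on_box[OF l_li, of a b] by (simp add: scaleR_diff_right)
  qed
  then show ?thesis using lim by eventually_elim simp
qed

section \<open>Approximation in the weighted norm\<close>

text \<open>
  The \<open>p\<close>-th power of the weighted norm, as an extended nonnegative number, so that finiteness is
  part of every bound.
\<close>

abbreviation weighted_energy :: "real \<Rightarrow> real \<Rightarrow> (real^'n \<Rightarrow> complex) \<Rightarrow> ennreal" where
  "weighted_energy b p f \<equiv> (\<integral>\<^sup>+x. ennreal (norm x powr (- b) * norm (f x) powr p) \<partial>lebesgue)"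

text \<open>
  In dimension at least 3 the last condition says that \<open>p\<close> lies below the exponent
  \<open>2 (N - b) / (N - 2)\<close> at which the weighted norm scales like the \<open>L\<^sup>2\<close> norm of the gradient; its
  right side is the power of the scale by which a dyadic step decays.
\<close>

definition subcritical :: "'n::finite itself \<Rightarrow> real \<Rightarrow> real \<Rightarrow> bool" where
  "subcritical _ b p \<longleftrightarrow> 0 \<le> b \<and> b < real CARD('n) \<and> 2 \<le> p \<and> 0 < real CARD('n) - b - p * (real CARD('n) / 2 - 1)"

lemma dyadic_step_weighted:
  assumes "subcritical TYPE('n::finite) b p"
  shows "\<exists>C q. 0 \<le> C \<and> 0 < q \<and> q < 1 \<and> (\<forall>(f :: real^'n \<Rightarrow> complex) g G k. has_weak_gradient f g \<longrightarrow>
      L2_energy g \<le> ennreal (G\<^sup>2) \<longrightarrow> 0 \<le> G \<longrightarrow>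
      weighted_energy b p (\<lambda>x. mollify (1/2^Suc k) f x - mollify (1/2^k) f x) \<le> ennreal (C * G powr p * q ^ k))"
proof -
  let ?\<alpha> = "real CARD('n) - b - p * (real CARD('n) / 2 - 1)"
  let ?q = "2 powr (- ?\<alpha>)"
  have h: "0 \<le> b" "b < real CARD('n)" "2 \<le> p" "0 < ?\<alpha>" using assms by (auto simp: subcritical_def)
  obtain C where C: "0 \<le> C" and step: "\<forall>(f :: real^'n \<Rightarrow> complex) g G t. has_weak_gradient f g \<longrightarrow>
      L2_energy g \<le> ennreal (G\<^sup>2) \<longrightarrow> 0 \<le> G \<longrightarrow> 0 < t \<longrightarrow>
      (\<integral>\<^sup>+x. ennreal (norm x powr (- b) * norm (mollify t f x - mollify (t/2) f x) powr p) \<partial>lebesgue)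
        \<le> ennreal (C * t powr ?\<alpha> * G powr p)"
    using dyadic_difference_weighted[OF h(1-3)] by (elim exE conjE) (rule that)
  show ?thesis
  proof (rule exI[of _ C], rule exI[of _ ?q], intro conjI allI impI C)
    show "0 < ?q" by simp
    show "?q < 1" using h(4) by (intro powr_less_one) auto
    fix f :: "real^'n \<Rightarrow> complex" and g G and k :: nat
    assume A: "has_weak_gradient f g" "L2_energy g \<le> ennreal (G\<^sup>2)" "0 \<le> G"
    have "weighted_energy b p (\<lambda>x. mollify (1/2^k) f x - mollify (1/2^k/2) f x) \<le> ennreal (C * (1/2^k) powr ?\<alpha> * G powr p)"
      by (rule step[rule_format, OF A]) simp
    also have "C * (1/2^k) powr ?\<alpha> * G powr p = C * G powr p * ?q ^ k"
      unfolding dyadic_powr by (simp only: mult_ac)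
    finally have "weighted_energy b p (\<lambda>x. mollify (1/2^k) f x - mollify (1/2^k/2) f x) \<le> ennreal (C * G powr p * ?q ^ k)" .
    moreover have "weighted_energy b p (\<lambda>x. mollify (1/2^Suc k) f x - mollify (1/2^k) f x)
        = weighted_energy b p (\<lambda>x. mollify (1/2^k) f x - mollify (1/2^k/2) f x)"
      by (intro nn_integral_cong) (simp add: norm_minus_commute mult.commute)
    ultimately show "weighted_energy b p (\<lambda>x. mollify (1/2^Suc k) f x - mollify (1/2^k) f x) \<le> ennreal (C * G powr p * ?q ^ k)"
      by (simp only:)
  qed
qed

text \<open>
  The unweighted convergence almost everywhere identifies the limit of the telescoping sum in
  the weighted energy.
\<close>

lemma mollify_approximation:
  assumes sc: "subcritical TYPE('n::finite) b p"
  shows "\<exists>C q. 0 \<le> C \<and> 0 < q \<and> q < 1 \<and> (\<forall>(f :: real^'n \<Rightarrow> complex) g G k. has_weak_gradient f g \<longrightarrow>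
      L2_energy g \<le> ennreal (G\<^sup>2) \<longrightarrow> 0 \<le> G \<longrightarrow>
      weighted_energy b p (\<lambda>x. f x - mollify (1/2^k) f x) \<le> ennreal (C * G powr p * q ^ k))"
proof -
  obtain C q where C: "0 \<le> C" and q: "0 < q" "q < 1" and step: "\<forall>(f :: real^'n \<Rightarrow> complex) g G k. has_weak_gradient f g \<longrightarrow>
      L2_energy g \<le> ennreal (G\<^sup>2) \<longrightarrow> 0 \<le> G \<longrightarrow>
      weighted_energy b p (\<lambda>x. mollify (1/2^Suc k) f x - mollify (1/2^k) f x) \<le> ennreal (C * G powr p * q ^ k)"
    using dyadic_step_weighted[OF sc] by (elim exE conjE) (rule that)
  have p: "0 < p" using sc by (simp add: subcritical_def)
  let ?T = "telescoping_const p q"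
  show ?thesis
  proof (rule exI[of _ "?T * C"], rule exI[of _ q], intro conjI allI impI q)
    show "0 \<le> ?T * C" using telescoping_const_nonneg[OF q] C by simp
    fix f :: "real^'n \<Rightarrow> complex" and g G and k :: nat
    assume w: "has_weak_gradient f g" and gG: "L2_energy g \<le> ennreal (G\<^sup>2)" and G: "0 \<le> G"
    have f: "locally_integrable f" using w by (simp add: has_weak_gradient_def)
    have "weighted_energy b p (\<lambda>x. f x - mollify (1/2^k) f x) \<le> ennreal (?T * (C * G powr p) * q ^ k)"
    proof (rule telescoping_bound[OF p q])
      show "0 \<le> C * G powr p" using C by simp
      show "mollify (1/2^j) f \<in> borel_measurable lebesgue" for j :: nat by (intro measurable_mollify f) simp
      show "(\<lambda>x::real^'n. norm x powr (- b)) \<in> borel_measurable lebesgue" by (rule measurable_power_weight)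
      show "weighted_energy b p (\<lambda>x. mollify (1/2^Suc j) f x - mollify (1/2^j) f x) \<le> ennreal (C * G powr p * q ^ j)" for j
        using step[rule_format, OF w gG G] .
      show "AE x in lebesgue. 0 < norm x powr (- b) \<longrightarrow> (\<lambda>j. mollify (1/2^j) f x) \<longlonglongrightarrow> f x"
        using mollify_AE_tendsto[OF w] le_less_trans[OF gG] by (auto elim: AE_mp)
    qed simp
    then show "weighted_energy b p (\<lambda>x. f x - mollify (1/2^k) f x) \<le> ennreal (?T * C * G powr p * q ^ k)"
      by (simp only: mult.assoc)
  qed
qed

lemma measurable_weighted_energy:
  fixes u :: "real^'n \<Rightarrow> complex"
  assumes "u \<in> borel_measurable lebesgue"
  shows "(\<lambda>x. ennreal (norm x powr (- b) * norm (u x) powr p)) \<in> borel_measurable lebesgue"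
  using assms measurable_power_weight[of "- b"] by measurable

lemma powr_add_le:
  fixes x y :: real
  assumes "0 \<le> x" "0 \<le> y" "0 \<le> p"
  shows "(x + y) powr p \<le> 2 powr p * (x powr p + y powr p)"
proof -
  have "(x + y) powr p \<le> (2 * max x y) powr p" using assms by (intro powr_mono2) auto
  also have "\<dots> = 2 powr p * max x y powr p" using assms by (intro powr_mult)
  also have "max x y powr p \<le> x powr p + y powr p" by (auto simp: max_def)
  finally show ?thesis by simp
qed

text \<open>
  A quasi-triangle inequality; the factor \<open>2\<^sup>p\<close> is harmless throughout.
\<close>

lemma weighted_energy_add:
  fixes u v :: "real^'n \<Rightarrow> complex"
  assumes u: "u \<in> borel_measurable lebesgue" and v: "v \<in> borel_measurable lebesgue" and p: "0 \<le> p"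
  shows "weighted_energy b p (\<lambda>x. u x + v x) \<le> ennreal (2 powr p) * (weighted_energy b p u + weighted_energy b p v)"
proof -
  have "weighted_energy b p (\<lambda>x. u x + v x) \<le>
    (\<integral>\<^sup>+x. ennreal (2 powr p) * (ennreal (norm x powr (- b) * norm (u x) powr p) + ennreal (norm x powr (- b) * norm (v x) powr p)) \<partial>lebesgue)"
  proof (rule nn_integral_mono)
    fix x
    have "norm (u x + v x) powr p \<le> (norm (u x) + norm (v x)) powr p"
      using p by (intro powr_mono2 norm_triangle_ineq) auto
    also have "\<dots> \<le> 2 powr p * (norm (u x) powr p + norm (v x) powr p)"
      using p by (intro powr_add_le) auto
    finally have "norm x powr (- b) * norm (u x + v x) powr p \<le> norm x powr (- b) * (2 powr p * (norm (u x) powr p + norm (v x) powr p))"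
      by (intro mult_left_mono) auto
    also have "\<dots> = 2 powr p * (norm x powr (- b) * norm (u x) powr p + norm x powr (- b) * norm (v x) powr p)"
      by (simp add: algebra_simps)
    finally show "ennreal (norm x powr (- b) * norm (u x + v x) powr p) \<le> ennreal (2 powr p) * (ennreal (norm x powr (- b) * norm (u x) powr p) + ennreal (norm x powr (- b) * norm (v x) powr p))"
      by (simp add: ennreal_mult[symmetric] ennreal_plus[symmetric] ennreal_leI del: ennreal_plus)
  qed
  also have "\<dots> = ennreal (2 powr p) * (weighted_energy b p u + weighted_energy b p v)"
    using measurable_weighted_energy[OF u, of b p] measurable_weighted_energy[OF v, of b p]
    by (subst nn_integral_cmult) (auto simp: nn_integral_add)
  finally show ?thesis .
qed

section \<open>Weighted convergence of uniformly bounded functions\<close>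

text \<open>
  From \<open>|f| \<le> 1 + |f|\<^sup>s\<close>; a crude bound suffices because only uniformity in \<open>f\<close> matters.
\<close>

lemma ball_integral_le:
  fixes f :: "real^'n \<Rightarrow> complex"
  assumes f: "locally_integrable f" and s: "1 \<le> s" and A: "Lp_energy s f \<le> ennreal A" "0 \<le> A"
    and t: "0 \<le> t"
  shows "(LINT y|lebesgue. indicator (cball x t) y * norm (f y)) \<le> t ^ CARD('n) * unit_ball_content TYPE('n) + A"
proof -
  let ?v = "t ^ CARD('n) * unit_ball_content TYPE('n)"
  have int: "integrable lebesgue (\<lambda>y. indicator (cball x t) y * norm (f y))"
    by (rule integrable_norm_on_cball[OF f])
  have fm [measurable]: "f \<in> borel_measurable lebesgue" using f by (simp add: locally_integrable_def)
  have "ennreal (LINT y|lebesgue. indicator (cball x t) y * norm (f y)) = (\<integral>\<^sup>+y. ennreal (indicator (cball x t) y * norm (f y)) \<partial>lebesgue)"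
    using nn_integral_eq_integral[OF int] by simp
  also have "\<dots> \<le> (\<integral>\<^sup>+y. indicator (cball x t) y + ennreal (norm (f y) powr s) \<partial>lebesgue)"
  proof (rule nn_integral_mono)
    fix y
    have "norm (f y) \<le> 1 + norm (f y) powr s"
    proof (cases "norm (f y) \<le> 1")
      case True then show ?thesis by (simp add: add_increasing2)
    next
      case False
      then have "norm (f y) powr 1 \<le> norm (f y) powr s" using s by (intro powr_mono) auto
      then show ?thesis by simp
    qed
    then have "ennreal (norm (f y)) \<le> 1 + ennreal (norm (f y) powr s)"
      by (simp add: ennreal_plus[symmetric] ennreal_1[symmetric] ennreal_leI del: ennreal_plus ennreal_1)
    then show "ennreal (indicator (cball x t) y * norm (f y)) \<le> indicator (cball x t) y + ennreal (norm (f y) powr s)"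
      by (simp split: split_indicator)
  qed
  also have "\<dots> = (\<integral>\<^sup>+y. indicator (cball x t) y \<partial>lebesgue) + Lp_energy s f"
    by (rule nn_integral_add) (auto intro!: borel_measurable_indicator)
  also have "(\<integral>\<^sup>+y. indicator (cball x t) y \<partial>lebesgue) = ennreal ?v"
    using emeasure_lebesgue_cball[OF t, of x] by (subst nn_integral_indicator) auto
  also have "ennreal ?v + Lp_energy s f \<le> ennreal ?v + ennreal A"
    using A by (intro add_left_mono)
  also have "\<dots> = ennreal (?v + A)" using A t by (intro ennreal_plus[symmetric]) auto
  finally show ?thesis using A t by (subst (asm) ennreal_le_iff) auto
qed

lemma mollify_sup_le:
  fixes f :: "real^'n \<Rightarrow> complex"
  assumes f: "locally_integrable f" and t: "0 < t"
  shows "norm (mollify t f x) \<le> 1 / (bump_mass TYPE('n) * t ^ CARD('n)) * (LINT y|lebesgue. indicator (cball x t) y * norm (f y))"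
proof -
  let ?c = "1 / (bump_mass TYPE('n) * t ^ CARD('n))"
  have int: "integrable lebesgue (\<lambda>y. ?c * (indicator (cball x t) y * norm (f y)))"
    using locally_integrable_norm[OF f] by (auto simp: locally_integrable_def set_integrable_def)
  have "norm (mollify t f x) \<le> (LINT y|lebesgue. ?c * (indicator (cball x t) y * norm (f y)))"
    unfolding mollify_def
  proof (rule order_trans[OF integral_norm_bound integral_mono[OF integrable_norm int]])
    show "integrable lebesgue (\<lambda>y. mollifier t (x - y) *\<^sub>R f y)" by (rule integrable_mollifier[OF f t])
    fix y
    show "norm (mollifier t (x - y) *\<^sub>R f y) \<le> ?c * (indicator (cball x t) y * norm (f y))"
    proof (cases "y \<in> cball x t")
      case True
      have "\<bar>mollifier t (x - y)\<bar> \<le> ?c" using mollifier_le[OF t, of "x - y"] mollifier_nonneg[of t "x - y"] t by simp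
      then show ?thesis using True mult_right_mono[of "\<bar>mollifier t (x - y)\<bar>" ?c "norm (f y)"] by simp
    next
      case False
      then show ?thesis using mollifier_eq_0[OF t, of "x - y"] by (simp add: dist_norm)
    qed
  qed
  then show ?thesis by simp
qed

lemma nn_integral_le_of_pointwise_limit:
  fixes F :: "nat \<Rightarrow> 'a \<Rightarrow> real"
  assumes m: "\<And>n. (\<lambda>x. ennreal (F n x)) \<in> borel_measurable M" and le: "\<And>n. (\<integral>\<^sup>+x. ennreal (F n x) \<partial>M) \<le> c"
    and lim: "\<And>x. (\<lambda>n. F n x) \<longlonglongrightarrow> G x"
  shows "(\<integral>\<^sup>+x. ennreal (G x) \<partial>M) \<le> c"
proof -
  have "(\<integral>\<^sup>+x. ennreal (G x) \<partial>M) = (\<integral>\<^sup>+x. liminf (\<lambda>n. ennreal (F n x)) \<partial>M)"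
    using lim_imp_Liminf[OF _ tendsto_ennrealI[OF lim]] by simp
  also have "\<dots> \<le> liminf (\<lambda>n. \<integral>\<^sup>+x. ennreal (F n x) \<partial>M)"
    by (rule nn_integral_liminf[OF m])
  also have "\<dots> \<le> liminf (\<lambda>n::nat. c)"
    by (intro Liminf_mono always_eventually allI le)
  also have "\<dots> = c" by (simp add: Liminf_const)
  finally show ?thesis .
qed

text \<open>
  Compare \<open>u\<close> with the threshold \<open>|x|^(-N/s)\<close>: below it \<open>u\<^sup>q\<close> is controlled by a power of \<open>|x|\<close>, above
  it by \<open>u\<^sup>s\<close>.
\<close>

lemma far_pointwise:
  fixes x :: "real^'n"
  assumes q: "0 < q" "q \<le> s" and x: "x \<noteq> 0" and u: "0 \<le> u"
  shows "norm x powr (- b) * u powr q \<le>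
    norm x powr (- (b + real CARD('n) * q / s)) + norm x powr (real CARD('n) - b - real CARD('n) * q / s) * u powr s"
proof -
  let ?N = "real CARD('n)" and ?r = "norm x"
  let ?\<tau> = "?r powr (- ?N / s)"
  have r: "0 < ?r" and s: "0 < s" using x q by auto
  have tau: "?\<tau> powr q = ?r powr (- ?N * q / s)" by (simp add: powr_powr)
  show ?thesis
  proof (cases "u \<le> ?\<tau>")
    case True
    then have "u powr q \<le> ?\<tau> powr q" using q u by (intro powr_mono2) auto
    then have "?r powr (- b) * u powr q \<le> ?r powr (- b) * ?r powr (- ?N * q / s)"
      unfolding tau by (intro mult_left_mono) auto
    also have "\<dots> = ?r powr (- (b + ?N * q / s))" by (simp add: powr_add[symmetric])
    also have "\<dots> \<le> ?r powr (- (b + ?N * q / s)) + ?r powr (?N - b - ?N * q / s) * u powr s" by simp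
    finally show ?thesis .
  next
    case False
    have tp: "0 < ?\<tau>" using r by simp
    then have up: "0 < u" using False by linarith
    have "u powr q = u powr s * u powr (q - s)" by (simp add: powr_add[symmetric])
    also have "\<dots> \<le> u powr s * ?\<tau> powr (q - s)"
      using False tp q by (intro mult_left_mono powr_mono2') auto
    also have "?\<tau> powr (q - s) = ?r powr (?N - ?N * q / s)"
    proof -
      have "(- ?N / s) * (q - s) = ?N - ?N * q / s" using s by (simp add: field_simps)
      then show ?thesis by (simp only: powr_powr)
    qed
    finally have "?r powr (- b) * u powr q \<le> ?r powr (- b) * (u powr s * ?r powr (?N - ?N * q / s))"
      by (intro mult_left_mono) auto
    also have "\<dots> = (?r powr (- b) * ?r powr (?N - ?N * q / s)) * u powr s" by (simp only: mult_ac)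
    also have "?r powr (- b) * ?r powr (?N - ?N * q / s) = ?r powr (?N - b - ?N * q / s)"
      by (simp add: powr_add[symmetric] algebra_simps)
    finally show ?thesis by (simp add: add_increasing)
  qed
qed

text \<open>
  The last condition makes \<open>|x|\<close> to the power \<open>- (b + N p / s)\<close> integrable at infinity, which is
  what the energy of exponent \<open>p\<close> needs there when only the one of exponent \<open>s\<close> is known to be
  finite.
\<close>

definition tail_controlled :: "'n::finite itself \<Rightarrow> real \<Rightarrow> real \<Rightarrow> real \<Rightarrow> bool" where
  "tail_controlled _ b p s \<longleftrightarrow> 0 < b \<and> b < real CARD('n) \<and> 0 < p \<and> 0 < s \<and> real CARD('n) < b + real CARD('n) * p / s"

lemma compl_ball_lebesgue: "- ball (x::real^'n) R \<in> sets lebesgue"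
proof -
  have "- ball x R \<in> sets borel" by (intro borel_closed closed_Compl open_ball)
  then show ?thesis by simp
qed

lemma weighted_energy_far:
  assumes tc: "tail_controlled TYPE('n::finite) b p s" and B: "0 \<le> B" and A: "0 \<le> A"
  shows "\<exists>D \<eta>. 0 \<le> D \<and> 0 < \<eta> \<and> (\<forall>(u :: real^'n \<Rightarrow> complex) R. u \<in> borel_measurable lebesgue \<longrightarrow> (\<forall>x. norm (u x) \<le> B) \<longrightarrow>
     Lp_energy s u \<le> ennreal A \<longrightarrow> 0 < R \<longrightarrow>
     (\<integral>\<^sup>+x\<in>- ball 0 R. ennreal (norm x powr (- b) * norm (u x) powr p) \<partial>lebesgue) \<le> ennreal (D * R powr (- \<eta>)))"
proof -
  let ?N = "real CARD('n)"
  \<comment> \<open>a bounded function satisfies \<open>|u|\<^sup>p \<le> B^(p-q) |u|\<^sup>q\<close> for \<open>q \<le> p\<close>, so the exponent may be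
    lowered to at most \<open>s\<close>\<close>
  define q where "q = min p s"
  \<comment> \<open>the rate at which the tail outside a ball decays in its radius\<close>
  define \<eta> where "\<eta> = b + ?N * q / s - ?N"
  have h: "0 < b" "b < ?N" "0 < p" "0 < s" "?N < b + ?N * p / s" using tc by (auto simp: tail_controlled_def)
  have q: "0 < q" "q \<le> s" "q \<le> p" using h by (auto simp: q_def)
  have \<eta>: "0 < \<eta>" using h unfolding \<eta>_def q_def by (cases "p \<le> s") (auto simp: min_def)
  obtain C where C: "0 \<le> C" "\<And>r. 0 < r \<Longrightarrow>
    (\<integral>\<^sup>+x\<in>- ball (0::real^'n) r. ennreal (norm x powr (- (?N + \<eta>))) \<partial>lebesgue) \<le> ennreal (C * r powr (?N - (?N + \<eta>)))"
  proof -
    have "?N < ?N + \<eta>" using \<eta> by simp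
    then show ?thesis using that by (rule power_weight_far)
  qed
  show ?thesis
  proof (rule exI[of _ "B powr (p - q) * (C + A)"], rule exI[of _ \<eta>], intro conjI allI impI \<eta>)
    show "0 \<le> B powr (p - q) * (C + A)" using C A by simp
    fix u :: "real^'n \<Rightarrow> complex" and R :: real
    assume u: "u \<in> borel_measurable lebesgue" and ub: "\<forall>x. norm (u x) \<le> B"
      and us: "Lp_energy s u \<le> ennreal A" and R: "0 < R"
    note [measurable] = u
    note [measurable] = compl_ball_lebesgue[of "0::real^'n" R]
    have [measurable]: "(\<lambda>x::real^'n. ennreal (norm x powr (- (?N + \<eta>)))) \<in> borel_measurable lebesgue"
      using measurable_power_weight[of "- (?N + \<eta>)"] by measurable
    have pt: "ennreal (norm x powr (- b) * norm (u x) powr p) * indicator (- ball 0 R) x \<le>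
       ennreal (B powr (p - q)) * (ennreal (norm x powr (- (?N + \<eta>))) * indicator (- ball 0 R) x + ennreal (R powr (- \<eta>)) * ennreal (norm (u x) powr s))" for x
    proof (cases "x \<in> ball 0 R")
      case False
      then have xR: "R \<le> norm x" and x0: "x \<noteq> 0" using R by auto
      have "norm (u x) powr p = norm (u x) powr (p - q) * norm (u x) powr q" by (simp add: powr_add[symmetric])
      also have "\<dots> \<le> B powr (p - q) * norm (u x) powr q"
        using ub q by (intro mult_right_mono powr_mono2) auto
      finally have "norm x powr (- b) * norm (u x) powr p \<le> norm x powr (- b) * (B powr (p - q) * norm (u x) powr q)"
        by (intro mult_left_mono) auto
      also have "\<dots> = B powr (p - q) * (norm x powr (- b) * norm (u x) powr q)"
        by (rule mult.left_commute)
      finally have 1: "norm x powr (- b) * norm (u x) powr p \<le> B powr (p - q) * (norm x powr (- b) * norm (u x) powr q)" .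
      have e: "- (b + ?N * q / s) = - (?N + \<eta>)" "?N - b - ?N * q / s = - \<eta>"
        by (simp_all add: \<eta>_def)
      have "norm x powr (- b) * norm (u x) powr q \<le>
          norm x powr (- (?N + \<eta>)) + norm x powr (- \<eta>) * norm (u x) powr s"
        using far_pointwise[OF q(1,2) x0 norm_ge_zero[of "u x"], of b] unfolding e .
      also have "\<dots> \<le> norm x powr (- (?N + \<eta>)) + R powr (- \<eta>) * norm (u x) powr s"
        using xR R \<eta> by (intro add_left_mono mult_right_mono powr_mono2') auto
      finally have "B powr (p - q) * (norm x powr (- b) * norm (u x) powr q)
          \<le> B powr (p - q) * (norm x powr (- (?N + \<eta>)) + R powr (- \<eta>) * norm (u x) powr s)"
        by (intro mult_left_mono) auto
      with 1 have "norm x powr (- b) * norm (u x) powr p \<le> B powr (p - q) * (norm x powr (- (?N + \<eta>)) + R powr (- \<eta>) * norm (u x) powr s)"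
        by (rule order_trans)
      then show ?thesis using False
        by (simp add: ennreal_mult[symmetric] ennreal_plus[symmetric] ennreal_leI del: ennreal_plus)
    qed simp
    have "(\<integral>\<^sup>+x\<in>- ball 0 R. ennreal (norm x powr (- b) * norm (u x) powr p) \<partial>lebesgue) \<le>
      (\<integral>\<^sup>+x. ennreal (B powr (p - q)) * (ennreal (norm x powr (- (?N + \<eta>))) * indicator (- ball 0 R) x + ennreal (R powr (- \<eta>)) * ennreal (norm (u x) powr s)) \<partial>lebesgue)"
      by (intro nn_integral_mono pt)
    also have "\<dots> = ennreal (B powr (p - q)) * (\<integral>\<^sup>+x. ennreal (norm x powr (- (?N + \<eta>))) * indicator (- ball (0::real^'n) R) x + ennreal (R powr (- \<eta>)) * ennreal (norm (u x) powr s) \<partial>lebesgue)"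
      by (rule nn_integral_cmult) measurable
    also have "(\<integral>\<^sup>+x. ennreal (norm x powr (- (?N + \<eta>))) * indicator (- ball (0::real^'n) R) x + ennreal (R powr (- \<eta>)) * ennreal (norm (u x) powr s) \<partial>lebesgue)
      = (\<integral>\<^sup>+x\<in>- ball (0::real^'n) R. ennreal (norm x powr (- (?N + \<eta>))) \<partial>lebesgue) + (\<integral>\<^sup>+x. ennreal (R powr (- \<eta>)) * ennreal (norm (u x) powr s) \<partial>lebesgue)"
      by (rule nn_integral_add) measurable
    also have "(\<integral>\<^sup>+x. ennreal (R powr (- \<eta>)) * ennreal (norm (u x) powr s) \<partial>lebesgue) = ennreal (R powr (- \<eta>)) * Lp_energy s u"
      by (rule nn_integral_cmult) measurable
    also have "ennreal (B powr (p - q)) * ((\<integral>\<^sup>+x\<in>- ball (0::real^'n) R. ennreal (norm x powr (- (?N + \<eta>))) \<partial>lebesgue) + ennreal (R powr (- \<eta>)) * Lp_energy s u)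
      \<le> ennreal (B powr (p - q)) * (ennreal (C * R powr (?N - (?N + \<eta>))) + ennreal (R powr (- \<eta>)) * ennreal A)"
      by (intro mult_left_mono add_mono C(2)[OF R] us) auto
    also have "\<dots> = ennreal (B powr (p - q) * (C + A) * R powr (- \<eta>))"
      using C A by (simp add: ennreal_mult[symmetric] ennreal_plus[symmetric] del: ennreal_plus) (simp add: algebra_simps)
    finally show "(\<integral>\<^sup>+x\<in>- ball 0 R. ennreal (norm x powr (- b) * norm (u x) powr p) \<partial>lebesgue) \<le> ennreal (B powr (p - q) * (C + A) * R powr (- \<eta>))" .
  qed
qed

lemma nn_integral_ball_split:
  assumes "f \<in> borel_measurable lebesgue"
  shows "(\<integral>\<^sup>+x. f x \<partial>lebesgue) = (\<integral>\<^sup>+x\<in>ball (0::real^'n) R. f x \<partial>lebesgue) + (\<integral>\<^sup>+x\<in>- ball 0 R. f x \<partial>lebesgue)"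
proof -
  have m: "ball (0::real^'n) R \<in> sets lebesgue" "- ball (0::real^'n) R \<in> sets lebesgue"
    by (simp_all add: compl_ball_lebesgue)
  have "(\<integral>\<^sup>+x. f x \<partial>lebesgue) = (\<integral>\<^sup>+x. f x * indicator (ball 0 R) x + f x * indicator (- ball 0 R) x \<partial>lebesgue)"
    by (intro nn_integral_cong) (simp split: split_indicator)
  also have "\<dots> = (\<integral>\<^sup>+x\<in>ball 0 R. f x \<partial>lebesgue) + (\<integral>\<^sup>+x\<in>- ball 0 R. f x \<partial>lebesgue)"
    using assms m by (intro nn_integral_add borel_measurable_times_ennreal borel_measurable_indicator)
  finally show ?thesis .
qed

lemma weighted_energy_near:
  assumes b: "0 \<le> b" "b < real CARD('n)" and B: "0 \<le> B" and p: "0 \<le> p" and R: "0 < R"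
    and u: "(u :: real^'n \<Rightarrow> complex) \<in> borel_measurable lebesgue" "\<And>x. norm (u x) \<le> B"
  shows "(\<integral>\<^sup>+x\<in>ball 0 R. ennreal (norm x powr (- b) * norm (u x) powr p) \<partial>lebesgue)
    \<le> ennreal (B powr p) * (\<integral>\<^sup>+x\<in>ball (0::real^'n) R. ennreal (norm x powr (- b)) \<partial>lebesgue)"
    and "(\<integral>\<^sup>+x\<in>ball (0::real^'n) R. ennreal (norm x powr (- b)) \<partial>lebesgue) < \<infinity>"
proof -
  obtain C where "0 \<le> C" and C: "\<And>r. 0 < r \<Longrightarrow>
    (\<integral>\<^sup>+x\<in>ball (0::real^'n) r. ennreal (norm x powr (- b)) \<partial>lebesgue) \<le> ennreal (C * r powr (real CARD('n) - b))"
    by (rule power_weight_near_origin[OF b]) (rule that)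
  show "(\<integral>\<^sup>+x\<in>ball (0::real^'n) R. ennreal (norm x powr (- b)) \<partial>lebesgue) < \<infinity>"
    using C[OF R] by (simp add: le_less_trans)
  have [measurable]: "(\<lambda>x::real^'n. ennreal (norm x powr (- b))) \<in> borel_measurable lebesgue"
    using measurable_power_weight[of "- b"] by measurable
  have [measurable]: "ball (0::real^'n) R \<in> sets lebesgue" by simp
  have "(\<integral>\<^sup>+x\<in>ball 0 R. ennreal (norm x powr (- b) * norm (u x) powr p) \<partial>lebesgue)
    \<le> (\<integral>\<^sup>+x. ennreal (B powr p) * (ennreal (norm x powr (- b)) * indicator (ball (0::real^'n) R) x) \<partial>lebesgue)"
  proof (rule nn_integral_mono)
    fix x :: "real^'n"
    have "norm x powr (- b) * norm (u x) powr p \<le> norm x powr (- b) * B powr p"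
      using u(2) p by (intro mult_left_mono powr_mono2) auto
    then show "ennreal (norm x powr (- b) * norm (u x) powr p) * indicator (ball 0 R) x
      \<le> ennreal (B powr p) * (ennreal (norm x powr (- b)) * indicator (ball 0 R) x)"
      by (auto split: split_indicator simp: ennreal_mult[symmetric] mult.commute intro!: ennreal_leI)
  qed
  also have "\<dots> = ennreal (B powr p) * (\<integral>\<^sup>+x\<in>ball (0::real^'n) R. ennreal (norm x powr (- b)) \<partial>lebesgue)"
    by (rule nn_integral_cmult) measurable
  finally show "(\<integral>\<^sup>+x\<in>ball 0 R. ennreal (norm x powr (- b) * norm (u x) powr p) \<partial>lebesgue)
    \<le> ennreal (B powr p) * (\<integral>\<^sup>+x\<in>ball (0::real^'n) R. ennreal (norm x powr (- b)) \<partial>lebesgue)" .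
qed

lemma weighted_energy_bounded:
  assumes tc: "tail_controlled TYPE('n::finite) b p s" and B: "0 \<le> B" and A: "0 \<le> A"
  shows "\<exists>E\<ge>0. \<forall>u :: real^'n \<Rightarrow> complex. u \<in> borel_measurable lebesgue \<longrightarrow> (\<forall>x. norm (u x) \<le> B) \<longrightarrow>
     Lp_energy s u \<le> ennreal A \<longrightarrow> weighted_energy b p u \<le> ennreal E"
proof -
  have h: "0 \<le> b" "b < real CARD('n)" "0 \<le> p" using tc by (auto simp: tail_controlled_def)
  obtain D \<eta> where D: "0 \<le> D" "0 < \<eta>" and far: "\<forall>(u :: real^'n \<Rightarrow> complex) R. u \<in> borel_measurable lebesgue \<longrightarrow> (\<forall>x. norm (u x) \<le> B) \<longrightarrow>
     Lp_energy s u \<le> ennreal A \<longrightarrow> 0 < R \<longrightarrow>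
     (\<integral>\<^sup>+x\<in>- ball 0 R. ennreal (norm x powr (- b) * norm (u x) powr p) \<partial>lebesgue) \<le> ennreal (D * R powr (- \<eta>))"
    using weighted_energy_far[OF tc B A] by (elim exE conjE) (rule that)
  let ?W = "\<integral>\<^sup>+x\<in>ball (0::real^'n) 1. ennreal (norm x powr (- b)) \<partial>lebesgue"
  have Wfin: "?W < \<infinity>"
    using weighted_energy_near(2)[OF h(1,2) order_refl h(3) zero_less_one, of "\<lambda>_. 0"] by simp
  then obtain \<omega> where \<omega>: "0 \<le> \<omega>" "?W = ennreal \<omega>" by (cases ?W) auto
  show ?thesis
  proof (intro exI[of _ "B powr p * \<omega> + D"] conjI allI impI)
    show "0 \<le> B powr p * \<omega> + D" using \<omega> D by simp
    fix u :: "real^'n \<Rightarrow> complex"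
    assume u: "u \<in> borel_measurable lebesgue" and ub: "\<forall>x. norm (u x) \<le> B"
      and us: "Lp_energy s u \<le> ennreal A"
    have "weighted_energy b p u = (\<integral>\<^sup>+x\<in>ball (0::real^'n) 1. ennreal (norm x powr (- b) * norm (u x) powr p) \<partial>lebesgue)
       + (\<integral>\<^sup>+x\<in>- ball (0::real^'n) 1. ennreal (norm x powr (- b) * norm (u x) powr p) \<partial>lebesgue)"
      by (rule nn_integral_ball_split[OF measurable_weighted_energy[OF u]])
    also have "\<dots> \<le> ennreal (B powr p) * ennreal \<omega> + ennreal (D * 1 powr (- \<eta>))"
    proof (rule add_mono)
      show "(\<integral>\<^sup>+x\<in>ball (0::real^'n) 1. ennreal (norm x powr (- b) * norm (u x) powr p) \<partial>lebesgue) \<le> ennreal (B powr p) * ennreal \<omega>"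
        using weighted_energy_near(1)[OF h(1,2) B h(3) zero_less_one u ub[rule_format]] unfolding \<omega>(2) .
      show "(\<integral>\<^sup>+x\<in>- ball (0::real^'n) 1. ennreal (norm x powr (- b) * norm (u x) powr p) \<partial>lebesgue) \<le> ennreal (D * 1 powr (- \<eta>))"
        by (rule far[rule_format, OF u _ us zero_less_one]) (simp add: ub)
    qed
    also have "\<dots> = ennreal (B powr p * \<omega> + D)"
      using \<omega> D by (simp add: ennreal_mult[symmetric] ennreal_plus[symmetric] del: ennreal_plus)
    finally show "weighted_energy b p u \<le> ennreal (B powr p * \<omega> + D)" .
  qed
qed

text \<open>
  Uniformly small tails outside a large ball, dominated convergence inside it.
\<close>

lemma weighted_energy_tendsto_0:
  fixes u :: "nat \<Rightarrow> real^'n \<Rightarrow> complex"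
  assumes tc: "tail_controlled TYPE('n) b p s" and B: "0 \<le> B" and A: "0 \<le> A"
    and u: "\<And>n. u n \<in> borel_measurable lebesgue" and ub: "\<And>n x. norm (u n x) \<le> B"
    and us: "\<And>n. Lp_energy s (u n) \<le> ennreal A"
    and lim: "\<And>x. (\<lambda>n. u n x) \<longlonglongrightarrow> 0"
  shows "(\<lambda>n. weighted_energy b p (u n)) \<longlonglongrightarrow> 0"
proof (rule order_tendstoI)
  fix e :: ennreal assume "0 < e"
  then obtain e0 where e0: "0 < e0" "e0 < e" using dense by blast
  then have "e0 \<noteq> \<infinity>" by auto
  then obtain e' where "0 \<le> e'" "e0 = ennreal e'" by (cases e0) auto
  then have e': "0 < e'" "ennreal e' < e" using e0 by auto
  have h: "0 \<le> b" "b < real CARD('n)" "0 < p" using tc by (auto simp: tail_controlled_def)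
  obtain D \<eta> where D: "0 \<le> D" "0 < \<eta>" and far: "\<forall>(u :: real^'n \<Rightarrow> complex) R. u \<in> borel_measurable lebesgue \<longrightarrow> (\<forall>x. norm (u x) \<le> B) \<longrightarrow>
     Lp_energy s u \<le> ennreal A \<longrightarrow> 0 < R \<longrightarrow>
     (\<integral>\<^sup>+x\<in>- ball 0 R. ennreal (norm x powr (- b) * norm (u x) powr p) \<partial>lebesgue) \<le> ennreal (D * R powr (- \<eta>))"
    using weighted_energy_far[OF tc B A] by (elim exE conjE) (rule that)
  have "((\<lambda>R. D * R powr (- \<eta>)) \<longlongrightarrow> D * 0) at_top"
    by (intro tendsto_mult tendsto_const tendsto_neg_powr filterlim_ident) (use D in simp)
  then have "eventually (\<lambda>R. D * R powr (- \<eta>) < e' / 2) at_top" using e' by (intro order_tendstoD) auto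
  then have "eventually (\<lambda>R. D * R powr (- \<eta>) < e' / 2 \<and> 0 < R) at_top"
    using eventually_gt_at_top[of "0::real"] by eventually_elim simp
  then obtain R where R: "D * R powr (- \<eta>) < e' / 2" "0 < R" using eventually_happens by force
  let ?near = "\<lambda>n. \<integral>\<^sup>+x\<in>ball (0::real^'n) R. ennreal (norm x powr (- b) * norm (u n x) powr p) \<partial>lebesgue"
  have "?near \<longlonglongrightarrow> (\<integral>\<^sup>+x. 0 \<partial>(lebesgue :: (real^'n) measure))"
  proof (rule nn_integral_dominated_convergence[where w="\<lambda>x. ennreal (B powr p) * (ennreal (norm x powr (- b)) * indicator (ball (0::real^'n) R) x)"])
    have [measurable]: "ball (0::real^'n) R \<in> sets lebesgue" by simp
    show "(\<lambda>x. ennreal (norm x powr (- b) * norm (u n x) powr p) * indicator (ball 0 R) x) \<in> borel_measurable lebesgue" for n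
      using measurable_weighted_energy[OF u[of n], of b p] by measurable
    have wm [measurable]: "(\<lambda>x::real^'n. ennreal (norm x powr (- b))) \<in> borel_measurable lebesgue"
      using measurable_power_weight[of "- b"] by measurable
    show "(\<lambda>x::real^'n. ennreal (B powr p) * (ennreal (norm x powr (- b)) * indicator (ball 0 R) x)) \<in> borel_measurable lebesgue"
      by measurable
    have "(\<integral>\<^sup>+x. ennreal (B powr p) * (ennreal (norm x powr (- b)) * indicator (ball (0::real^'n) R) x) \<partial>lebesgue)
      = ennreal (B powr p) * (\<integral>\<^sup>+x\<in>ball (0::real^'n) R. ennreal (norm x powr (- b)) \<partial>lebesgue)"
      by (rule nn_integral_cmult) measurable
    also have "\<dots> < \<infinity>"
      using weighted_energy_near(2)[OF h(1,2) B less_imp_le[OF h(3)] R(2) u ub] by (simp add: ennreal_mult_less_top)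
    finally show "(\<integral>\<^sup>+x. ennreal (B powr p) * (ennreal (norm x powr (- b)) * indicator (ball (0::real^'n) R) x) \<partial>lebesgue) < \<infinity>" .
    show "AE x in lebesgue. ennreal (norm x powr (- b) * norm (u n x) powr p) * indicator (ball 0 R) x
       \<le> ennreal (B powr p) * (ennreal (norm x powr (- b)) * indicator (ball (0::real^'n) R) x)" for n
    proof (rule AE_I2)
      fix x :: "real^'n"
      have "norm x powr (- b) * norm (u n x) powr p \<le> norm x powr (- b) * B powr p"
        using ub h by (intro mult_left_mono powr_mono2) auto
      then show "ennreal (norm x powr (- b) * norm (u n x) powr p) * indicator (ball 0 R) x
        \<le> ennreal (B powr p) * (ennreal (norm x powr (- b)) * indicator (ball 0 R) x)"
        by (auto split: split_indicator simp: ennreal_mult[symmetric] mult.commute intro!: ennreal_leI)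
    qed
    show "AE x in lebesgue. (\<lambda>n. ennreal (norm x powr (- b) * norm (u n x) powr p) * indicator (ball (0::real^'n) R) x) \<longlonglongrightarrow> 0"
    proof (rule AE_I2)
      fix x :: "real^'n"
      have "(\<lambda>n. norm (u n x) powr p) \<longlonglongrightarrow> 0 powr p"
        using lim[of x] h(3) by (intro tendsto_powr' tendsto_norm_zero tendsto_const) auto
      then have "(\<lambda>n. norm x powr (- b) * norm (u n x) powr p) \<longlonglongrightarrow> 0"
        using h(3) tendsto_mult_right_zero by auto
      then have "(\<lambda>n. ennreal (norm x powr (- b) * norm (u n x) powr p)) \<longlonglongrightarrow> 0"
        using tendsto_ennrealI by fastforce
      then show "(\<lambda>n. ennreal (norm x powr (- b) * norm (u n x) powr p) * indicator (ball (0::real^'n) R) x) \<longlonglongrightarrow> 0"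
        by (cases "x \<in> ball 0 R") auto
    qed
  qed simp
  then have "eventually (\<lambda>n. ?near n < ennreal (e' / 2)) sequentially"
    using e' by (intro order_tendstoD) auto
  then show "eventually (\<lambda>n. weighted_energy b p (u n) < e) sequentially"
  proof eventually_elim
    case (elim n)
    have "weighted_energy b p (u n) = ?near n + (\<integral>\<^sup>+x\<in>- ball (0::real^'n) R. ennreal (norm x powr (- b) * norm (u n x) powr p) \<partial>lebesgue)"
      by (rule nn_integral_ball_split[OF measurable_weighted_energy[OF u]])
    also have "\<dots> \<le> ennreal (e' / 2) + ennreal (D * R powr (- \<eta>))"
      using elim far[rule_format, OF u _ us R(2)] ub by (intro add_mono) auto
    also have "\<dots> \<le> ennreal (e' / 2) + ennreal (e' / 2)"
      using R by (intro add_left_mono ennreal_leI) auto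
    also have "\<dots> = ennreal e'" using e' by (simp add: ennreal_plus[symmetric] del: ennreal_plus)
    finally show ?case using e'(2) by simp
  qed
qed simp

section \<open>Extraction of a convergent subsequence\<close>

lemma mollify_bound:
  fixes f :: "real^'n \<Rightarrow> complex"
  assumes f: "locally_integrable f" and s: "1 \<le> s" and A: "Lp_energy s f \<le> ennreal A" "0 \<le> A"
    and t: "0 < t"
  shows "norm (mollify t f x) \<le> 1 / (bump_mass TYPE('n) * t ^ CARD('n)) * (t ^ CARD('n) * unit_ball_content TYPE('n) + A)"
proof -
  have "norm (mollify t f x) \<le> 1 / (bump_mass TYPE('n) * t ^ CARD('n)) * (LINT y|lebesgue. indicator (cball x t) y * norm (f y))"
    by (rule mollify_sup_le[OF f t])
  also have "\<dots> \<le> 1 / (bump_mass TYPE('n) * t ^ CARD('n)) * (t ^ CARD('n) * unit_ball_content TYPE('n) + A)"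
    using ball_integral_le[OF f s A, of t x] bump_mass_pos[where 'n='n] t by (intro mult_left_mono) auto
  finally show ?thesis .
qed

text \<open>
  A diagonal argument gives convergence at all scales on a countable dense set, and
  equicontinuity at each scale extends it to every point.
\<close>

lemma mollify_subsequence_pointwise:
  fixes u :: "nat \<Rightarrow> real^'n \<Rightarrow> complex"
  assumes u: "\<And>n. locally_integrable (u n)" and s: "1 \<le> s"
    and A: "\<And>n. Lp_energy s (u n) \<le> ennreal A" "0 \<le> A"
  shows "\<exists>r. strict_mono r \<and> (\<forall>k x. convergent (\<lambda>n. mollify (1/2^k) (u (r n)) x))"
proof -
  let ?t = "\<lambda>k::nat. 1/2^k :: real"
  let ?M = "\<lambda>t. 1 / (bump_mass TYPE('n) * t ^ CARD('n)) * (t ^ CARD('n) * unit_ball_content TYPE('n) + A) :: real"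
  have M0: "0 \<le> ?M t" if "0 < t" for t
    using bump_mass_pos[where 'n='n] that A(2) by (intro mult_nonneg_nonneg add_nonneg_nonneg divide_nonneg_nonneg) auto
  obtain D :: "(real^'n) set" where D: "countable D" "\<And>X. open X \<Longrightarrow> X \<noteq> {} \<Longrightarrow> \<exists>d\<in>D. d \<in> X"
    using countable_dense_setE by blast
  \<comment> \<open>rescaled so that one bound serves for all scales in the diagonal argument\<close>
  define F where "F n z = (1 / (?M (?t (fst z)) + 1)) *\<^sub>R mollify (?t (fst z)) (u n) (snd z)" for n and z :: "nat \<times> (real^'n)"
  have F1: "norm (F n z) \<le> 1" for n z
  proof -
    have "norm (mollify (?t (fst z)) (u n) (snd z)) \<le> ?M (?t (fst z)) + 1"
      using mollify_bound[OF u s A, of "?t (fst z)" n "snd z"] by simp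
    moreover have "0 < ?M (?t (fst z)) + 1" using M0[of "?t (fst z)"] by simp
    ultimately show ?thesis unfolding F_def norm_scaleR by (simp del: divide_const_simps)
  qed
  obtain r where r: "strict_mono r" "\<And>z. z \<in> UNIV \<times> D \<Longrightarrow> \<exists>l. (\<lambda>n. F (r n) z) \<longlonglongrightarrow> l"
  proof (rule function_convergent_subsequence[of "UNIV \<times> D" F 1])
    show "countable ((UNIV :: nat set) \<times> D)" using D(1) by simp
    show "norm (F n z) \<le> 1" for n z by (rule F1)
  qed (rule that)
  have dense: "Cauchy (\<lambda>n. mollify (?t k) (u (r n)) y)" if y: "y \<in> D" for k y
  proof -
    have pos: "?M (?t k) + 1 \<noteq> 0" using M0[of "?t k"] by simp
    obtain l where "(\<lambda>n. F (r n) (k, y)) \<longlonglongrightarrow> l" using r(2)[of "(k, y)"] y by auto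
    then have "(\<lambda>n. (?M (?t k) + 1) *\<^sub>R F (r n) (k, y)) \<longlonglongrightarrow> (?M (?t k) + 1) *\<^sub>R l"
      by (intro tendsto_scaleR tendsto_const)
    moreover have "(?M (?t k) + 1) *\<^sub>R F (r n) (k, y) = mollify (?t k) (u (r n)) y" for n
      unfolding F_def fst_conv snd_conv scaleR_scaleR times_divide_eq_right mult_1_right divide_self[OF pos] scaleR_one ..
    ultimately show ?thesis by (simp only: LIMSEQ_imp_Cauchy)
  qed
  have "convergent (\<lambda>n. mollify (?t k) (u (r n)) x)" for k x
  proof -
    let ?m = "\<lambda>n. mollify (?t k) (u (r n))"
    let ?L = "(?t k + 1) ^ CARD('n) * unit_ball_content TYPE('n) + A"
    have L0: "0 \<le> ?L" using A(2) by (intro add_nonneg_nonneg mult_nonneg_nonneg) auto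
    have "Cauchy (\<lambda>n. ?m n x)"
      unfolding Cauchy_iff
    proof (intro allI impI)
      fix e :: real assume e: "0 < e"
      have "0 < e / (3 * (a + 1))" if "0 \<le> a" for a :: real using that e by simp
      from this[OF L0] have e3: "0 < e / (3 * (?L + 1))" .
      have t: "0 < ?t k" by simp
      obtain d where d: "0 < d" and eq: "\<forall>(f :: real^'n \<Rightarrow> complex) x x'. locally_integrable f \<longrightarrow> dist x x' < d \<longrightarrow>
         norm (mollify (?t k) f x - mollify (?t k) f x') \<le> e / (3 * (?L + 1)) * (LINT y|lebesgue. indicator (cball x (?t k + 1)) y * norm (f y))"
        using mollify_equicontinuous[OF t e3, where 'n='n and 'b=complex] by (elim exE conjE) (rule that)
      obtain y where y: "y \<in> D" "dist x y < d" using D(2)[of "ball x d"] d by auto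
      have close: "norm (?m n x - ?m n y) < e / 3" for n
      proof -
        have "norm (?m n x - ?m n y) \<le> e / (3 * (?L + 1)) * (LINT y|lebesgue. indicator (cball x (?t k + 1)) y * norm (u (r n) y))"
          by (rule eq[rule_format, OF u y(2)])
        also have "\<dots> \<le> e / (3 * (?L + 1)) * ?L"
          using ball_integral_le[OF u[of "r n"] s A(1)[of "r n"] A(2), where t="?t k + 1" and x=x] e3
          by (intro mult_left_mono) auto
        also have "\<dots> < e / 3"
        proof -
          have "e / (3 * (a + 1)) * a < e / 3" if "0 \<le> a" for a :: real using that e by (simp add: field_simps)
          from this[OF L0] show ?thesis .
        qed
        finally show ?thesis .
      qed
      obtain N where N: "\<And>m n. N \<le> m \<Longrightarrow> N \<le> n \<Longrightarrow> norm (?m m y - ?m n y) < e / 3"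
        using dense[OF y(1), of k] e unfolding Cauchy_iff by (meson divide_pos_pos zero_less_numeral)
      show "\<exists>N. \<forall>m\<ge>N. \<forall>n\<ge>N. norm (?m m x - ?m n x) < e"
      proof (intro exI[of _ N] allI impI)
        fix m n assume mn: "N \<le> m" "N \<le> n"
        have "?m m x - ?m n x = (?m m x - ?m m y) + (?m m y - ?m n y) - (?m n x - ?m n y)" by simp
        then have "norm (?m m x - ?m n x) \<le> norm (?m m x - ?m m y) + norm (?m m y - ?m n y) + norm (?m n x - ?m n y)"
          by (smt (verit) norm_triangle_ineq norm_triangle_ineq4)
        then show "norm (?m m x - ?m n x) < e" using close[of m] close[of n] N[OF mn] by linarith
      qed
    qed
    then show ?thesis by (rule Cauchy_convergent)
  qed
  then show ?thesis using r(1) by blast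
qed

lemma weighted_energy_0:
  "weighted_energy 0 s (f :: real^'n \<Rightarrow> complex) = Lp_energy s f"
proof (rule nn_integral_cong_AE)
  have "AE x in lebesgue. x \<notin> {0::real^'n}"
    by (intro AE_not_in) (simp add: negligible_iff_null_sets[symmetric])
  then show "AE x in lebesgue. ennreal (norm x powr - 0 * norm (f x) powr s) = ennreal (norm (f x) powr s)"
    by eventually_elim simp
qed

lemma weighted_energy_minus_commute:
  "weighted_energy b p (\<lambda>x. f x - g x) = weighted_energy b p (\<lambda>x. g x - (f x :: complex))"
  by (simp only: norm_minus_commute)

text \<open>
  The approximation estimate without weight bounds \<open>mollify (1/2^k) f - f\<close> in \<open>L\<^sup>s\<close>, and \<open>f\<close> itself
  is bounded there.
\<close>

lemma mollify_Lp_bound: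
  assumes sc: "subcritical TYPE('n::finite) 0 s" and G: "0 \<le> G" and A: "0 \<le> A"
  shows "\<exists>A'\<ge>0. \<forall>(f :: real^'n \<Rightarrow> complex) g k. has_weak_gradient f g \<longrightarrow>
      L2_energy g \<le> ennreal (G\<^sup>2) \<longrightarrow>
      Lp_energy s f \<le> ennreal A \<longrightarrow>
      (\<integral>\<^sup>+x. ennreal (norm (mollify (1/2^k) f x) powr s) \<partial>lebesgue) \<le> ennreal A'"
proof -
  obtain C q where C: "0 \<le> C" "0 < q" "q < 1" and app: "\<forall>(f :: real^'n \<Rightarrow> complex) g G k. has_weak_gradient f g \<longrightarrow>
      L2_energy g \<le> ennreal (G\<^sup>2) \<longrightarrow> 0 \<le> G \<longrightarrow>
      weighted_energy 0 s (\<lambda>x. f x - mollify (1/2^k) f x) \<le> ennreal (C * G powr s * q ^ k)"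
    using mollify_approximation[OF sc] by (elim exE conjE) (rule that)
  have s: "0 \<le> s" using sc by (simp add: subcritical_def)
  show ?thesis
  proof (rule exI[of _ "2 powr s * (C * G powr s + A)"], intro conjI allI impI)
    show "0 \<le> 2 powr s * (C * G powr s + A)" using C A by simp
    fix f :: "real^'n \<Rightarrow> complex" and g and k :: nat
    assume w: "has_weak_gradient f g" and gG: "L2_energy g \<le> ennreal (G\<^sup>2)"
      and fA: "Lp_energy s f \<le> ennreal A"
    have f: "locally_integrable f" using w by (simp add: has_weak_gradient_def)
    have fm: "f \<in> borel_measurable lebesgue" using f by (simp add: locally_integrable_def)
    have mm: "mollify (1/2^k) f \<in> borel_measurable lebesgue" by (rule measurable_mollify[OF f]) simp
    have dm: "(\<lambda>x. mollify (1/2^k) f x - f x) \<in> borel_measurable lebesgue" using fm mm by simp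
    have "weighted_energy 0 s (\<lambda>x. (mollify (1/2^k) f x - f x) + f x)
      \<le> ennreal (2 powr s) * (weighted_energy 0 s (\<lambda>x. mollify (1/2^k) f x - f x) + weighted_energy 0 s f)"
      by (rule weighted_energy_add[OF dm fm s])
    also have "\<dots> \<le> ennreal (2 powr s) * (ennreal (C * G powr s) + ennreal A)"
    proof (intro mult_left_mono add_mono)
      have "weighted_energy 0 s (\<lambda>x. mollify (1/2^k) f x - f x) \<le> ennreal (C * G powr s * q ^ k)"
        using app[rule_format, OF w gG G, of k] by (simp only: weighted_energy_minus_commute[where f=f and b=0])
      also have "\<dots> \<le> ennreal (C * G powr s)"
        using C by (intro ennreal_leI mult_right_le_one_le power_le_one) auto
      finally show "weighted_energy 0 s (\<lambda>x. mollify (1/2^k) f x - f x) \<le> ennreal (C * G powr s)" .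
      show "weighted_energy 0 s f \<le> ennreal A" using fA by (simp only: weighted_energy_0)
    qed simp
    also have "\<dots> = ennreal (2 powr s * (C * G powr s + A))"
      using C A by (simp add: ennreal_mult[symmetric] ennreal_plus[symmetric] del: ennreal_plus)
    finally show "(\<integral>\<^sup>+x. ennreal (norm (mollify (1/2^k) f x) powr s) \<partial>lebesgue) \<le> ennreal (2 powr s * (C * G powr s + A))"
      by (simp add: weighted_energy_0[symmetric])
  qed
qed

text \<open>
  Split \<open>f\<close> into its mollification at scale 1, which is bounded, and the remainder, which the
  gradient controls.
\<close>

lemma weighted_energy_le_of_bounds:
  assumes sc: "subcritical TYPE('n::finite) b p" and sc0: "subcritical TYPE('n) 0 s" and tc: "tail_controlled TYPE('n) b p s"
    and G: "0 \<le> G" and A: "0 \<le> A"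
  shows "\<exists>E\<ge>0. \<forall>(f :: real^'n \<Rightarrow> complex) g. has_weak_gradient f g \<longrightarrow>
      L2_energy g \<le> ennreal (G\<^sup>2) \<longrightarrow>
      Lp_energy s f \<le> ennreal A \<longrightarrow> weighted_energy b p f \<le> ennreal E"
proof -
  have s: "1 \<le> s" using sc0 by (simp add: subcritical_def)
  have p: "0 \<le> p" using sc by (simp add: subcritical_def)
  obtain C q where C: "0 \<le> C" "0 < q" "q < 1" and app: "\<forall>(f :: real^'n \<Rightarrow> complex) g G k. has_weak_gradient f g \<longrightarrow>
      L2_energy g \<le> ennreal (G\<^sup>2) \<longrightarrow> 0 \<le> G \<longrightarrow>
      weighted_energy b p (\<lambda>x. f x - mollify (1/2^k) f x) \<le> ennreal (C * G powr p * q ^ k)"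
    using mollify_approximation[OF sc] by (elim exE conjE) (rule that)
  obtain A' where A': "0 \<le> A'" and Lp: "\<forall>(f :: real^'n \<Rightarrow> complex) g k. has_weak_gradient f g \<longrightarrow>
      L2_energy g \<le> ennreal (G\<^sup>2) \<longrightarrow>
      Lp_energy s f \<le> ennreal A \<longrightarrow>
      (\<integral>\<^sup>+x. ennreal (norm (mollify (1/2^k) f x) powr s) \<partial>lebesgue) \<le> ennreal A'"
    using mollify_Lp_bound[OF sc0 G A] by (elim exE conjE) (rule that)
  let ?M = "1 / (bump_mass TYPE('n) * 1 ^ CARD('n)) * (1 ^ CARD('n) * unit_ball_content TYPE('n) + A)"
  have M: "0 \<le> ?M" using bump_mass_pos[where 'n='n] A by (intro mult_nonneg_nonneg add_nonneg_nonneg divide_nonneg_nonneg) auto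
  obtain E where E: "0 \<le> E" and bdd: "\<forall>u :: real^'n \<Rightarrow> complex. u \<in> borel_measurable lebesgue \<longrightarrow> (\<forall>x. norm (u x) \<le> ?M) \<longrightarrow>
     Lp_energy s u \<le> ennreal A' \<longrightarrow> weighted_energy b p u \<le> ennreal E"
    using weighted_energy_bounded[OF tc M A'] by (elim exE conjE) (rule that)
  show ?thesis
  proof (rule exI[of _ "2 powr p * (C * G powr p + E)"], intro conjI allI impI)
    show "0 \<le> 2 powr p * (C * G powr p + E)" using C E by simp
    fix f :: "real^'n \<Rightarrow> complex" and g
    assume w: "has_weak_gradient f g" and gG: "L2_energy g \<le> ennreal (G\<^sup>2)"
      and fA: "Lp_energy s f \<le> ennreal A"
    have f: "locally_integrable f" using w by (simp add: has_weak_gradient_def)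
    have fm: "f \<in> borel_measurable lebesgue" using f by (simp add: locally_integrable_def)
    have mm: "mollify 1 f \<in> borel_measurable lebesgue" by (rule measurable_mollify[OF f]) simp
    have dm: "(\<lambda>x. f x - mollify 1 f x) \<in> borel_measurable lebesgue" using fm mm by simp
    have "weighted_energy b p (\<lambda>x. (f x - mollify 1 f x) + mollify 1 f x)
      \<le> ennreal (2 powr p) * (weighted_energy b p (\<lambda>x. f x - mollify 1 f x) + weighted_energy b p (mollify 1 f))"
      by (rule weighted_energy_add[OF dm mm p])
    also have "\<dots> \<le> ennreal (2 powr p) * (ennreal (C * G powr p) + ennreal E)"
    proof (intro mult_left_mono add_mono)
      show "weighted_energy b p (\<lambda>x. f x - mollify 1 f x) \<le> ennreal (C * G powr p)"
        using app[rule_format, OF w gG G, of 0] by simp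
      show "weighted_energy b p (mollify 1 f) \<le> ennreal E"
      proof (rule bdd[rule_format, OF mm])
        show "norm (mollify 1 f x) \<le> ?M" for x by (rule mollify_bound[OF f s fA A]) simp
        show "Lp_energy s (mollify 1 f) \<le> ennreal A'"
          using Lp[rule_format, OF w gG fA, of 0] by simp
      qed
    qed simp
    also have "\<dots> = ennreal (2 powr p * (C * G powr p + E))"
      using C E by (simp add: ennreal_mult[symmetric] ennreal_plus[symmetric] del: ennreal_plus)
    finally show "weighted_energy b p f \<le> ennreal (2 powr p * (C * G powr p + E))" by simp
  qed
qed

text \<open>
  Three approximations are combined: of \<open>u (r n)\<close> by its mollification at a small scale,
  uniformly in \<open>n\<close>; of that mollification by its limit \<open>v k\<close> for large \<open>n\<close>; and of \<open>v k\<close> by \<open>l\<close>. By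
  Fatou's lemma the functions \<open>v k\<close> obey the same dyadic estimate as mollifications of a single
  function, so \<open>l\<close> exists by telescoping.
\<close>

lemma bounded_sequence_has_convergent_subsequence:
  fixes u :: "nat \<Rightarrow> real^'n \<Rightarrow> complex"
  assumes sc: "subcritical TYPE('n) b p" and sc0: "subcritical TYPE('n) 0 s" and tc: "tail_controlled TYPE('n) b p s"
    and G: "0 \<le> G" and A: "0 \<le> A"
    and w: "\<And>n. has_weak_gradient (u n) (g n)"
    and gG: "\<And>n. L2_energy (g n) \<le> ennreal (G\<^sup>2)"
    and uA: "\<And>n. Lp_energy s (u n) \<le> ennreal A"
  shows "\<exists>l r. l \<in> borel_measurable lebesgue \<and> strict_mono r \<and>
    (\<lambda>n. weighted_energy b p (\<lambda>x. u (r n) x - l x)) \<longlonglongrightarrow> 0"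
proof -
  have s: "1 \<le> s" and s0: "0 < s" using sc0 by (auto simp: subcritical_def)
  have p: "0 \<le> p" and p0: "0 < p" using sc by (auto simp: subcritical_def)
  have ul: "locally_integrable (u n)" for n using w[of n] by (simp add: has_weak_gradient_def)
  have um: "u n \<in> borel_measurable lebesgue" for n using ul[of n] by (simp add: locally_integrable_def)
  obtain r where r: "strict_mono r" and conv: "\<forall>k x. convergent (\<lambda>n. mollify (1/2^k) (u (r n)) x)"
    using mollify_subsequence_pointwise[where u=u, OF ul s uA A] by (elim exE conjE) (rule that)
  let ?m = "\<lambda>k n. mollify (1/2^k) (u (r n))"
  have mm: "?m k n \<in> borel_measurable lebesgue" for k n by (rule measurable_mollify[OF ul]) simp
  define v where "v k x = lim (\<lambda>n. ?m k n x)" for k x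
  have lim: "(\<lambda>n. ?m k n x) \<longlonglongrightarrow> v k x" for k x
    unfolding v_def using conv by (simp add: convergent_LIMSEQ_iff)
  have vm: "v k \<in> borel_measurable lebesgue" for k
    by (rule borel_measurable_LIMSEQ_metric[OF mm lim])
  obtain C1 q1 where C1: "0 \<le> C1" and q1: "0 < q1" "q1 < 1" and step: "\<forall>(f :: real^'n \<Rightarrow> complex) g G k. has_weak_gradient f g \<longrightarrow>
      L2_energy g \<le> ennreal (G\<^sup>2) \<longrightarrow> 0 \<le> G \<longrightarrow>
      weighted_energy b p (\<lambda>x. mollify (1/2^Suc k) f x - mollify (1/2^k) f x) \<le> ennreal (C1 * G powr p * q1 ^ k)"
    using dyadic_step_weighted[OF sc] by (elim exE conjE) (rule that)
  obtain C2 q2 where C2: "0 \<le> C2" and q2: "0 < q2" "q2 < 1" and app: "\<forall>(f :: real^'n \<Rightarrow> complex) g G k. has_weak_gradient f g \<longrightarrow>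
      L2_energy g \<le> ennreal (G\<^sup>2) \<longrightarrow> 0 \<le> G \<longrightarrow>
      weighted_energy b p (\<lambda>x. f x - mollify (1/2^k) f x) \<le> ennreal (C2 * G powr p * q2 ^ k)"
    using mollify_approximation[OF sc] by (elim exE conjE) (rule that)
  obtain A' where A': "0 \<le> A'" and Lp: "\<forall>(f :: real^'n \<Rightarrow> complex) g k. has_weak_gradient f g \<longrightarrow>
      L2_energy g \<le> ennreal (G\<^sup>2) \<longrightarrow>
      Lp_energy s f \<le> ennreal A \<longrightarrow>
      (\<integral>\<^sup>+x. ennreal (norm (mollify (1/2^k) f x) powr s) \<partial>lebesgue) \<le> ennreal A'"
    using mollify_Lp_bound[OF sc0 G A] by (elim exE conjE) (rule that)
  have mA': "Lp_energy s (?m k n) \<le> ennreal A'" for k n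
    by (rule Lp[rule_format, OF w gG uA])

  have fixed_scale: "(\<lambda>n. weighted_energy b p (\<lambda>x. ?m k n x - v k x)) \<longlonglongrightarrow> 0" for k
  proof -
    let ?t = "1/2^k :: real"
    let ?M = "1 / (bump_mass TYPE('n) * ?t ^ CARD('n)) * (?t ^ CARD('n) * unit_ball_content TYPE('n) + A)"
    have mb: "norm (?m k n x) \<le> ?M" for n x
      by (rule mollify_bound[OF ul s uA A]) simp
    have vb: "norm (v k x) \<le> ?M" for x
      by (rule LIMSEQ_le_const2[OF tendsto_norm[OF lim]]) (use mb in auto)
    have vA': "Lp_energy s (v k) \<le> ennreal A'"
    proof (rule nn_integral_le_of_pointwise_limit[OF _ mA'])
      show "(\<lambda>x. ennreal (norm (?m k n x) powr s)) \<in> borel_measurable lebesgue" for n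
        using mm[of k n] by measurable
      show "(\<lambda>n. norm (?m k n x) powr s) \<longlonglongrightarrow> norm (v k x) powr s" for x
        using s0 by (intro tendsto_powr' tendsto_norm lim tendsto_const) auto
    qed
    let ?A = "2 powr s * (A' + A')"
    show ?thesis
    proof (rule weighted_energy_tendsto_0[OF tc])
      have "0 \<le> ?M" by (rule order_trans[OF norm_ge_zero mb[of 0 0]])
      then show "0 \<le> ?M + ?M" by (intro add_nonneg_nonneg)
      show "0 \<le> ?A" using A' by simp
      show dm: "(\<lambda>x. ?m k n x - v k x) \<in> borel_measurable lebesgue" for n using mm[of k n] vm[of k] by simp
      show "norm (?m k n x - v k x) \<le> ?M + ?M" for n x
        using norm_triangle_ineq4[of "?m k n x" "v k x"] mb[of n x] vb[of x] by linarith
      show "(\<integral>\<^sup>+x. ennreal (norm (?m k n x - v k x) powr s) \<partial>lebesgue) \<le> ennreal ?A" for n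
      proof -
        have vm': "(\<lambda>x. - v k x) \<in> borel_measurable lebesgue" using vm[of k] by simp
        have "weighted_energy 0 s (\<lambda>x. ?m k n x + - v k x) \<le> ennreal (2 powr s) * (weighted_energy 0 s (?m k n) + weighted_energy 0 s (\<lambda>x. - v k x))"
          by (rule weighted_energy_add[OF mm vm']) (use s0 in simp)
        also have "\<dots> \<le> ennreal (2 powr s) * (ennreal A' + ennreal A')"
          using mA'[of k n] vA' unfolding weighted_energy_0 norm_minus_cancel by (intro mult_left_mono add_mono) auto
        also have "\<dots> = ennreal ?A" using A' by (simp add: ennreal_mult[symmetric] ennreal_plus[symmetric] del: ennreal_plus)
        finally show ?thesis unfolding weighted_energy_0 by simp
      qed
      show "(\<lambda>n. ?m k n x - v k x) \<longlonglongrightarrow> 0" for x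
        using tendsto_diff[OF lim[of k x] tendsto_const[of "v k x"]] by simp
    qed
  qed

  let ?K = "C1 * G powr p"
  have K0: "0 \<le> ?K" using C1 by simp
  have vstep: "weighted_energy b p (\<lambda>x. v (Suc k) x - v k x) \<le> ennreal (?K * q1 ^ k)" for k
  proof (rule nn_integral_le_of_pointwise_limit)
    show "(\<lambda>x. ennreal (norm x powr (- b) * norm (?m (Suc k) n x - ?m k n x) powr p)) \<in> borel_measurable lebesgue" for n
      by (rule measurable_weighted_energy[OF borel_measurable_diff[OF mm mm]])
    show "weighted_energy b p (\<lambda>x. ?m (Suc k) n x - ?m k n x) \<le> ennreal (?K * q1 ^ k)" for n
      by (rule step[rule_format, OF w gG G])
    show "(\<lambda>n. norm x powr (- b) * norm (?m (Suc k) n x - ?m k n x) powr p) \<longlonglongrightarrow> norm x powr (- b) * norm (v (Suc k) x - v k x) powr p" for x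
      using p0 by (intro tendsto_mult tendsto_powr' tendsto_norm tendsto_diff lim tendsto_const) auto
  qed
  have W: "(\<lambda>x::real^'n. norm x powr (- b)) \<in> borel_measurable lebesgue" "\<And>x::real^'n. 0 \<le> norm x powr (- b)"
    by (simp_all add: measurable_power_weight)
  define l where "l x = lim (\<lambda>k. v k x)" for x
  have lm: "l \<in> borel_measurable lebesgue" unfolding l_def by (rule borel_measurable_lim_metric[OF vm])
  have "AE x in lebesgue. 0 < norm x powr (- b) \<longrightarrow> (\<lambda>k. v k x) \<longlonglongrightarrow> l x"
    using telescoping_AE_convergent[OF p0 q1 K0 vm W vstep]
    by eventually_elim (simp add: l_def convergent_LIMSEQ_iff)
  then have vl: "weighted_energy b p (\<lambda>x. l x - v k x) \<le> ennreal (telescoping_const p q1 * ?K * q1 ^ k)" for k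
    by (rule telescoping_bound[OF p0 q1 K0 vm W vstep])
  let ?T = "telescoping_const p q1"
  have T: "0 \<le> ?T" by (rule telescoping_const_nonneg[OF q1])

  have split: "weighted_energy b p (\<lambda>x. u (r n) x - l x) \<le>
      ennreal (2 powr p * (C2 * G powr p * q2 ^ k) + 2 powr p * (2 powr p * (?T * ?K * q1 ^ k)))
      + ennreal (2 powr p * 2 powr p) * weighted_energy b p (\<lambda>x. ?m k n x - v k x)" for n k
  proof -
    have m1: "(\<lambda>x. u (r n) x - ?m k n x) \<in> borel_measurable lebesgue" using um[of "r n"] mm[of k n] by simp
    have m2: "(\<lambda>x. v k x - l x) \<in> borel_measurable lebesgue" using vm[of k] lm by simp
    have m3: "(\<lambda>x. ?m k n x - v k x) \<in> borel_measurable lebesgue" using vm[of k] mm[of k n] by simp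
    note m23 = borel_measurable_add[OF m2 m3]
    have "weighted_energy b p (\<lambda>x. (u (r n) x - ?m k n x) + ((v k x - l x) + (?m k n x - v k x)))
      \<le> ennreal (2 powr p) * (weighted_energy b p (\<lambda>x. u (r n) x - ?m k n x)
          + weighted_energy b p (\<lambda>x. (v k x - l x) + (?m k n x - v k x)))"
      by (rule weighted_energy_add[OF m1 m23 p])
    also have "\<dots> \<le> ennreal (2 powr p) * (ennreal (C2 * G powr p * q2 ^ k) +
        ennreal (2 powr p) * (ennreal (?T * ?K * q1 ^ k) + weighted_energy b p (\<lambda>x. ?m k n x - v k x)))"
    proof (intro mult_left_mono add_mono)
      show "weighted_energy b p (\<lambda>x. u (r n) x - ?m k n x) \<le> ennreal (C2 * G powr p * q2 ^ k)"
        by (rule app[rule_format, OF w gG G])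
      have "weighted_energy b p (\<lambda>x. (v k x - l x) + (?m k n x - v k x))
        \<le> ennreal (2 powr p) * (weighted_energy b p (\<lambda>x. v k x - l x) + weighted_energy b p (\<lambda>x. ?m k n x - v k x))"
        by (rule weighted_energy_add[OF m2 m3 p])
      also have "\<dots> \<le> ennreal (2 powr p) * (ennreal (?T * ?K * q1 ^ k) + weighted_energy b p (\<lambda>x. ?m k n x - v k x))"
        using vl[of k] unfolding weighted_energy_minus_commute[where f="v k" and g=l] by (intro mult_left_mono add_right_mono) auto
      finally show "weighted_energy b p (\<lambda>x. (v k x - l x) + (?m k n x - v k x)) \<le> \<dots>" .
    qed simp
    also have "\<dots> = (ennreal (2 powr p) * ennreal (C2 * G powr p * q2 ^ k) + ennreal (2 powr p) * (ennreal (2 powr p) * ennreal (?T * ?K * q1 ^ k)))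
        + (ennreal (2 powr p) * ennreal (2 powr p)) * weighted_energy b p (\<lambda>x. ?m k n x - v k x)"
      by (simp only: distrib_left mult.assoc add.assoc)
    also have "ennreal (2 powr p) * ennreal (C2 * G powr p * q2 ^ k) + ennreal (2 powr p) * (ennreal (2 powr p) * ennreal (?T * ?K * q1 ^ k))
      = ennreal (2 powr p * (C2 * G powr p * q2 ^ k) + 2 powr p * (2 powr p * (?T * ?K * q1 ^ k)))"
      using C2 q2 q1 T K0 by (simp add: ennreal_mult[symmetric] ennreal_plus[symmetric] del: ennreal_plus)
    also have "ennreal (2 powr p) * ennreal (2 powr p) = ennreal (2 powr p * 2 powr p)" by (simp add: ennreal_mult)
    finally show ?thesis by simp
  qed

  have "(\<lambda>n. weighted_energy b p (\<lambda>x. u (r n) x - l x)) \<longlonglongrightarrow> 0"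
  proof (rule order_tendstoI)
    fix e :: ennreal assume "0 < e"
    then obtain e0 where e0: "0 < e0" "e0 < e" using dense by blast
    then have "e0 \<noteq> \<infinity>" by auto
    then obtain e' where "0 \<le> e'" "e0 = ennreal e'" by (cases e0) auto
    then have e': "0 < e'" "ennreal e' < e" using e0 by auto
    have "(\<lambda>k. 2 powr p * (C2 * G powr p * q2 ^ k) + 2 powr p * (2 powr p * (?T * ?K * q1 ^ k))) \<longlonglongrightarrow> 2 powr p * (C2 * G powr p * 0) + 2 powr p * (2 powr p * (?T * ?K * 0))"
      using q1 q2 by (intro tendsto_add tendsto_mult tendsto_const LIMSEQ_realpow_zero) auto
    then have "eventually (\<lambda>k. 2 powr p * (C2 * G powr p * q2 ^ k) + 2 powr p * (2 powr p * (?T * ?K * q1 ^ k)) < e' / 2) sequentially"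
      using e' by (intro order_tendstoD) auto
    then obtain k where k: "2 powr p * (C2 * G powr p * q2 ^ k) + 2 powr p * (2 powr p * (?T * ?K * q1 ^ k)) < e' / 2"
      using eventually_happens by force
    have "(\<lambda>n. ennreal (2 powr p * 2 powr p) * weighted_energy b p (\<lambda>x. ?m k n x - v k x)) \<longlonglongrightarrow> ennreal (2 powr p * 2 powr p) * 0"
      by (intro ennreal_tendsto_cmult fixed_scale) simp
    then have "eventually (\<lambda>n. ennreal (2 powr p * 2 powr p) * weighted_energy b p (\<lambda>x. ?m k n x - v k x) < ennreal (e' / 2)) sequentially"
      using e' by (intro order_tendstoD) auto
    then show "eventually (\<lambda>n. weighted_energy b p (\<lambda>x. u (r n) x - l x) < e) sequentially"
    proof eventually_elim
      case (elim n)
      have "weighted_energy b p (\<lambda>x. u (r n) x - l x) \<le> ennreal (e' / 2) + ennreal (e' / 2)"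
        by (rule order_trans[OF split[of n k]]) (intro add_mono ennreal_leI less_imp_le k elim)
      also have "\<dots> = ennreal e'" using e' by (simp add: ennreal_plus[symmetric] del: ennreal_plus)
      finally show ?case using e'(2) by simp
    qed
  qed simp
  then show ?thesis using lm r by blast
qed

section \<open>The compact embedding\<close>

lemma has_weak_gradient_scaleR:
  fixes f :: "real^'n \<Rightarrow> complex"
  assumes "has_weak_gradient f g"
  shows "has_weak_gradient (\<lambda>x. c *\<^sub>R f x) (\<lambda>x. c *\<^sub>R g x)"
proof -
  have li: "locally_integrable (\<lambda>x. c *\<^sub>R h x)" if "locally_integrable h" for h :: "real^'n \<Rightarrow> 'b::{banach,second_countable_topology}"
  proof -
    have "integrable lebesgue (\<lambda>x. c *\<^sub>R (indicator K x *\<^sub>R h x))" if "compact K" for K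
      using \<open>locally_integrable h\<close> that by (intro integrable_scaleR_right) (auto simp: locally_integrable_def set_integrable_def)
    then show ?thesis using that
      unfolding locally_integrable_def set_integrable_def by (auto simp: mult.commute)
  qed
  have f: "locally_integrable f" and g: "locally_integrable g" using assms by (auto simp: has_weak_gradient_def)
  show ?thesis
    unfolding has_weak_gradient_def
  proof (intro conjI allI impI li f g)
    fix \<phi> :: "real^'n \<Rightarrow> real" and i assume t: "test_function \<phi>"
    have "(LINT x|lebesgue. partial_deriv i \<phi> x *\<^sub>R f x) = - (LINT x|lebesgue. \<phi> x *\<^sub>R (g x $ i))"
      using assms[unfolded has_weak_gradient_def, THEN conjunct2, THEN conjunct2, rule_format, OF t] .
    then have "c *\<^sub>R (LINT x|lebesgue. partial_deriv i \<phi> x *\<^sub>R f x) = - (c *\<^sub>R (LINT x|lebesgue. \<phi> x *\<^sub>R (g x $ i)))"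
      by (simp only: scaleR_minus_right)
    then show "(LINT x|lebesgue. partial_deriv i \<phi> x *\<^sub>R (c *\<^sub>R f x)) = - (LINT x|lebesgue. \<phi> x *\<^sub>R ((c *\<^sub>R g x) $ i))"
      by (simp only: vector_scaleR_component scaleR_left_commute[of _ c] integral_scaleR_right)
  qed
qed

text \<open>
  The chosen representative need not be the square integrable one from the definition of the
  space; uniqueness transfers integrability.
\<close>

lemma hom_sobolev_weak_gradient:
  fixes f :: "real^'n \<Rightarrow> complex"
  assumes "f \<in> hom_sobolev"
  shows "has_weak_gradient f (weak_gradient f)" and "weak_gradient f \<in> Lp_space 2"
proof -
  obtain g where g: "has_weak_gradient f g" "g \<in> Lp_space 2" using assms by (auto simp: hom_sobolev_def)
  show w: "has_weak_gradient f (weak_gradient f)"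
    unfolding weak_gradient_def by (rule someI[where P="has_weak_gradient f", OF g(1)])
  have m: "weak_gradient f \<in> borel_measurable lebesgue"
    using w by (simp add: has_weak_gradient_def locally_integrable_def)
  have gm: "g \<in> borel_measurable lebesgue" and gi: "integrable lebesgue (\<lambda>x. norm (g x) powr 2)"
    using g(2) by (auto simp: Lp_space_def)
  have "integrable lebesgue (\<lambda>x. norm (weak_gradient f x) powr 2)"
  proof (subst integrable_cong_AE)
    show "(\<lambda>x. norm (weak_gradient f x) powr 2) \<in> borel_measurable lebesgue"
      using m by measurable
    show "(\<lambda>x. norm (g x) powr 2) \<in> borel_measurable lebesgue" using gm by measurable
    show "AE x in lebesgue. norm (weak_gradient f x) powr 2 = norm (g x) powr 2"
      using weak_gradient_unique[OF w g(1)] by eventually_elim simp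
  qed (rule gi)
  then show "weak_gradient f \<in> Lp_space 2" using m by (simp add: Lp_space_def)
qed

lemma nn_integral_Lp_norm:
  assumes f: "f \<in> Lp_space p" and p: "0 < p"
  shows "Lp_energy p f = ennreal (Lp_norm p f powr p)"
    and "0 \<le> Lp_norm p f"
proof -
  have "0 \<le> (LINT x|lebesgue. norm (f x) powr p)" by (intro integral_nonneg_AE) simp
  then have "Lp_norm p f powr p = (LINT x|lebesgue. norm (f x) powr p)"
    using p by (simp add: Lp_norm_def powr_powr)
  moreover have "integrable lebesgue (\<lambda>x. norm (f x) powr p)" using f by (simp add: Lp_space_def)
  ultimately show "Lp_energy p f = ennreal (Lp_norm p f powr p)"
    by (simp add: nn_integral_eq_integral)
  show "0 \<le> Lp_norm p f" by (simp add: Lp_norm_def)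
qed

lemma weighted_Lp_spaceI:
  fixes f :: "real^'n \<Rightarrow> complex"
  assumes f: "f \<in> borel_measurable lebesgue" and E: "weighted_energy b p f < \<infinity>"
  shows "f \<in> weighted_Lp_space b p"
proof -
  have "(\<lambda>x. norm x powr (- b) * norm (f x) powr p) \<in> borel_measurable lebesgue"
    using f measurable_power_weight[of "- b"] by measurable
  then have "integrable lebesgue (\<lambda>x. norm x powr (- b) * norm (f x) powr p)"
    using E by (intro integrableI_bounded) (auto simp: norm_mult)
  then show ?thesis using f by (simp add: weighted_Lp_space_def)
qed

lemma weighted_Lp_norm_eq:
  fixes f :: "real^'n \<Rightarrow> complex"
  assumes f: "f \<in> borel_measurable lebesgue"
  shows "weighted_Lp_norm b p f = enn2real (weighted_energy b p f) powr (1 / p)"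
proof -
  have "(\<lambda>x. norm x powr (- b) * norm (f x) powr p) \<in> borel_measurable lebesgue"
    using f measurable_power_weight[of "- b"] by measurable
  then have "(LINT x|lebesgue. norm x powr (- b) * norm (f x) powr p) = enn2real (weighted_energy b p f)"
    by (intro integral_eq_nn_integral) auto
  then show ?thesis by (simp add: weighted_Lp_norm_def)
qed

lemma weighted_energy_scaleR:
  fixes f :: "real^'n \<Rightarrow> complex"
  assumes f: "f \<in> borel_measurable lebesgue" and c: "0 \<le> c"
  shows "weighted_energy b p (\<lambda>x. c *\<^sub>R f x) = ennreal (c powr p) * weighted_energy b p f"
proof -
  have "weighted_energy b p (\<lambda>x. c *\<^sub>R f x) = (\<integral>\<^sup>+x. ennreal (c powr p) * ennreal (norm x powr (- b) * norm (f x) powr p) \<partial>lebesgue)"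
    using c by (intro nn_integral_cong) (simp add: powr_mult ennreal_mult[symmetric] mult.left_commute)
  also have "\<dots> = ennreal (c powr p) * weighted_energy b p f"
    by (rule nn_integral_cmult[OF measurable_weighted_energy[OF f]])
  finally show ?thesis .
qed

text \<open>
  Boundedness of the inclusion on the unit ball becomes a linear bound by rescaling \<open>f\<close> to norm
  1. If the norm of \<open>f\<close> is 0, then \<open>f\<close> vanishes almost everywhere.
\<close>

lemma compact_embedding_weighted:
  assumes sc: "subcritical TYPE('n::finite) b p" and sc0: "subcritical TYPE('n) 0 s" and tc: "tail_controlled TYPE('n) b p s"
  shows "compact_embedding (hom_sobolev \<inter> Lp_space s :: (real^'n \<Rightarrow> complex) set)
    (\<lambda>f. hom_sobolev_norm f + Lp_norm s f) (weighted_Lp_space b p) (weighted_Lp_norm b p)"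
proof -
  let ?X = "hom_sobolev \<inter> Lp_space s :: (real^'n \<Rightarrow> complex) set"
  let ?N = "\<lambda>f :: real^'n \<Rightarrow> complex. hom_sobolev_norm f + Lp_norm s f"
  have s: "0 < s" using sc0 by (simp add: subcritical_def)
  have p: "0 < p" using sc by (simp add: subcritical_def)
  have data: "has_weak_gradient f (weak_gradient f)" "f \<in> borel_measurable lebesgue"
      "L2_energy (weak_gradient f) = ennreal ((hom_sobolev_norm f)\<^sup>2)"
      "Lp_energy s f = ennreal (Lp_norm s f powr s)"
      "0 \<le> hom_sobolev_norm f" "0 \<le> Lp_norm s f" if "f \<in> ?X" for f
  proof -
    have f: "f \<in> hom_sobolev" "f \<in> Lp_space s" using that by auto
    show "has_weak_gradient f (weak_gradient f)" by (rule hom_sobolev_weak_gradient[OF f(1)])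
    show "f \<in> borel_measurable lebesgue" using f(2) by (simp add: Lp_space_def)
    note L2 = nn_integral_Lp_norm[OF hom_sobolev_weak_gradient(2)[OF f(1)] zero_less_numeral]
    show nn: "0 \<le> hom_sobolev_norm f" using L2(2) by (simp add: hom_sobolev_norm_def)
    show "L2_energy (weak_gradient f) = ennreal ((hom_sobolev_norm f)\<^sup>2)"
      using L2(1) nn by (simp add: hom_sobolev_norm_def powr_2_eq_power2)
    show "Lp_energy s f = ennreal (Lp_norm s f powr s)" "0 \<le> Lp_norm s f"
      by (rule nn_integral_Lp_norm[OF f(2) s])+
  qed

  have finite: "weighted_energy b p f < \<infinity>" if f: "f \<in> ?X" for f
  proof -
    have Ls: "0 \<le> Lp_norm s f powr s" by simp
    obtain E where bd: "\<forall>(h :: real^'n \<Rightarrow> complex) g. has_weak_gradient h g \<longrightarrow>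
      L2_energy g \<le> ennreal ((hom_sobolev_norm f)\<^sup>2) \<longrightarrow>
      Lp_energy s h \<le> ennreal (Lp_norm s f powr s) \<longrightarrow> weighted_energy b p h \<le> ennreal E"
      using weighted_energy_le_of_bounds[OF sc sc0 tc data(5)[OF f] Ls] by (elim exE conjE) (rule that)
    have "weighted_energy b p f \<le> ennreal E"
      by (rule bd[rule_format, OF data(1)[OF f] eq_refl[OF data(3)[OF f]] eq_refl[OF data(4)[OF f]]])
    then show ?thesis by (simp add: le_less_trans)
  qed
  have sub: "?X \<subseteq> weighted_Lp_space b p"
    using weighted_Lp_spaceI[OF data(2) finite] by blast

  obtain E where E: "0 \<le> E" and bd: "\<forall>(f :: real^'n \<Rightarrow> complex) g. has_weak_gradient f g \<longrightarrow>
      L2_energy g \<le> ennreal (1\<^sup>2) \<longrightarrow>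
      Lp_energy s f \<le> ennreal 1 \<longrightarrow> weighted_energy b p f \<le> ennreal E"
    using weighted_energy_le_of_bounds[OF sc sc0 tc zero_le_one zero_le_one] by (elim exE conjE) (rule that)
  have bounded: "weighted_Lp_norm b p f \<le> E powr (1/p) * ?N f" if f: "f \<in> ?X" for f
  proof (cases "?N f = 0")
    case True
    then have "Lp_norm s f = 0" using data(5,6)[OF f] by linarith
    then have "Lp_energy s f = 0" using data(4)[OF f] s by simp
    then have "AE x in lebesgue. ennreal (norm (f x) powr s) = 0"
      using data(2)[OF f] by (subst (asm) nn_integral_0_iff_AE) auto
    then have "AE x in lebesgue. ennreal (norm x powr (- b) * norm (f x) powr p) = 0"
      by eventually_elim (simp add: ennreal_eq_0_iff)
    then have "weighted_energy b p f = 0"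
      using measurable_weighted_energy[OF data(2)[OF f]] by (subst nn_integral_0_iff_AE) auto
    then show ?thesis using True by (simp add: weighted_Lp_norm_eq[OF data(2)[OF f]])
  next
    case False
    define \<mu> where "\<mu> = ?N f"
    have \<mu>: "0 < \<mu>" using False data(5,6)[OF f] by (simp add: \<mu>_def)
    have le: "hom_sobolev_norm f \<le> \<mu>" "Lp_norm s f \<le> \<mu>" using data(5,6)[OF f] by (simp_all add: \<mu>_def)
    let ?f = "\<lambda>x. (1/\<mu>) *\<^sub>R f x"
    note w = has_weak_gradient_scaleR[OF data(1)[OF f], of "1/\<mu>"]
    have g2: "(\<integral>\<^sup>+x. ennreal ((norm ((1/\<mu>) *\<^sub>R weak_gradient f x))\<^sup>2) \<partial>lebesgue) \<le> ennreal (1\<^sup>2)"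
    proof -
      have gm: "weak_gradient f \<in> borel_measurable lebesgue"
        using data(1)[OF f] by (simp add: has_weak_gradient_def locally_integrable_def)
      have "(\<integral>\<^sup>+x. ennreal ((norm ((1/\<mu>) *\<^sub>R weak_gradient f x))\<^sup>2) \<partial>lebesgue)
        = (\<integral>\<^sup>+x. ennreal ((1/\<mu>)\<^sup>2) * ennreal ((norm (weak_gradient f x))\<^sup>2) \<partial>lebesgue)"
        by (intro nn_integral_cong) (simp add: power_mult_distrib ennreal_mult[symmetric] power_divide)
      also have "\<dots> = ennreal ((1/\<mu>)\<^sup>2) * L2_energy (weak_gradient f)"
        by (rule nn_integral_cmult) (use gm in measurable)
      also have "\<dots> = ennreal ((1/\<mu>)\<^sup>2 * (hom_sobolev_norm f)\<^sup>2)"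
        unfolding data(3)[OF f] by (simp add: ennreal_mult)
      also have "\<dots> \<le> ennreal (1\<^sup>2)"
      proof (rule ennreal_leI)
        have "(1/\<mu> * hom_sobolev_norm f)\<^sup>2 \<le> 1\<^sup>2"
          using \<mu> le data(5)[OF f] by (intro power_mono) auto
        then show "(1/\<mu>)\<^sup>2 * (hom_sobolev_norm f)\<^sup>2 \<le> 1\<^sup>2" by (simp only: power_mult_distrib)
      qed
      finally show ?thesis .
    qed
    have fs: "Lp_energy s ?f \<le> ennreal 1"
    proof -
      have "Lp_energy s ?f = ennreal ((1/\<mu>) powr s) * ennreal (Lp_norm s f powr s)"
        using weighted_energy_scaleR[OF data(2)[OF f], of "1/\<mu>" 0 s] \<mu> unfolding weighted_energy_0 data(4)[OF f] by simp
      also have "\<dots> = ennreal ((1/\<mu>) powr s * Lp_norm s f powr s)" by (simp add: ennreal_mult)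
      also have "\<dots> \<le> ennreal 1"
      proof (rule ennreal_leI)
        have "(1/\<mu> * Lp_norm s f) powr s \<le> 1 powr s"
          using \<mu> le data(6)[OF f] s by (intro powr_mono2) auto
        moreover have "(1/\<mu> * Lp_norm s f) powr s = (1/\<mu>) powr s * Lp_norm s f powr s"
          by (rule powr_mult)
        ultimately show "(1/\<mu>) powr s * Lp_norm s f powr s \<le> 1" by simp
      qed
      finally show ?thesis .
    qed
    have e: "ennreal ((1/\<mu>) powr p) * weighted_energy b p f \<le> ennreal E"
      using bd[rule_format, OF w g2 fs] weighted_energy_scaleR[OF data(2)[OF f], of "1/\<mu>" b p] \<mu> by simp
    obtain \<epsilon> where \<epsilon>: "0 \<le> \<epsilon>" "weighted_energy b p f = ennreal \<epsilon>"
      using finite[OF f] by (cases "weighted_energy b p f") auto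
    have "(1/\<mu>) powr p * \<epsilon> \<le> E"
      using e \<epsilon> E by (simp add: ennreal_mult[symmetric])
    then have "\<epsilon> \<le> E * \<mu> powr p"
      using \<mu> by (simp add: powr_divide field_simps)
    then have "\<epsilon> powr (1/p) \<le> (E * \<mu> powr p) powr (1/p)"
      using \<epsilon> p by (intro powr_mono2) auto
    also have "\<dots> = E powr (1/p) * (\<mu> powr p) powr (1/p)"
      by (rule powr_mult)
    also have "(\<mu> powr p) powr (1/p) = \<mu>"
      using \<mu> p by (simp add: powr_powr)
    finally show ?thesis
      using \<epsilon> by (simp add: weighted_Lp_norm_eq[OF data(2)[OF f]] \<mu>_def)
  qed

  have compact: "\<exists>l\<in>weighted_Lp_space b p. \<exists>r. strict_mono r \<and> (\<lambda>k. weighted_Lp_norm b p (\<lambda>x. u (r k) x - l x)) \<longlonglongrightarrow> 0"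
    if u: "\<And>n. u n \<in> ?X" and M: "\<And>n. ?N (u n) \<le> M" for u :: "nat \<Rightarrow> real^'n \<Rightarrow> complex" and M
  proof -
    have le: "hom_sobolev_norm (u n) \<le> M" "Lp_norm s (u n) \<le> M" for n
      using M[of n] data(5,6)[OF u[of n]] by linarith+
    have M0: "0 \<le> M" using le(1)[of 0] data(5)[OF u[of 0]] by linarith
    have g: "(\<integral>\<^sup>+y. ennreal ((norm (weak_gradient (u n) y))\<^sup>2) \<partial>lebesgue) \<le> ennreal (M\<^sup>2)" for n
      unfolding data(3)[OF u] using le(1) data(5)[OF u] by (intro ennreal_leI power_mono)
    have a: "Lp_energy s (u n) \<le> ennreal (M powr s)" for n
      unfolding data(4)[OF u] using le(2) data(6)[OF u] s by (intro ennreal_leI powr_mono2) auto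
    have Ms: "0 \<le> M powr s" by simp
    obtain l r where lm: "l \<in> borel_measurable lebesgue" and r: "strict_mono r"
      and lim: "(\<lambda>n. weighted_energy b p (\<lambda>x. u (r n) x - l x)) \<longlonglongrightarrow> 0"
      using bounded_sequence_has_convergent_subsequence[where u=u and g="\<lambda>n. weak_gradient (u n)", OF sc sc0 tc M0 Ms data(1)[OF u] g a]
      by (elim exE conjE) (rule that)
    have um: "u n \<in> borel_measurable lebesgue" for n by (rule data(2)[OF u])
    have dm: "(\<lambda>x. u (r n) x - l x) \<in> borel_measurable lebesgue" for n using um[of "r n"] lm by simp
    have "eventually (\<lambda>n. weighted_energy b p (\<lambda>x. u (r n) x - l x) < 1) sequentially"
      using lim by (intro order_tendstoD) auto
    then obtain n where n: "weighted_energy b p (\<lambda>x. u (r n) x - l x) < 1"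
      using eventually_happens by force
    have dm': "(\<lambda>x. l x - u (r n) x) \<in> borel_measurable lebesgue" using um[of "r n"] lm by simp
    have "weighted_energy b p (\<lambda>x. (l x - u (r n) x) + u (r n) x)
      \<le> ennreal (2 powr p) * (weighted_energy b p (\<lambda>x. l x - u (r n) x) + weighted_energy b p (u (r n)))"
      by (rule weighted_energy_add[OF dm' um]) (use p in simp)
    also have "\<dots> < \<infinity>"
    proof -
      have "weighted_energy b p (\<lambda>x. l x - u (r n) x) < \<infinity>"
        unfolding weighted_energy_minus_commute[where f=l] using n by (rule less_trans) simp
      then show ?thesis using finite[OF u[of "r n"]] by (simp add: ennreal_mult_less_top)
    qed
    finally have "weighted_energy b p l < \<infinity>" by simp
    then have l: "l \<in> weighted_Lp_space b p" by (rule weighted_Lp_spaceI[OF lm])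
    have "(\<lambda>n. enn2real (weighted_energy b p (\<lambda>x. u (r n) x - l x))) \<longlonglongrightarrow> 0"
      by (rule tendsto_enn2real) (use lim in simp_all)
    then have "(\<lambda>n. enn2real (weighted_energy b p (\<lambda>x. u (r n) x - l x)) powr (1/p)) \<longlonglongrightarrow> 0 powr (1/p)"
      using p by (intro tendsto_powr' tendsto_const) auto
    then have "(\<lambda>n. weighted_Lp_norm b p (\<lambda>x. u (r n) x - l x)) \<longlonglongrightarrow> 0"
      using p by (simp add: weighted_Lp_norm_eq[OF dm])
    then show ?thesis using l r by blast
  qed
  show ?thesis
    unfolding compact_embedding_def
  proof (intro conjI allI impI)
    show "\<exists>C. \<forall>f\<in>?X. weighted_Lp_norm b p f \<le> C * ?N f" using bounded by blast
    fix u :: "nat \<Rightarrow> real^'n \<Rightarrow> complex"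
    assume "(\<forall>n. u n \<in> ?X) \<and> (\<exists>M. \<forall>n. ?N (u n) \<le> M)"
    then obtain M where "\<And>n. u n \<in> ?X" "\<And>n. ?N (u n) \<le> M" by blast
    then show "\<exists>l\<in>weighted_Lp_space b p. \<exists>r. strict_mono r \<and> (\<lambda>k. weighted_Lp_norm b p (\<lambda>x. u (r k) x - l x)) \<longlonglongrightarrow> 0"
      by (rule compact)
  qed (rule sub)
qed

theorem proposition4p2:
  fixes b \<sigma> \<sigma>\<^sub>c :: real
  assumes "0 < b" and "b < 2"
    and "b < real CARD('n::finite)"
    and "(2 - b) / real CARD('n) < \<sigma>"
    and "CARD('n) \<ge> 3 \<Longrightarrow> \<sigma> < (2 - b) / (real CARD('n) - 2)"
    and "\<sigma>\<^sub>c = 2 * real CARD('n) * \<sigma> / (2 - b)"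
  shows "compact_embedding
    (hom_sobolev \<inter> Lp_space \<sigma>\<^sub>c :: (real^'n \<Rightarrow> complex) set)
    (\<lambda>f. hom_sobolev_norm f + Lp_norm \<sigma>\<^sub>c f)
    (weighted_Lp_space b (2 * \<sigma> + 2))
    (weighted_Lp_norm b (2 * \<sigma> + 2))"
proof -
  let ?N = "real CARD('n)"
  have N: "0 < ?N" by simp
  have \<sigma>1: "2 - b < \<sigma> * ?N" using assms(4) N by (simp add: divide_less_eq)
  have \<sigma>0: "0 < \<sigma>" using assms(2,4) N by (meson divide_pos_pos diff_gt_0_iff_gt less_trans)
  have \<sigma>2: "\<sigma> * (?N - 2) < 2 - b"
  proof (cases "CARD('n) \<ge> 3")
    case True
    then have "0 < ?N - 2" by simp
    then show ?thesis using assms(5)[OF True] by (simp add: less_divide_eq)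
  next
    case False
    then have "?N - 2 \<le> 0" by simp
    then have "\<sigma> * (?N - 2) \<le> 0" using \<sigma>0 by (simp add: mult_nonneg_nonpos)
    then show ?thesis using assms(2) by linarith
  qed
  \<comment> \<open>the three exponent conditions all reduce to \<open>\<sigma> (N - 2) < 2 - b\<close>, and the lower bound on
    \<open>\<sigma>\<close> says \<open>\<sigma>\<^sub>c > 2\<close>\<close>
  have sc: "subcritical TYPE('n) b (2 * \<sigma> + 2)"
    using assms(1,3) \<sigma>0 \<sigma>2 by (simp add: subcritical_def algebra_simps)
  have s2: "2 < \<sigma>\<^sub>c" unfolding assms(6) using assms(2) \<sigma>1 by (simp add: less_divide_eq mult.commute)
  have "0 < ?N - \<sigma>\<^sub>c * (?N / 2 - 1)"
  proof -
    have "?N * (\<sigma> * (?N - 2)) < ?N * (2 - b)" using \<sigma>2 N by (intro mult_strict_left_mono)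
    then have "?N * (\<sigma> * (?N - 2)) / (2 - b) < ?N" using assms(2) by (simp add: divide_less_eq)
    moreover have "\<sigma>\<^sub>c * (?N / 2 - 1) = ?N * (\<sigma> * (?N - 2)) / (2 - b)"
      unfolding assms(6) using assms(2) by (simp add: field_simps)
    ultimately show ?thesis by simp
  qed
  then have sc0: "subcritical TYPE('n) 0 \<sigma>\<^sub>c" using s2 N by (simp add: subcritical_def)
  have "?N * (2 * \<sigma> + 2) / \<sigma>\<^sub>c = (\<sigma> + 1) * (2 - b) / \<sigma>"
    unfolding assms(6) using assms(2) \<sigma>0 N by (simp add: field_simps)
  moreover have "?N - b < (\<sigma> + 1) * (2 - b) / \<sigma>"
    using \<sigma>0 \<sigma>2 by (simp add: less_divide_eq algebra_simps)
  ultimately have tc: "tail_controlled TYPE('n) b (2 * \<sigma> + 2) \<sigma>\<^sub>c"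
    using assms(1,3) \<sigma>0 s2 by (simp add: tail_controlled_def)
  show ?thesis by (rule compact_embedding_weighted[OF sc sc0 tc])
qed

end
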